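(* Let $n\ge 1$ be an integer. For each $m=0,1,2,\ldots$ there exists a unique $q$-difference operator $$B_m=\sum_{\gamma\in\mathbb N^n,\ |\gamma|\le m} b^{(m)}_\gamma(x)\,T_{q,x}^\gamma$$ of order $\le m$, with coefficients $b^{(m)}_\gamma(x)$ rational functions in $x=(x_1,\ldots,x_n)$ over $\mathbb Q(q,t)$, such that for every partition $\lambda=(\lambda_1,\lambda_2,\ldots)$ with $\ell(\lambda)\le n$ and $\lambda_1\le m$, $$B_m J_\lambda(x;q,t)=\begin{cases} J_{(m,\lambda)}(x;q,t) & \text{if } \ell(\lambda)<n,\\ 0 & \text{if } \ell(\lambda)=n.\end{cases}$$ Furthermore, the operator $B_m$ is invariant under the action of the symmetric group $\mathfrak S_n$ of degree $n$ permuting the variables $x_1,\ldots,x_n$.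
   Context: $q,t$ are indeterminates, $\mathbb K=\mathbb Q(q,t)$, $x=(x_1,\ldots,x_n)$, $\mathbb N=\{0,1,2,\ldots\}$. For $\gamma\in\mathbb N^n$: $|\gamma|=\gamma_1+\cdots+\gamma_n$, $T_{q,x}^\gamma=T_{q,x_1}^{\gamma_1}\cdots T_{q,x_n}^{\gamma_n}$, where $T_{q,x_i}$ is the $q$-shift operator $T_{q,x_i}f(x_1,\ldots,x_i,\ldots,x_n)=f(x_1,\ldots,qx_i,\ldots,x_n)$. An operator $B$ is invariant under $\mathfrak S_n$ if $w\circ B\circ w^{-1}=B$ for all $w\in\mathfrak S_n$, where $w$ acts on functions by permuting the variables. Macdonald polynomials: let $$D_x(u;q,t)=\sum_{K\subset\{1,\ldots,n\}}(-u)^{|K|}t^{\binom{|K|}{2}}\prod_{i\in K,\,j\notin K}\frac{1-t x_i/x_j}{1-x_i/x_j}\prod_{i\in K}T_{q,x_i}.$$ For a partition $\lambda$ with length $\ell(\lambda)\le n$, the Macdonald polynomial $P_\lambda(x;q,t)\in\mathbb K[x]^{\mathfrak S_n}$ is the symmetric polynomial satisfying $D_x(u;q,t)P_\lambda=P_\lambda\prod_{i=1}^n(1-uq^{\lambda_i}t^{n-i})$, normalized so that the coefficient of $x^\lambda$ is $1$. Its integral form is $J_\lambda(x;q,t)=c_\lambda P_\lambda(x;q,t)$ with $c_\lambda=\prod_{s\in\lambda}(1-q^{a(s)}t^{l(s)+1})$, where $a(s),l(s)$ are the arm-length and leg-length of the box $s$ in the Young diagram of $\lambda$. For a partition $\lambda$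 with $\lambda_1\le m$, $(m,\lambda)=(m,\lambda_1,\lambda_2,\ldots)$ is the partition obtained by adding a row of length $m$. *)

theory Defs
  imports
    "HOL-Library.Poly_Mapping"
    "HOL-Computational_Algebra.Polynomial_Factorial"
    "HOL-Combinatorics.Permutations"
begin

type_synonym coef = "rat poly poly fract"

text \<open>
  The field \<open>\<rat>(q,t)\<close>, obtained as the fraction field of \<open>\<rat>[q][t]\<close>.
\<close>

definition indet_q :: coef where
  "indet_q = to_fract [:[:0, 1:]:]"

definition indet_t :: coef where
  "indet_t = to_fract [:0, 1:]"

text \<open>
  Polynomials and rational functions live over the countably many variables
  \<open>x\<^sub>0, x\<^sub>1, \<dots>\<close>; those in the first \<open>n\<close> of them, \<open>x\<^sub>0, \<dots>, x\<^sub>n\<^sub>-\<^sub>1\<close>, are singled out by the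
  sets \<open>mpolys n\<close> and \<open>ratfuns n\<close>.  Thus all indices are shifted down by one from
  the usual \<open>x\<^sub>1, \<dots>, x\<^sub>n\<close>, and the parts of a partition \<open>\<mu>\<close> are \<open>\<mu> 0 \<ge> \<mu> 1 \<ge> \<dots>\<close>.
\<close>

type_synonym mpol = "(nat \<Rightarrow>\<^sub>0 nat) \<Rightarrow>\<^sub>0 coef"
type_synonym ratfun = "mpol fract"

definition mpolys :: "nat \<Rightarrow> mpol set" where
  "mpolys n = {p. \<forall>e \<in> Poly_Mapping.keys p. Poly_Mapping.keys e \<subseteq> {..<n}}"

definition ratfuns :: "nat \<Rightarrow> ratfun set" where
  "ratfuns n = {to_fract a / to_fract b | a b. a \<in> mpolys n \<and> b \<in> mpolys n \<and> b \<noteq> 0}"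

definition const :: "coef \<Rightarrow> ratfun" where
  "const c = to_fract (Poly_Mapping.single 0 c)"

definition var :: "nat \<Rightarrow> ratfun" where
  "var i = to_fract (Poly_Mapping.single (Poly_Mapping.single i 1) 1)"

definition mpol_subst :: "(nat \<Rightarrow> ratfun) \<Rightarrow> mpol \<Rightarrow> ratfun" where
  "mpol_subst \<sigma> p =
     (\<Sum>e \<in> Poly_Mapping.keys p. const (Poly_Mapping.lookup p e) *
        (\<Prod>i \<in> Poly_Mapping.keys e. \<sigma> i ^ Poly_Mapping.lookup e i))"

text \<open>
  Substitution \<open>f(x\<^sub>0, x\<^sub>1, \<dots>) \<mapsto> f(\<sigma> 0, \<sigma> 1, \<dots>)\<close>.  The value does not depend on the chosen
  representation of \<open>f\<close> as a fraction, and a representation with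
  \<open>mpol_subst \<sigma> b \<noteq> 0\<close> exists for every \<open>f\<close> if \<open>\<sigma>\<close> rescales the variables by nonzero
  constants or permutes them, the only cases used.
\<close>

definition ratfun_subst :: "(nat \<Rightarrow> ratfun) \<Rightarrow> ratfun \<Rightarrow> ratfun" where
  "ratfun_subst \<sigma> f =
     (THE g. \<exists>a b. mpol_subst \<sigma> b \<noteq> 0 \<and> f = to_fract a / to_fract b \<and>
                   g = mpol_subst \<sigma> a / mpol_subst \<sigma> b)"

definition qshift :: "nat \<Rightarrow> ratfun \<Rightarrow> ratfun" where
  "qshift i = ratfun_subst (var(i := const indet_q * var i))"

definition perm_act :: "(nat \<Rightarrow> nat) \<Rightarrow> ratfun \<Rightarrow> ratfun" where
  "perm_act w = ratfun_subst (\<lambda>i. var (w i))"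

text \<open>
  \<open>multi_qshift n \<gamma>\<close> is \<open>T\<^sub>0\<^bsup>\<gamma> 0\<^esup> \<circ> \<dots> \<circ> T\<^sub>n\<^sub>-\<^sub>1\<^bsup>\<gamma> (n - 1)\<^esup>\<close>, where \<open>T\<^sub>i = qshift i\<close>.
\<close>

definition multi_qshift :: "nat \<Rightarrow> (nat \<Rightarrow> nat) \<Rightarrow> ratfun \<Rightarrow> ratfun" where
  "multi_qshift n \<gamma> = foldr (\<lambda>i. qshift i ^^ \<gamma> i) [0..<n]"

text \<open>
  \<open>\<gamma> \<in> \<nat>\<^sup>n\<close> is encoded as a function vanishing outside \<open>{..<n}\<close>.
\<close>

definition multi_indices :: "nat \<Rightarrow> nat \<Rightarrow> (nat \<Rightarrow> nat) set" where
  "multi_indices n m = {\<gamma>. (\<forall>i\<ge>n. \<gamma> i = 0) \<and> (\<Sum>i<n. \<gamma> i) \<le> m}"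

text \<open>
  The coefficients only involve the first \<open>n\<close> variables.  Such an operator is determined by its
  coefficients, hence by its restriction to \<open>ratfuns n\<close>, so comparing operators on
  the whole type \<open>ratfun\<close> is the same as comparing them on \<open>ratfuns n\<close>.
\<close>

definition is_qdiff_operator :: "nat \<Rightarrow> nat \<Rightarrow> (ratfun \<Rightarrow> ratfun) \<Rightarrow> bool" where
  "is_qdiff_operator n m B \<longleftrightarrow>
     (\<exists>b. (\<forall>\<gamma> \<in> multi_indices n m. b \<gamma> \<in> ratfuns n) \<and>
          B = (\<lambda>f. \<Sum>\<gamma> \<in> multi_indices n m. b \<gamma> * multi_qshift n \<gamma> f))"

definition perm_invariant :: "nat \<Rightarrow> (ratfun \<Rightarrow> ratfun) \<Rightarrow> bool" where
  "perm_invariant n B \<longleftrightarrow>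
     (\<forall>w. w permutes {..<n} \<longrightarrow> perm_act w \<circ> B \<circ> perm_act (inv w) = B)"

definition is_partition :: "(nat \<Rightarrow> nat) \<Rightarrow> bool" where
  "is_partition \<mu> \<longleftrightarrow> antimono \<mu> \<and> finite {i. \<mu> i \<noteq> 0}"

definition part_length :: "(nat \<Rightarrow> nat) \<Rightarrow> nat" where
  "part_length \<mu> = card {i. \<mu> i \<noteq> 0}"

definition add_row :: "nat \<Rightarrow> (nat \<Rightarrow> nat) \<Rightarrow> nat \<Rightarrow> nat" where
  "add_row m \<mu> = case_nat m \<mu>"

definition boxes :: "(nat \<Rightarrow> nat) \<Rightarrow> (nat \<times> nat) set" where
  "boxes \<mu> = {(i, j). j < \<mu> i}"

definition arm :: "(nat \<Rightarrow> nat) \<Rightarrow> nat \<times> nat \<Rightarrow> nat" where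
  "arm \<mu> = (\<lambda>(i, j). card {j'. j < j' \<and> (i, j') \<in> boxes \<mu>})"

definition leg :: "(nat \<Rightarrow> nat) \<Rightarrow> nat \<times> nat \<Rightarrow> nat" where
  "leg \<mu> = (\<lambda>(i, j). card {i'. i < i' \<and> (i', j) \<in> boxes \<mu>})"

text \<open>
  \<open>macdonald_D n f\<close> is \<open>D\<^sub>x(u;q,t) f\<close> as a polynomial in the indeterminate \<open>u\<close>
  with coefficients in \<open>ratfun\<close>.
\<close>

definition macdonald_D :: "nat \<Rightarrow> ratfun \<Rightarrow> ratfun poly" where
  "macdonald_D n f =
     (\<Sum>K \<in> Pow {..<n}.
        (- [:0, 1:]) ^ card K *
        [: const indet_t ^ (card K choose 2) *
           (\<Prod>i \<in> K. \<Prod>j \<in> {..<n} - K.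
              (1 - const indet_t * var i / var j) / (1 - var i / var j)) *
           multi_qshift n (\<lambda>i. if i \<in> K then 1 else 0) f :])"

definition is_symmetric :: "nat \<Rightarrow> mpol \<Rightarrow> bool" where
  "is_symmetric n p \<longleftrightarrow> (\<forall>w. w permutes {..<n} \<longrightarrow> perm_act w (to_fract p) = to_fract p)"

definition is_macdonald_P :: "nat \<Rightarrow> (nat \<Rightarrow> nat) \<Rightarrow> mpol \<Rightarrow> bool" where
  "is_macdonald_P n \<mu> p \<longleftrightarrow>
     p \<in> mpolys n \<and> is_symmetric n p \<and>
     macdonald_D n (to_fract p) =
       smult (to_fract p) (\<Prod>i<n. 1 - [:0, 1:] * [: const (indet_q ^ \<mu> i * indet_t ^ (n - Suc i)) :]) \<and>
     Poly_Mapping.lookup p (Abs_poly_mapping \<mu>) = 1"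

text \<open>
  For a partition of length at most \<open>n\<close> there is exactly one such polynomial; for other
  arguments \<open>macdonald_P\<close> is irrelevant.
\<close>

definition macdonald_P :: "nat \<Rightarrow> (nat \<Rightarrow> nat) \<Rightarrow> mpol" where
  "macdonald_P n \<mu> = (THE p. is_macdonald_P n \<mu> p)"

definition macdonald_J :: "nat \<Rightarrow> (nat \<Rightarrow> nat) \<Rightarrow> ratfun" where
  "macdonald_J n \<mu> =
     const (\<Prod>s \<in> boxes \<mu>. 1 - indet_q ^ arm \<mu> s * indet_t ^ (leg \<mu> s + 1)) *
     to_fract (macdonald_P n \<mu>)"

definition row_raising :: "nat \<Rightarrow> nat \<Rightarrow> (ratfun \<Rightarrow> ratfun) \<Rightarrow> bool" where
  "row_raising n m B \<longleftrightarrow>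
     (\<forall>\<mu>. is_partition \<mu> \<and> part_length \<mu> \<le> n \<and> \<mu> 0 \<le> m \<longrightarrow>
        B (macdonald_J n \<mu>) =
          (if part_length \<mu> < n then macdonald_J n (add_row m \<mu>) else 0))"

end

theory Submission
  imports Defs "HOL-Library.FuncSet"
begin

text \<open>
  The number of \<open>\<gamma> \<in> \<nat>\<^sup>n\<close> with \<open>|\<gamma>| \<le> m\<close> equals the number of partitions in the
  \<open>n \<times> m\<close> box (take partial sums of \<open>\<gamma>\<close>).  So the conditions on the coefficients of \<open>B\<^sub>m\<close>
  form a square linear system with matrix \<open>T\<^sup>\<gamma> J\<^sub>\<lambda>\<close>, and existence and uniqueness both
  follow once the homogeneous system has only the trivial solution.  Invariance follows from
  uniqueness: all \<open>J\<^sub>\<lambda>\<close> are symmetric, so \<open>w B\<^sub>m w\<^sup>-\<^sup>1\<close> solves the same system.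

  The homogeneous system is treated by interpolation.  An operator \<open>\<Sum> b\<^sub>\<gamma> T\<^sup>\<gamma>\<close> that
  kills every symmetric polynomial of degree at most \<open>m\<close> in each variable satisfies
  \<open>\<Sum> b\<^sub>\<gamma> C(q\<^bsup>\<gamma> 0\<^esup> x\<^sub>0) C(q\<^bsup>\<gamma> 1\<^esup> x\<^sub>1) \<dots> = 0\<close> for every one-variable polynomial
  \<open>C\<close> of degree at most \<open>m\<close> whose coefficients are rational functions of \<open>x\<close>.  The choice of
  \<open>C\<close> as the product of \<open>z - q\<^sup>k x\<^sub>j\<close> over all \<open>j\<close> and all \<open>k < \<delta> j\<close> makes the \<open>\<gamma>\<close>-th product
  nonzero exactly when \<open>\<delta> \<le> \<gamma>\<close> componentwise.  If \<open>|\<delta>|\<close> is maximal with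
  \<open>b\<^sub>\<delta> \<noteq> 0\<close>, only the term \<open>\<gamma> = \<delta>\<close> survives, which is a contradiction
  (\<open>qdiff_vanishes_on_products\<close>, \<open>qdiff_coefficients_eq_0\<close>).

  It remains to see that the Macdonald polynomials \<open>P\<^sub>\<lambda>\<close> exist, are unique, and for \<open>\<lambda>\<close> in
  the box span the symmetric polynomials of degree at most \<open>m\<close> in each variable.  Let
  \<open>D\<^sub>r\<close> be the coefficient of \<open>(-u)\<^sup>r\<close> in Macdonald's operator.  Three facts are used.

  \<^item> \<open>D\<^sub>r\<close> preserves symmetric polynomials, because \<open>\<Delta> D\<^sub>r f\<close> is a polynomial for the
    Vandermonde product \<open>\<Delta>\<close> and the simple poles along \<open>x\<^sub>k = x\<^sub>l\<close> of a symmetric function cancel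
    (\<open>macdonald_op_symmetric_pols\<close>).
  \<^item> \<open>D\<^sub>r\<close> is triangular for the lexicographic order of monomials, because \<open>\<Delta> D\<^sub>r f\<close> is a
    sum of products of rescaled copies of \<open>\<Delta>\<close> and \<open>f\<close>, whose leading terms multiply
    (\<open>leading_term_macdonald_op\<close>).  The eigenvalues of \<open>D\<^sub>1\<close> on different partitions differ, so
    \<open>D\<^sub>1\<close> is diagonalisable with one-dimensional eigenspaces.
  \<^item> \<open>D\<^sub>1\<close> commutes with \<open>D\<^sub>r\<close> (\<open>macdonald_op_commute\<close>).  So the eigenfunctions of \<open>D\<^sub>1\<close> are
    eigenfunctions of the whole family.  The commutation reduces to an identity of rational
    functions that is a Lagrange interpolation formula (\<open>macdonald_factor_exchange\<close>).
\<close>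

section \<open>Evaluation of polynomials\<close>

lemma const_0 [simp]: "const 0 = 0"
  by (simp add: const_def)

lemma const_1 [simp]: "const 1 = 1"
  by (simp add: const_def)

lemma const_add: "const (a + b) = const a + const b"
  by (simp add: const_def single_add)

lemma const_mult: "const (a * b) = const a * const b"
  by (simp add: const_def mult_single flip: to_fract_mult)

lemma const_eq_iff [simp]: "const a = const b \<longleftrightarrow> a = b"
  by (metis const_def inj_single injD to_fract_eq_iff)

lemma const_eq_0_iff [simp]: "const a = 0 \<longleftrightarrow> a = 0"
  using const_eq_iff[of a 0] by (simp del: const_eq_iff)

lemma const_power: "const (a ^ k) = const a ^ k"
  by (induction k) (simp_all add: const_mult)

lemma const_sum: "const (\<Sum>i\<in>A. f i) = (\<Sum>i\<in>A. const (f i))"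
  by (induction A rule: infinite_finite_induct) (simp_all add: const_add)

lemma const_prod: "const (\<Prod>i\<in>A. f i) = (\<Prod>i\<in>A. const (f i))"
  by (induction A rule: infinite_finite_induct) (simp_all add: const_mult)

lemma const_minus: "const (- a) = - const a"
  using const_add[of a "- a"] by (simp add: eq_neg_iff_add_eq_0 add.commute)

lemma const_diff: "const (a - b) = const a - const b"
  using const_add[of a "- b"] by (simp add: const_minus)

lemma const_inverse: "const (inverse a) = inverse (const a)"
proof (cases "a = 0")
  case False
  then have "const a * const (inverse a) = 1"
    by (simp flip: const_mult)
  then show ?thesis
    by (simp add: inverse_unique)
qed simp

definition monom_eval :: "(nat \<Rightarrow> ratfun) \<Rightarrow> (nat \<Rightarrow>\<^sub>0 nat) \<Rightarrow> ratfun" where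
  "monom_eval \<sigma> e = (\<Prod>i \<in> Poly_Mapping.keys e. \<sigma> i ^ Poly_Mapping.lookup e i)"

lemma monom_eval_superset:
  assumes "finite A" "Poly_Mapping.keys e \<subseteq> A"
  shows "monom_eval \<sigma> e = (\<Prod>i\<in>A. \<sigma> i ^ Poly_Mapping.lookup e i)"
  unfolding monom_eval_def
  by (rule prod.mono_neutral_left) (use assms in \<open>auto simp: in_keys_iff\<close>)

lemma monom_eval_0 [simp]: "monom_eval \<sigma> 0 = 1"
  by (simp add: monom_eval_def)

lemma monom_eval_single [simp]: "monom_eval \<sigma> (Poly_Mapping.single i k) = \<sigma> i ^ k"
  by (cases "k = 0") (simp_all add: monom_eval_def)

lemma monom_eval_add: "monom_eval \<sigma> (e + f) = monom_eval \<sigma> e * monom_eval \<sigma> f"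
proof -
  let ?A = "Poly_Mapping.keys e \<union> Poly_Mapping.keys f"
  have "monom_eval \<sigma> (e + f) = (\<Prod>i\<in>?A. \<sigma> i ^ Poly_Mapping.lookup (e + f) i)"
    by (rule monom_eval_superset) (auto simp: Poly_Mapping.keys_add)
  also have "\<dots> = (\<Prod>i\<in>?A. \<sigma> i ^ Poly_Mapping.lookup e i) * (\<Prod>i\<in>?A. \<sigma> i ^ Poly_Mapping.lookup f i)"
    by (simp add: lookup_add power_add prod.distrib)
  also have "\<dots> = monom_eval \<sigma> e * monom_eval \<sigma> f"
    by (simp add: monom_eval_superset[of ?A])
  finally show ?thesis .
qed

lemma mpol_subst_superset:
  assumes "finite A" "Poly_Mapping.keys p \<subseteq> A"
  shows "mpol_subst \<sigma> p = (\<Sum>e\<in>A. const (Poly_Mapping.lookup p e) * monom_eval \<sigma> e)"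
  unfolding mpol_subst_def monom_eval_def[symmetric]
  by (rule sum.mono_neutral_left) (use assms in \<open>auto simp: in_keys_iff\<close>)

lemma mpol_subst_0 [simp]: "mpol_subst \<sigma> 0 = 0"
  by (simp add: mpol_subst_def)

lemma mpol_subst_single [simp]:
  "mpol_subst \<sigma> (Poly_Mapping.single e c) = const c * monom_eval \<sigma> e"
  using mpol_subst_superset[of "{e}" "Poly_Mapping.single e c"] by simp

lemma mpol_subst_1 [simp]: "mpol_subst \<sigma> 1 = 1"
  using mpol_subst_single[of \<sigma> 0 1] by (simp del: mpol_subst_single)

lemma mpol_subst_add: "mpol_subst \<sigma> (p + r) = mpol_subst \<sigma> p + mpol_subst \<sigma> r"
proof -
  let ?A = "Poly_Mapping.keys p \<union> Poly_Mapping.keys r"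
  have "mpol_subst \<sigma> (p + r) =
      (\<Sum>e\<in>?A. const (Poly_Mapping.lookup (p + r) e) * monom_eval \<sigma> e)"
    by (rule mpol_subst_superset) (auto simp: Poly_Mapping.keys_add)
  also have "\<dots> = (\<Sum>e\<in>?A. const (Poly_Mapping.lookup p e) * monom_eval \<sigma> e)
      + (\<Sum>e\<in>?A. const (Poly_Mapping.lookup r e) * monom_eval \<sigma> e)"
    by (simp add: lookup_add const_add distrib_right sum.distrib)
  also have "\<dots> = mpol_subst \<sigma> p + mpol_subst \<sigma> r"
    by (simp add: mpol_subst_superset[of ?A])
  finally show ?thesis .
qed

lemma poly_mapping_add_induct [case_names single add]:
  fixes p :: "'a \<Rightarrow>\<^sub>0 'b::comm_monoid_add"
  assumes "\<And>e c. P (Poly_Mapping.single e c)"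
    and "\<And>p r. P p \<Longrightarrow> P r \<Longrightarrow> P (p + r)"
  shows "P p"
proof (induction p rule: update_induct)
  case const
  show ?case using assms(1)[of undefined 0] by simp
next
  case (update p e c)
  have "Poly_Mapping.update e c p = p + Poly_Mapping.single e c"
    using update by (intro poly_mapping_eqI)
      (auto simp: lookup_update lookup_add lookup_single when_def in_keys_iff)
  then show ?case
    using assms update by simp
qed

lemma mpol_subst_mult: "mpol_subst \<sigma> (p * r) = mpol_subst \<sigma> p * mpol_subst \<sigma> r"
proof (induction p rule: poly_mapping_add_induct)
  case (single e c)
  show ?case
    by (induction r rule: poly_mapping_add_induct)
       (simp_all add: mult_single const_mult monom_eval_add mpol_subst_add distrib_left)
next
  case (add p p')
  then show ?case
    by (simp add: distrib_right mpol_subst_add)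
qed

lemma mpol_subst_power: "mpol_subst \<sigma> (p ^ k) = mpol_subst \<sigma> p ^ k"
  by (induction k) (simp_all add: mpol_subst_mult)

lemma mpol_subst_prod: "mpol_subst \<sigma> (\<Prod>i\<in>A. p i) = (\<Prod>i\<in>A. mpol_subst \<sigma> (p i))"
  by (induction A rule: infinite_finite_induct) (simp_all add: mpol_subst_mult)

lemma mpol_subst_minus: "mpol_subst \<sigma> (- p) = - mpol_subst \<sigma> p"
  using mpol_subst_add[of \<sigma> p "- p"] by (simp add: eq_neg_iff_add_eq_0 add.commute)

lemma mpol_subst_diff: "mpol_subst \<sigma> (p - r) = mpol_subst \<sigma> p - mpol_subst \<sigma> r"
  using mpol_subst_add[of \<sigma> p "- r"] by (simp add: mpol_subst_minus)

lemma to_fract_power: "to_fract (p ^ k) = to_fract p ^ k"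
  by (induction k) simp_all

lemma to_fract_prod: "to_fract (\<Prod>i\<in>A. f i) = (\<Prod>i\<in>A. to_fract (f i))"
  by (induction A rule: infinite_finite_induct) simp_all

lemma to_fract_single: "to_fract (Poly_Mapping.single e c) = const c * monom_eval var e"
proof -
  have *: "to_fract (Poly_Mapping.single e 1) = monom_eval var e"
  proof (induction e rule: poly_mapping_add_induct)
    case (single i k)
    have "Poly_Mapping.single (Poly_Mapping.single i k) (1::coef)
        = Poly_Mapping.single (Poly_Mapping.single i 1) 1 ^ k"
    proof (induction k)
      case (Suc k)
      have "Poly_Mapping.single i (Suc k) = Poly_Mapping.single i 1 + Poly_Mapping.single i k"
        by (simp flip: single_add)
      then show ?case
        using mult_single[of "Poly_Mapping.single i 1" "1::coef" "Poly_Mapping.single i k" 1] Suc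
        by simp
    qed simp
    then show ?case by (simp add: var_def to_fract_power)
  next
    case (add e f)
    have "Poly_Mapping.single (e + f) (1::coef) = Poly_Mapping.single e 1 * Poly_Mapping.single f 1"
      by (simp add: mult_single)
    then show ?case using add by (simp add: monom_eval_add)
  qed
  have "Poly_Mapping.single e c = Poly_Mapping.single 0 c * Poly_Mapping.single e (1::coef)"
    by (simp add: mult_single)
  then show ?thesis using * by (simp add: const_def)
qed

lemma mpol_subst_var: "mpol_subst var p = to_fract p"
  by (induction p rule: poly_mapping_add_induct)
     (simp_all add: to_fract_single mpol_subst_add)

text \<open>
  Two successive substitutions compose if the first one sends variables to polynomials.  A
  polynomial \<open>p'\<close> is needed as an intermediate object because \<open>mpol_subst\<close> takes values in the
  field of fractions but accepts only polynomials.
\<close>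

lemma mpol_subst_comp:
  "\<exists>p'. to_fract p' = mpol_subst (\<lambda>i. to_fract (s i)) p \<and>
        mpol_subst \<tau> p' = mpol_subst (\<lambda>i. mpol_subst \<tau> (s i)) p"
proof (induction p rule: poly_mapping_add_induct)
  case (single e c)
  let ?p = "Poly_Mapping.single 0 c *
    (\<Prod>i \<in> Poly_Mapping.keys e. s i ^ Poly_Mapping.lookup e i)"
  show ?case
    by (rule exI[of _ ?p])
      (simp add: mpol_subst_mult mpol_subst_prod mpol_subst_power monom_eval_def to_fract_prod
        to_fract_power const_def)
next
  case (add p r)
  then obtain p' r' where "to_fract p' = mpol_subst (\<lambda>i. to_fract (s i)) p"
      "mpol_subst \<tau> p' = mpol_subst (\<lambda>i. mpol_subst \<tau> (s i)) p"
      "to_fract r' = mpol_subst (\<lambda>i. to_fract (s i)) r"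
      "mpol_subst \<tau> r' = mpol_subst (\<lambda>i. mpol_subst \<tau> (s i)) r" by blast
  then show ?case by (intro exI[of _ "p' + r'"]) (simp add: mpol_subst_add)
qed

section \<open>Substitutions as field homomorphisms\<close>

text \<open>
  Endomorphisms of the field of rational functions over \<open>\<rat>(q,t)\<close>.  They are determined by the
  images of the variables, which is how all identities between shifts and permutations are proved.
\<close>

definition khom :: "(ratfun \<Rightarrow> ratfun) \<Rightarrow> bool" where
  "khom h \<longleftrightarrow> (\<forall>f g. h (f + g) = h f + h g) \<and> (\<forall>f g. h (f * g) = h f * h g) \<and>
     (\<forall>c. h (const c) = const c)"

lemma khom_add: "khom h \<Longrightarrow> h (f + g) = h f + h g"
  and khom_mult: "khom h \<Longrightarrow> h (f * g) = h f * h g"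
  and khom_const: "khom h \<Longrightarrow> h (const c) = const c"
  by (simp_all add: khom_def)

lemma khom_0: "khom h \<Longrightarrow> h 0 = 0"
  using khom_const[of h 0] by simp

lemma khom_1: "khom h \<Longrightarrow> h 1 = 1"
  using khom_const[of h 1] by simp

lemma khom_minus:
  assumes "khom h" shows "h (- f) = - h f"
  using khom_add[OF assms, of f "- f"] khom_0[OF assms] by (simp add: eq_neg_iff_add_eq_0 add.commute)

lemma khom_diff:
  assumes "khom h" shows "h (f - g) = h f - h g"
  using khom_add[OF assms, of f "- g"] by (simp add: khom_minus[OF assms])

lemma khom_eq_0_iff:
  assumes "khom h" shows "h f = 0 \<longleftrightarrow> f = 0"
proof
  assume "h f = 0"
  show "f = 0"
  proof (rule ccontr)
    assume "f \<noteq> 0"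
    then have "h f * h (inverse f) = 1"
      by (simp add: khom_1[OF assms] flip: khom_mult[OF assms])
    then show False using \<open>h f = 0\<close> by simp
  qed
qed (simp add: khom_0[OF assms])

lemma khom_divide:
  assumes "khom h" shows "h (f / g) = h f / h g"
proof (cases "g = 0")
  case False
  have "h (f / g) * h g = h f"
    using False by (simp flip: khom_mult[OF assms])
  then show ?thesis using False by (simp add: khom_eq_0_iff[OF assms] field_simps)
qed (simp add: khom_0[OF assms])

lemma khom_power:
  assumes "khom h" shows "h (f ^ k) = h f ^ k"
  by (induction k) (simp_all add: khom_1[OF assms] khom_mult[OF assms])

lemma khom_sum:
  assumes "khom h" shows "h (\<Sum>i\<in>A. f i) = (\<Sum>i\<in>A. h (f i))"
  by (induction A rule: infinite_finite_induct) (simp_all add: khom_0[OF assms] khom_add[OF assms])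

lemma khom_prod:
  assumes "khom h" shows "h (\<Prod>i\<in>A. f i) = (\<Prod>i\<in>A. h (f i))"
  by (induction A rule: infinite_finite_induct) (simp_all add: khom_1[OF assms] khom_mult[OF assms])

lemmas khom_simps = khom_add khom_mult khom_const khom_0 khom_1 khom_minus khom_diff khom_divide
  khom_power khom_sum khom_prod

lemma khom_comp: "khom h \<Longrightarrow> khom h' \<Longrightarrow> khom (h \<circ> h')"
  by (simp add: khom_def)

lemma khom_id: "khom (\<lambda>x. x)" "khom id"
  by (simp_all add: khom_def)

lemma khom_monom_eval:
  assumes "khom h" shows "h (monom_eval \<sigma> e) = monom_eval (h \<circ> \<sigma>) e"
  by (simp add: monom_eval_def khom_prod[OF assms] khom_power[OF assms])

lemma khom_to_fract:
  assumes "khom h"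
  shows "h (to_fract p) = mpol_subst (h \<circ> var) p"
  by (induction p rule: poly_mapping_add_induct)
     (simp_all add: to_fract_single khom_simps[OF assms] khom_monom_eval[OF assms] mpol_subst_add o_def)

lemma ratfun_cases:
  fixes f :: ratfun
  obtains a b where "f = to_fract a / to_fract b" "b \<noteq> 0"
proof -
  obtain a b where "f = Fract a b" "b \<noteq> 0" by (rule Fract_cases[of f])
  then show ?thesis using that[of a b] unfolding Fract_conv_to_fract by blast
qed
lemma khom_eqI:
  assumes "khom h" "khom h'" "\<And>i. h (var i) = h' (var i)"
  shows "h = h'"
proof
  fix f :: ratfun
  obtain a b where "f = to_fract a / to_fract b" "b \<noteq> 0" by (rule ratfun_cases[of f])
  moreover have "h \<circ> var = h' \<circ> var" using assms(3) by auto
  ultimately show "h f = h' f"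
    by (simp only: khom_divide[OF assms(1)] khom_divide[OF assms(2)] khom_to_fract[OF assms(1)]
        khom_to_fract[OF assms(2)])
qed

lemma ratfun_subst_frac:
  assumes "mpol_subst \<sigma> b \<noteq> 0"
  shows "ratfun_subst \<sigma> (to_fract a / to_fract b) = mpol_subst \<sigma> a / mpol_subst \<sigma> b"
  unfolding ratfun_subst_def
proof (rule the_equality)
  show "\<exists>a' b'. mpol_subst \<sigma> b' \<noteq> 0 \<and> to_fract a / to_fract b = to_fract a' / to_fract b' \<and>
      mpol_subst \<sigma> a / mpol_subst \<sigma> b = mpol_subst \<sigma> a' / mpol_subst \<sigma> b'"
    using assms by blast
next
  fix g
  assume "\<exists>a' b'. mpol_subst \<sigma> b' \<noteq> 0 \<and> to_fract a / to_fract b = to_fract a' / to_fract b' \<and>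
      g = mpol_subst \<sigma> a' / mpol_subst \<sigma> b'"
  then obtain a' b' where *: "mpol_subst \<sigma> b' \<noteq> 0"
      "to_fract a / to_fract b = to_fract a' / to_fract b'"
      "g = mpol_subst \<sigma> a' / mpol_subst \<sigma> b'" by blast
  have "b \<noteq> 0" "b' \<noteq> 0" using * assms by auto
  then have "to_fract (a * b') = to_fract (a' * b)"
    using *(2) by (simp add: field_simps)
  then have "a * b' = a' * b" by (simp only: to_fract_eq_iff)
  then have "mpol_subst \<sigma> (a * b') = mpol_subst \<sigma> (a' * b)" by (rule arg_cong)
  then show "g = mpol_subst \<sigma> a / mpol_subst \<sigma> b"
    using *(1,3) assms by (simp add: mpol_subst_mult frac_eq_eq)
qed

lemma ratfun_subst_to_fract: "ratfun_subst \<sigma> (to_fract a) = mpol_subst \<sigma> a"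
  using ratfun_subst_frac[of \<sigma> 1 a] by simp

lemma ratfun_subst_var [simp]: "ratfun_subst \<sigma> (var i) = \<sigma> i"
  by (simp add: var_def ratfun_subst_to_fract)

text \<open>
  An injective substitution never makes a denominator vanish, so the fraction-wise definition of
  \<open>ratfun_subst\<close> is everywhere meaningful.
\<close>

lemma khom_ratfun_subst:
  assumes "\<And>p. mpol_subst \<sigma> p = 0 \<Longrightarrow> p = 0"
  shows "khom (ratfun_subst \<sigma>)"
proof -
  have nz: "mpol_subst \<sigma> p \<noteq> 0" if "p \<noteq> 0" for p using assms that by blast
  have "ratfun_subst \<sigma> (f + g) = ratfun_subst \<sigma> f + ratfun_subst \<sigma> g \<and>
        ratfun_subst \<sigma> (f * g) = ratfun_subst \<sigma> f * ratfun_subst \<sigma> g" for f g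
  proof -
    obtain a b where f: "f = to_fract a / to_fract b" "b \<noteq> 0" by (rule ratfun_cases[of f])
    obtain c d where g: "g = to_fract c / to_fract d" "d \<noteq> 0" by (rule ratfun_cases[of g])
    have 1: "f + g = to_fract (a * d + c * b) / to_fract (b * d)"
      and 2: "f * g = to_fract (a * c) / to_fract (b * d)"
      using f g by (simp_all add: field_simps)
    have "b * d \<noteq> 0" using f g by simp
    note nz' = nz[OF this]
    have 3: "ratfun_subst \<sigma> (f + g) = mpol_subst \<sigma> (a * d + c * b) / mpol_subst \<sigma> (b * d)"
      "ratfun_subst \<sigma> (f * g) = mpol_subst \<sigma> (a * c) / mpol_subst \<sigma> (b * d)"
      unfolding 1 2 by (rule ratfun_subst_frac[OF nz'])+
    have 4: "ratfun_subst \<sigma> f = mpol_subst \<sigma> a / mpol_subst \<sigma> b"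
      "ratfun_subst \<sigma> g = mpol_subst \<sigma> c / mpol_subst \<sigma> d"
      unfolding f(1) g(1) by (rule ratfun_subst_frac[OF nz[OF f(2)]], rule ratfun_subst_frac[OF nz[OF g(2)]])
    show ?thesis unfolding 3 4
      using nz[OF f(2)] nz[OF g(2)] by (simp add: mpol_subst_mult mpol_subst_add field_simps)
  qed
  moreover have "ratfun_subst \<sigma> (const c) = const c" for c
    unfolding const_def[of c] ratfun_subst_to_fract by (simp flip: const_def)
  ultimately show ?thesis by (simp add: khom_def)
qed

text \<open>
  The criterion for \<open>\<sigma>\<close> to extend to the field of fractions: \<open>\<tau>\<close> is a left inverse of \<open>\<sigma>\<close>.
\<close>

lemma mpol_subst_inj:
  assumes "\<And>i. \<sigma> i = to_fract (s i)" "\<And>i. mpol_subst \<tau> (s i) = var i" "mpol_subst \<sigma> p = 0"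
  shows "p = 0"
proof -
  have \<sigma>: "\<sigma> = (\<lambda>i. to_fract (s i))" using assms(1) by auto
  obtain p' where "to_fract p' = mpol_subst \<sigma> p" "mpol_subst \<tau> p' = mpol_subst var p"
    using mpol_subst_comp[of s p \<tau>] unfolding \<sigma> assms(2) by blast
  then show ?thesis using assms(3) by (simp add: mpol_subst_var)
qed

lemma indet_q_nonzero [simp]: "indet_q \<noteq> 0"
  by (simp add: indet_q_def)

lemma khom_qshift: "khom (qshift i)"
  unfolding qshift_def
proof (rule khom_ratfun_subst, rule mpol_subst_inj)
  let ?s = "\<lambda>j. Poly_Mapping.single (Poly_Mapping.single j 1) (if j = i then indet_q else 1)"
  let ?\<tau> = "\<lambda>j. const (if j = i then inverse indet_q else 1) * var j"
  show "(var(i := const indet_q * var i)) j = to_fract (?s j)" for j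
    by (simp add: to_fract_single)
  show "mpol_subst ?\<tau> (?s j) = var j" for j
    by (auto simp: const_inverse)
qed

lemma qshift_var: "qshift i (var j) = (if j = i then const indet_q * var j else var j)"
  by (simp add: qshift_def)

lemma khom_funpow: "khom h \<Longrightarrow> khom (h ^^ k)"
  by (induction k) (simp_all add: khom_id khom_comp)

lemma khom_multi_qshift: "khom (multi_qshift n \<gamma>)"
proof -
  have "khom (foldr (\<lambda>i. qshift i ^^ \<gamma> i) xs)" for xs
    by (induction xs) (simp_all only: foldr.simps khom_id khom_comp khom_funpow khom_qshift)
  then show ?thesis by (simp add: multi_qshift_def)
qed

lemma qshift_funpow_var:
  "(qshift i ^^ k) (var j) = (if j = i then const (indet_q ^ k) * var j else var j)"
  by (induction k) (simp_all add: qshift_var khom_simps[OF khom_qshift] const_mult const_power)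

lemma multi_qshift_var:
  "multi_qshift n \<gamma> (var j) = (if j < n then const (indet_q ^ \<gamma> j) * var j else var j)"
proof -
  have "foldr (\<lambda>i. qshift i ^^ \<gamma> i) xs (var j) =
    (if j \<in> set xs then const (indet_q ^ \<gamma> j) * var j else var j)" if "distinct xs" for xs
    using that
    by (induction xs)
       (auto simp: qshift_funpow_var khom_simps[OF khom_funpow[OF khom_qshift]])
  from this[of "[0..<n]"] show ?thesis by (simp add: multi_qshift_def)
qed

lemma perm_act_var: "perm_act w (var i) = var (w i)"
  by (simp add: perm_act_def)

lemma khom_perm_act:
  assumes "bij w"
  shows "khom (perm_act w)"
  unfolding perm_act_def
proof (rule khom_ratfun_subst, rule mpol_subst_inj)
  show "var (w j) = to_fract (Poly_Mapping.single (Poly_Mapping.single (w j) 1) 1)" for j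
    by (simp add: var_def)
  show "mpol_subst (\<lambda>j. var (inv w j)) (Poly_Mapping.single (Poly_Mapping.single (w j) 1) 1) = var j" for j
    using assms by (simp add: bij_is_inj)
qed

section \<open>Polynomials and rational functions in finitely many variables\<close>

lemma mpolys_add: "p \<in> mpolys n \<Longrightarrow> r \<in> mpolys n \<Longrightarrow> p + r \<in> mpolys n"
  using Poly_Mapping.keys_add[of p r] by (auto simp: mpolys_def)

lemma mpolys_mult:
  assumes "p \<in> mpolys n" "r \<in> mpolys n"
  shows "p * r \<in> mpolys n"
  unfolding mpolys_def
proof (safe)
  fix e i assume "e \<in> Poly_Mapping.keys (p * r)" "i \<in> Poly_Mapping.keys e"
  then obtain a b where "a \<in> Poly_Mapping.keys p" "b \<in> Poly_Mapping.keys r" "e = a + b"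
    using keys_mult[of p r] by blast
  then show "i < n" using assms Poly_Mapping.keys_add[of a b] \<open>i \<in> _\<close>
    unfolding mpolys_def by blast
qed

definition pol :: "nat \<Rightarrow> ratfun set" where
  "pol n = to_fract ` mpolys n"

lemma pol_const [simp]: "const c \<in> pol n"
  by (auto simp: pol_def const_def mpolys_def)

lemma pol_var: "i < n \<Longrightarrow> var i \<in> pol n"
  by (auto simp: pol_def var_def mpolys_def)

lemma pol_add: "f \<in> pol n \<Longrightarrow> g \<in> pol n \<Longrightarrow> f + g \<in> pol n"
  by (auto simp: pol_def mpolys_add simp flip: to_fract_add)

lemma pol_mult: "f \<in> pol n \<Longrightarrow> g \<in> pol n \<Longrightarrow> f * g \<in> pol n"
  by (auto simp: pol_def mpolys_mult simp flip: to_fract_mult)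

lemma pol_0 [simp]: "0 \<in> pol n" and pol_1 [simp]: "1 \<in> pol n"
  using pol_const[of 0 n] pol_const[of 1 n] by simp_all

lemma pol_minus: "f \<in> pol n \<Longrightarrow> - f \<in> pol n"
  using pol_mult[OF pol_const[of "-1" n], of f] by (simp add: const_minus)

lemma pol_diff: "f \<in> pol n \<Longrightarrow> g \<in> pol n \<Longrightarrow> f - g \<in> pol n"
  using pol_add[of f n "- g"] by (simp add: pol_minus)

lemma pol_power: "f \<in> pol n \<Longrightarrow> f ^ k \<in> pol n"
  by (induction k) (simp_all add: pol_mult)

lemma pol_sum: "(\<And>i. i \<in> A \<Longrightarrow> f i \<in> pol n) \<Longrightarrow> (\<Sum>i\<in>A. f i) \<in> pol n"
  by (induction A rule: infinite_finite_induct) (simp_all add: pol_add)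

lemma pol_prod: "(\<And>i. i \<in> A \<Longrightarrow> f i \<in> pol n) \<Longrightarrow> (\<Prod>i\<in>A. f i) \<in> pol n"
  by (induction A rule: infinite_finite_induct) (simp_all add: pol_mult)

lemma pol_monom_eval: "Poly_Mapping.keys e \<subseteq> {..<n} \<Longrightarrow> monom_eval var e \<in> pol n"
  unfolding monom_eval_def by (intro pol_prod pol_power pol_var) auto

lemma pol_mpol_subst:
  assumes "p \<in> mpolys n" "\<And>i. i < n \<Longrightarrow> \<sigma> i \<in> pol k"
  shows "mpol_subst \<sigma> p \<in> pol k"
  unfolding mpol_subst_def
  by (intro pol_sum pol_mult pol_const pol_prod pol_power assms(2)) (use assms(1) in \<open>auto simp: mpolys_def\<close>)

lemma khom_pol:
  assumes "khom h" "\<And>i. i < n \<Longrightarrow> h (var i) \<in> pol k" "f \<in> pol n"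
  shows "h f \<in> pol k"
proof -
  obtain p where "f = to_fract p" "p \<in> mpolys n" using assms(3) by (auto simp: pol_def)
  then show ?thesis using assms(1,2) by (simp add: khom_to_fract[OF assms(1)] pol_mpol_subst)
qed

lemma ratfuns_iff: "f \<in> ratfuns n \<longleftrightarrow> (\<exists>a\<in>pol n. \<exists>b\<in>pol n. b \<noteq> 0 \<and> f = a / b)"
  unfolding ratfuns_def pol_def by fastforce

lemma ratfuns_pol: "f \<in> pol n \<Longrightarrow> f \<in> ratfuns n"
  unfolding ratfuns_iff by (rule bexI[of _ f], rule bexI[of _ 1]) auto

lemma ratfuns_add:
  assumes "f \<in> ratfuns n" "g \<in> ratfuns n" shows "f + g \<in> ratfuns n"
proof -
  obtain a b c d where *: "a \<in> pol n" "b \<in> pol n" "b \<noteq> 0" "f = a / b" "c \<in> pol n" "d \<in> pol n" "d \<noteq> 0" "g = c / d"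
    using assms by (auto simp: ratfuns_iff)
  then have "f + g = (a * d + c * b) / (b * d)" by (simp add: field_simps)
  moreover have "a * d + c * b \<in> pol n" "b * d \<in> pol n" "b * d \<noteq> 0" using * by (auto intro: pol_add pol_mult)
  ultimately show ?thesis unfolding ratfuns_iff by blast
qed

lemma ratfuns_mult:
  assumes "f \<in> ratfuns n" "g \<in> ratfuns n" shows "f * g \<in> ratfuns n"
proof -
  obtain a b c d where *: "a \<in> pol n" "b \<in> pol n" "b \<noteq> 0" "f = a / b" "c \<in> pol n" "d \<in> pol n" "d \<noteq> 0" "g = c / d"
    using assms by (auto simp: ratfuns_iff)
  then have "f * g = (a * c) / (b * d)" by simp
  moreover have "a * c \<in> pol n" "b * d \<in> pol n" "b * d \<noteq> 0" using * by (auto intro: pol_mult)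
  ultimately show ?thesis unfolding ratfuns_iff by blast
qed

lemma ratfuns_inverse:
  assumes "f \<in> ratfuns n" shows "inverse f \<in> ratfuns n"
proof (cases "f = 0")
  case False
  obtain a b where *: "a \<in> pol n" "b \<in> pol n" "b \<noteq> 0" "f = a / b"
    using assms by (auto simp: ratfuns_iff)
  then have "inverse f = b / a" "a \<noteq> 0" using False by auto
  then show ?thesis using * by (auto simp: ratfuns_iff)
qed (simp add: ratfuns_pol)

lemma ratfuns_minus: "f \<in> ratfuns n \<Longrightarrow> - f \<in> ratfuns n"
  using ratfuns_mult[OF ratfuns_pol[OF pol_const[of "-1" n]], of f] by (simp add: const_minus)

lemma khom_ratfuns:
  assumes "khom h" "\<And>i. i < n \<Longrightarrow> h (var i) \<in> pol k" "f \<in> ratfuns n"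
  shows "h f \<in> ratfuns k"
proof -
  obtain a b where *: "a \<in> pol n" "b \<in> pol n" "b \<noteq> 0" "f = a / b"
    using assms by (auto simp: ratfuns_iff)
  then have "h f = h a / h b" "h b \<noteq> 0"
    by (simp_all add: khom_divide[OF assms(1)] khom_eq_0_iff[OF assms(1)])
  then show ?thesis using khom_pol[OF assms(1,2)] * by (auto simp: ratfuns_iff)
qed

section \<open>Lexicographic leading terms\<close>

text \<open>
  Exponents are ordered lexicographically, with the exponent of \<open>x\<^sub>0\<close> compared first.  The
  coefficient \<open>c\<close> may be zero, in which case only an upper bound for the monomials is asserted;
  this makes the notion stable under sums in which the top terms cancel.
\<close>

definition leading_term :: "ratfun \<Rightarrow> (nat \<Rightarrow>\<^sub>0 nat) \<Rightarrow> coef \<Rightarrow> bool" where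
  "leading_term f e c \<longleftrightarrow>
     (\<exists>p. f = to_fract p \<and> (\<forall>k \<in> Poly_Mapping.keys p. k \<le> e) \<and> Poly_Mapping.lookup p e = c)"

lemma leading_term_0: "leading_term 0 e 0"
  unfolding leading_term_def by (rule exI[of _ 0]) simp

lemma leading_term_const: "leading_term (const c) 0 c"
  unfolding leading_term_def const_def
  by (rule exI[of _ "Poly_Mapping.single 0 c"]) (auto split: if_splits)

lemma leading_term_monom: "leading_term (monom_eval var e) e 1"
  unfolding leading_term_def
  by (rule exI[of _ "Poly_Mapping.single e 1"]) (simp add: to_fract_single)

lemma leading_term_var: "leading_term (var i) (Poly_Mapping.single i 1) 1"
  using leading_term_monom[of "Poly_Mapping.single i 1"] by simp

lemma leading_term_add:
  assumes "leading_term f e c" "leading_term g e d"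
  shows "leading_term (f + g) e (c + d)"
proof -
  obtain p r where "f = to_fract p" "\<forall>k \<in> Poly_Mapping.keys p. k \<le> e" "Poly_Mapping.lookup p e = c"
    "g = to_fract r" "\<forall>k \<in> Poly_Mapping.keys r. k \<le> e" "Poly_Mapping.lookup r e = d"
    using assms unfolding leading_term_def by blast
  then show ?thesis
    using Poly_Mapping.keys_add[of p r] unfolding leading_term_def
    by (intro exI[of _ "p + r"]) (auto simp: lookup_add)
qed

lemma poly_mapping_split:
  fixes p :: "'a \<Rightarrow>\<^sub>0 'b::comm_ring_1"
  obtains p' where "p = Poly_Mapping.single e (Poly_Mapping.lookup p e) + p'"
    "Poly_Mapping.keys p' = Poly_Mapping.keys p - {e}"
proof -
  let ?p = "p - Poly_Mapping.single e (Poly_Mapping.lookup p e)"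
  have "Poly_Mapping.keys ?p = Poly_Mapping.keys p - {e}"
    by (auto simp: in_keys_iff lookup_minus lookup_single when_def split: if_splits)
  then show ?thesis using that[of ?p] by simp
qed

text \<open>
  The order on exponents is compatible with addition, so \<open>(e, d)\<close> is the only pair of occurring
  exponents with sum \<open>e + d\<close>.
\<close>

lemma lookup_mult_max:
  fixes p r :: mpol
  assumes p: "\<forall>k \<in> Poly_Mapping.keys p. k \<le> e" and r: "\<forall>k \<in> Poly_Mapping.keys r. k \<le> d"
  shows "Poly_Mapping.lookup (p * r) (e + d) = Poly_Mapping.lookup p e * Poly_Mapping.lookup r d"
proof -
  obtain p' where p': "p = Poly_Mapping.single e (Poly_Mapping.lookup p e) + p'"
    "Poly_Mapping.keys p' = Poly_Mapping.keys p - {e}" by (rule poly_mapping_split)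
  obtain r' where r': "r = Poly_Mapping.single d (Poly_Mapping.lookup r d) + r'"
    "Poly_Mapping.keys r' = Poly_Mapping.keys r - {d}" by (rule poly_mapping_split)
  have 1: "e + d \<notin> Poly_Mapping.keys (p' * r)"
  proof
    assume "e + d \<in> Poly_Mapping.keys (p' * r)"
    then obtain k l where "k \<in> Poly_Mapping.keys p'" "l \<in> Poly_Mapping.keys r" "e + d = k + l"
      using keys_mult[of p' r] by blast
    then have "k < e" "l \<le> d" using p p'(2) r by auto
    then have "k + l < e + d" by (rule add_less_le_mono)
    then show False using \<open>e + d = k + l\<close> by simp
  qed
  have 2: "e + d \<notin> Poly_Mapping.keys (Poly_Mapping.single e (Poly_Mapping.lookup p e) * r')"
  proof
    assume "e + d \<in> Poly_Mapping.keys (Poly_Mapping.single e (Poly_Mapping.lookup p e) * r')"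
    then obtain l where "l \<in> Poly_Mapping.keys r'" "e + d = e + l"
      using keys_mult[of "Poly_Mapping.single e (Poly_Mapping.lookup p e)" r'] by (auto split: if_splits)
    then show False using r'(2) by auto
  qed
  have "p * r = Poly_Mapping.single e (Poly_Mapping.lookup p e) * r + p' * r"
    by (subst p'(1)) (rule distrib_right)
  moreover have "Poly_Mapping.single e (Poly_Mapping.lookup p e) * r =
      Poly_Mapping.single e (Poly_Mapping.lookup p e) * Poly_Mapping.single d (Poly_Mapping.lookup r d)
      + Poly_Mapping.single e (Poly_Mapping.lookup p e) * r'"
    by (subst r'(1)) (rule distrib_left)
  ultimately show ?thesis using 1 2 by (simp add: lookup_add in_keys_iff mult_single)
qed

lemma leading_term_mult:
  assumes "leading_term f e c" "leading_term g d b"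
  shows "leading_term (f * g) (e + d) (c * b)"
proof -
  obtain p r where *: "f = to_fract p" "\<forall>k \<in> Poly_Mapping.keys p. k \<le> e" "Poly_Mapping.lookup p e = c"
    "g = to_fract r" "\<forall>k \<in> Poly_Mapping.keys r. k \<le> d" "Poly_Mapping.lookup r d = b"
    using assms unfolding leading_term_def by blast
  have "\<forall>k\<in>Poly_Mapping.keys (p * r). k \<le> e + d"
    using keys_mult[of p r] *(2,5) by (fastforce intro: add_mono)
  then show ?thesis
    using * lookup_mult_max[OF *(2,5)] unfolding leading_term_def
    by (intro exI[of _ "p * r"]) auto
qed

lemma leading_term_const_mult:
  "leading_term f e c \<Longrightarrow> leading_term (const a * f) e (a * c)"
  using leading_term_mult[OF leading_term_const] by fastforce

lemma leading_term_minus: "leading_term f e c \<Longrightarrow> leading_term (- f) e (- c)"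
  using leading_term_const_mult[of f e c "- 1"] by (simp add: const_minus)

lemma leading_term_diff:
  "leading_term f e c \<Longrightarrow> leading_term g e d \<Longrightarrow> leading_term (f - g) e (c - d)"
  using leading_term_add[of f e c "- g" "- d"] by (simp add: leading_term_minus)

lemma leading_term_sum:
  "(\<And>i. i \<in> A \<Longrightarrow> leading_term (f i) e (c i)) \<Longrightarrow> leading_term (\<Sum>i\<in>A. f i) e (\<Sum>i\<in>A. c i)"
  by (induction A rule: infinite_finite_induct) (simp_all add: leading_term_0 leading_term_add)

lemma leading_term_prod:
  "(\<And>i. i \<in> A \<Longrightarrow> leading_term (f i) (e i) (c i)) \<Longrightarrow>
    leading_term (\<Prod>i\<in>A. f i) (\<Sum>i\<in>A. e i) (\<Prod>i\<in>A. c i)"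
  using leading_term_const[of 1]
  by (induction A rule: infinite_finite_induct) (simp_all add: leading_term_mult)

lemma leading_term_unique:
  "leading_term f e c \<Longrightarrow> leading_term f e d \<Longrightarrow> c = d"
  unfolding leading_term_def by auto

lemma leading_term_le:
  assumes "leading_term f e c" "c \<noteq> 0" "leading_term f d b"
  shows "e \<le> d"
  using assms unfolding leading_term_def by (auto simp: in_keys_iff)

lemma leading_term_less:
  assumes "leading_term f e c" "e < d"
  shows "leading_term f d 0"
  using assms unfolding leading_term_def by (force simp: in_keys_iff not_le)

lemma leading_term_le_imp:
  assumes "leading_term f e c" "e \<le> d"
  shows "\<exists>b. leading_term f d b"
  using assms leading_term_less[of f e c d] by (cases "e = d") (auto simp: order_le_less)

lemma leading_term_exists:
  assumes "f \<in> pol n" "f \<noteq> 0"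
  obtains e c where "leading_term f e c" "c \<noteq> 0" "Poly_Mapping.keys e \<subseteq> {..<n}"
proof -
  obtain p where p: "f = to_fract p" "p \<in> mpolys n" using assms(1) by (auto simp: pol_def)
  then have ne: "Poly_Mapping.keys p \<noteq> {}" using assms(2) by auto
  let ?e = "Max (Poly_Mapping.keys p)"
  have "?e \<in> Poly_Mapping.keys p" using ne by simp
  then have "Poly_Mapping.keys ?e \<subseteq> {..<n}" "Poly_Mapping.lookup p ?e \<noteq> 0"
    using p by (auto simp: mpolys_def in_keys_iff)
  moreover have "leading_term f ?e (Poly_Mapping.lookup p ?e)"
    unfolding leading_term_def using p ne by auto
  ultimately show ?thesis using that by blast
qed

lemma leading_term_scale:
  assumes "khom h" "\<And>i. h (var i) = const (s i) * var i" "leading_term f e c"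
  shows "leading_term (h f) e (c * (\<Prod>i \<in> Poly_Mapping.keys e. s i ^ Poly_Mapping.lookup e i))"
proof -
  obtain p where p: "f = to_fract p" "\<forall>k \<in> Poly_Mapping.keys p. k \<le> e" "Poly_Mapping.lookup p e = c"
    using assms(3) unfolding leading_term_def by blast
  let ?S = "\<lambda>e. \<Prod>i \<in> Poly_Mapping.keys e. s i ^ Poly_Mapping.lookup e i"
  have M: "monom_eval (h \<circ> var) k = const (?S k) * monom_eval var k" for k
    by (simp add: monom_eval_def assms(2) power_mult_distrib prod.distrib const_prod const_power)
  have hf: "h f = (\<Sum>k\<in>insert e (Poly_Mapping.keys p). const (Poly_Mapping.lookup p k * ?S k) * monom_eval var k)"
    unfolding p(1) khom_to_fract[OF assms(1)]
    by (subst mpol_subst_superset[of "insert e (Poly_Mapping.keys p)"]) (auto simp: M const_mult mult.assoc)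
  have "leading_term (const (Poly_Mapping.lookup p k * ?S k) * monom_eval var k) e
      (if k = e then Poly_Mapping.lookup p k * ?S k else 0)" if "k \<in> insert e (Poly_Mapping.keys p)" for k
  proof -
    have "leading_term (const (Poly_Mapping.lookup p k * ?S k) * monom_eval var k) k (Poly_Mapping.lookup p k * ?S k * 1)"
      by (intro leading_term_const_mult leading_term_monom)
    then show ?thesis using that p(2) leading_term_less by (cases "k = e") (auto simp: order_le_less)
  qed
  then have "leading_term (h f) e (\<Sum>k\<in>insert e (Poly_Mapping.keys p).
      if k = e then Poly_Mapping.lookup p k * ?S k else 0)"
    unfolding hf by (rule leading_term_sum)
  then show ?thesis
    using p(3) by (simp add: sum.delta del: sum.insert)
qed


section \<open>Permutations and shifts of the variables\<close>

lemma khom_perm_act_permutes: "w permutes S \<Longrightarrow> khom (perm_act w)"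
  by (simp add: khom_perm_act permutes_bij)

lemma perm_act_comp:
  assumes "bij v" "bij w"
  shows "perm_act v (perm_act w f) = perm_act (v \<circ> w) f"
proof -
  have "perm_act v \<circ> perm_act w = perm_act (v \<circ> w)"
    using assms by (intro khom_eqI khom_comp khom_perm_act bij_comp) (simp_all add: perm_act_var)
  then show ?thesis by (metis comp_apply)
qed

lemma perm_act_id [simp]: "perm_act id f = f"
proof -
  have "perm_act id = (\<lambda>x. x)"
    by (intro khom_eqI khom_perm_act khom_id) (simp_all add: perm_act_var)
  then show ?thesis by metis
qed

lemma multi_qshift_comp:
  "multi_qshift n \<gamma> (multi_qshift n \<delta> f) = multi_qshift n (\<lambda>i. \<gamma> i + \<delta> i) f"
proof -
  have "multi_qshift n \<gamma> \<circ> multi_qshift n \<delta> = multi_qshift n (\<lambda>i. \<gamma> i + \<delta> i)"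
    by (intro khom_eqI khom_comp khom_multi_qshift)
      (simp add: multi_qshift_var khom_mult[OF khom_multi_qshift] khom_const[OF khom_multi_qshift]
        power_add const_mult mult_ac)
  then show ?thesis by (metis comp_apply)
qed

lemma perm_act_multi_qshift:
  assumes "w permutes {..<n}"
  shows "perm_act w (multi_qshift n \<gamma> f) = multi_qshift n (\<gamma> \<circ> inv w) (perm_act w f)"
proof -
  note k = khom_perm_act_permutes[OF assms]
  have "perm_act w (multi_qshift n \<gamma> (var i)) = multi_qshift n (\<gamma> \<circ> inv w) (perm_act w (var i))" for i
    using permutes_in_image[OF assms, of i] permutes_inverses[OF assms]
    by (simp add: multi_qshift_var perm_act_var khom_mult[OF k] khom_const[OF k])
  then have "perm_act w \<circ> multi_qshift n \<gamma> = multi_qshift n (\<gamma> \<circ> inv w) \<circ> perm_act w"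
    by (intro khom_eqI khom_comp khom_multi_qshift k) simp
  then show ?thesis by (metis comp_apply)
qed

lemma map_key_inv:
  assumes "bij w"
  shows "Poly_Mapping.map_key w (Poly_Mapping.map_key (inv w) e) = e"
  using assms by (intro poly_mapping_eqI)
    (simp add: map_key.rep_eq bij_is_inj bij_imp_bij_inv)

lemma bij_map_key:
  assumes "bij w"
  shows "bij (Poly_Mapping.map_key w :: ('a \<Rightarrow>\<^sub>0 'b::zero) \<Rightarrow> 'a \<Rightarrow>\<^sub>0 'b)"
  using map_key_inv[OF assms] map_key_inv[OF bij_imp_bij_inv[OF assms]] assms
  by (intro o_bij[of "Poly_Mapping.map_key (inv w)"]) (auto simp: inv_inv_eq fun_eq_iff)

lemma monom_eval_map_key:
  assumes "bij w"
  shows "monom_eval (\<lambda>i. \<sigma> (w i)) (Poly_Mapping.map_key w e) = monom_eval \<sigma> e"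
proof -
  have inj: "inj w" using assms by (rule bij_is_inj)
  have "bij_betw w (Poly_Mapping.keys (Poly_Mapping.map_key w e)) (Poly_Mapping.keys e)"
    using assms inj unfolding bij_betw_def keys_map_key[OF inj]
    by (auto simp: bij_is_surj inj_on_def inj_def surj_image_vimage_eq)
  then show ?thesis
    unfolding monom_eval_def
    by (intro prod.reindex_bij_betw[of w _ _ "\<lambda>i. \<sigma> i ^ Poly_Mapping.lookup e i", simplified map_key.rep_eq, THEN trans[rotated]])
       (simp_all add: map_key.rep_eq inj)
qed

text \<open>
  On exponents, \<open>map_key w\<close> is composition with \<open>w\<close>; applied once more to the polynomial itself, it
  moves the coefficient of \<open>x\<^sup>e\<close> to the exponent \<open>e \<circ> w\<^sup>-\<^sup>1\<close>.
\<close>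

lemma perm_act_to_fract:
  assumes "bij w"
  shows "perm_act w (to_fract p) = to_fract (Poly_Mapping.map_key (Poly_Mapping.map_key w) p)"
proof (induction p rule: poly_mapping_add_induct)
  case (single e c)
  note k = khom_perm_act[OF assms]
  let ?e = "Poly_Mapping.map_key (inv w) e"
  have inj: "inj (Poly_Mapping.map_key w :: (nat \<Rightarrow>\<^sub>0 nat) \<Rightarrow> nat \<Rightarrow>\<^sub>0 nat)"
    using bij_map_key[OF assms] by (rule bij_is_inj)
  have "perm_act w (to_fract (Poly_Mapping.single e c)) = const c * monom_eval (\<lambda>i. var (w i)) e"
    by (simp add: to_fract_single khom_mult[OF k] khom_const[OF k] khom_monom_eval[OF k] perm_act_var o_def)
  also have "\<dots> = const c * monom_eval var ?e"
    using monom_eval_map_key[OF assms, of var ?e] by (simp add: map_key_inv[OF assms])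
  also have "\<dots> = to_fract (Poly_Mapping.map_key (Poly_Mapping.map_key w) (Poly_Mapping.single e c))"
    using map_key_single[OF inj, of ?e c] by (simp add: map_key_inv[OF assms] to_fract_single)
  finally show ?case .
next
  case (add p r)
  have inj: "inj (Poly_Mapping.map_key w :: (nat \<Rightarrow>\<^sub>0 nat) \<Rightarrow> nat \<Rightarrow>\<^sub>0 nat)"
    using bij_map_key[OF assms] by (rule bij_is_inj)
  show ?case using add by (simp add: khom_add[OF khom_perm_act[OF assms]] map_key_plus[OF inj])
qed

definition symmetric_fun :: "nat \<Rightarrow> ratfun \<Rightarrow> bool" where
  "symmetric_fun n f \<longleftrightarrow> (\<forall>w. w permutes {..<n} \<longrightarrow> perm_act w f = f)"

lemma symmetric_fun_lookup:
  assumes "symmetric_fun n (to_fract p)" "w permutes {..<n}"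
  shows "Poly_Mapping.lookup p (Poly_Mapping.map_key w e) = Poly_Mapping.lookup p e"
proof -
  have b: "bij w" using assms(2) by (rule permutes_bij)
  have "to_fract (Poly_Mapping.map_key (Poly_Mapping.map_key w) p) = to_fract p"
    using assms by (simp add: symmetric_fun_def flip: perm_act_to_fract[OF b])
  then have "Poly_Mapping.lookup (Poly_Mapping.map_key (Poly_Mapping.map_key w) p) e = Poly_Mapping.lookup p e"
    by (simp only: to_fract_eq_iff)
  moreover have "inj (Poly_Mapping.map_key w :: (nat \<Rightarrow>\<^sub>0 nat) \<Rightarrow> nat \<Rightarrow>\<^sub>0 nat)"
    using bij_map_key[OF b] by (rule bij_is_inj)
  ultimately show ?thesis by (simp add: map_key.rep_eq)
qed

text \<open>
  If the exponents of the leading monomial increased somewhere, exchanging the two variables would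
  give a larger monomial with the same coefficient.
\<close>

lemma leading_term_symmetric_antimono:
  assumes "symmetric_fun n f" "leading_term f e c" "c \<noteq> 0" "Poly_Mapping.keys e \<subseteq> {..<n}"
  shows "antimono (Poly_Mapping.lookup e)"
proof (rule antimonoI, rule ccontr)
  fix i j :: nat assume "i \<le> j" "\<not> Poly_Mapping.lookup e j \<le> Poly_Mapping.lookup e i"
  then have lt: "Poly_Mapping.lookup e i < Poly_Mapping.lookup e j" and "i < j"
    by (auto simp: order_le_less)
  then have "j \<in> Poly_Mapping.keys e" by (simp add: in_keys_iff)
  then have "j < n" using assms(4) by auto
  let ?s = "Transposition.transpose i j"
  let ?e = "Poly_Mapping.map_key ?s e"
  have s: "?s permutes {..<n}" using \<open>i < j\<close> \<open>j < n\<close> by (intro permutes_swap_id) auto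
  obtain p where p: "f = to_fract p" "\<forall>k \<in> Poly_Mapping.keys p. k \<le> e" "Poly_Mapping.lookup p e = c"
    using assms(2) unfolding leading_term_def by blast
  have "Poly_Mapping.lookup p ?e = c"
    using symmetric_fun_lookup[OF _ s] assms(1) p by simp
  then have "?e \<le> e" using p(2) assms(3) by (simp add: in_keys_iff)
  moreover have "e < ?e"
  proof -
    have "Poly_Mapping.lookup ?e k = Poly_Mapping.lookup e (?s k)" for k
      by (simp add: map_key.rep_eq)
    then have "less_fun (Poly_Mapping.lookup e) (Poly_Mapping.lookup ?e)"
      unfolding less_fun_def using lt \<open>i < j\<close>
      by (intro exI[of _ i]) (auto simp: transpose_def)
    then show ?thesis by (simp add: less_poly_mapping.rep_eq)
  qed
  ultimately show False by simp
qed

section \<open>Characteristic zero and scaled variables\<close>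

lemma of_nat_ratfun: "(of_nat k :: ratfun) = const (of_nat k)"
  by (induction k) (simp_all add: const_add)

lemma of_nat_coef_eq_0_iff: "(of_nat k :: coef) = 0 \<longleftrightarrow> k = 0"
proof -
  have "(of_nat k :: coef) = to_fract (of_nat k)"
    by (induction k) simp_all
  then show ?thesis by simp
qed

lemma of_nat_ratfun_eq_0_iff: "(of_nat k :: ratfun) = 0 \<longleftrightarrow> k = 0"
  by (simp add: of_nat_ratfun of_nat_coef_eq_0_iff)

lemma indet_t_nonzero [simp]: "indet_t \<noteq> 0"
  by (simp add: indet_t_def)

lemma single_one_eq_iff: "Poly_Mapping.single i (1::nat) = Poly_Mapping.single j 1 \<longleftrightarrow> i = j"
  by (metis lookup_single_eq lookup_single_not_eq one_neq_zero)

lemma scaled_var_eq_iff: "const a * var i = const b * var j \<longleftrightarrow> a = 0 \<and> b = 0 \<or> i = j \<and> a = b"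
proof -
  have v: "const a * var i = to_fract (Poly_Mapping.single (Poly_Mapping.single i 1) a)" for a i
    by (simp add: to_fract_single)
  have "a = 0 \<and> b = 0 \<or> i = j \<and> a = b"
    if "Poly_Mapping.single (Poly_Mapping.single i 1) a = Poly_Mapping.single (Poly_Mapping.single j (1::nat)) b"
  proof -
    have "(a when i = j) = b" "(b when i = j) = a"
      using arg_cong[OF that, of "\<lambda>p. Poly_Mapping.lookup p (Poly_Mapping.single j 1)"]
        arg_cong[OF that, of "\<lambda>p. Poly_Mapping.lookup p (Poly_Mapping.single i 1)"]
      by (auto simp: lookup_single when_def single_one_eq_iff[unfolded One_nat_def] split: if_splits)
    then show ?thesis by (auto simp: when_def split: if_splits)
  qed
  then show ?thesis unfolding v to_fract_eq_iff by auto
qed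

lemma var_eq_iff [simp]: "var i = var j \<longleftrightarrow> i = j"
  using scaled_var_eq_iff[of 1 i 1 j] by simp

lemma var_nonzero [simp]: "var i \<noteq> 0"
  using scaled_var_eq_iff[of 1 i 0 i] by simp

section \<open>Macdonald operators and the Vandermonde product\<close>

definition var_pairs :: "nat \<Rightarrow> (nat \<times> nat) set" where
  "var_pairs n = (SIGMA i : {..<n}. {i<..<n})"

text \<open>
  The factors of the Vandermonde product are indexed by an arbitrary set of pairs, so that they can
  be removed one at a time.
\<close>

definition vandermonde :: "(nat \<times> nat) set \<Rightarrow> ratfun" where
  "vandermonde S = (\<Prod>(i, j) \<in> S. var i - var j)"

definition macdonald_coef :: "nat \<Rightarrow> nat set \<Rightarrow> ratfun" where
  "macdonald_coef n K = const indet_t ^ (card K choose 2) *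
     (\<Prod>i \<in> K. \<Prod>j \<in> {..<n} - K. (1 - const indet_t * var i / var j) / (1 - var i / var j))"

abbreviation ind :: "nat set \<Rightarrow> nat \<Rightarrow> nat" where
  "ind K \<equiv> (\<lambda>i. if i \<in> K then 1 else 0)"

definition subsets_of_size :: "nat \<Rightarrow> nat \<Rightarrow> nat set set" where
  "subsets_of_size n r = {K. K \<subseteq> {..<n} \<and> card K = r}"

text \<open>
  Up to sign, the coefficient of \<open>u\<^sup>r\<close> in Macdonald's operator \<open>D\<^sub>x(u;q,t)\<close>.
\<close>

definition macdonald_op :: "nat \<Rightarrow> nat \<Rightarrow> ratfun \<Rightarrow> ratfun" where
  "macdonald_op n r f = (\<Sum>K \<in> subsets_of_size n r. macdonald_coef n K * multi_qshift n (ind K) f)"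

lemma subsets_of_size_1: "subsets_of_size n 1 = (\<lambda>i. {i}) ` {..<n}"
  by (auto simp: subsets_of_size_def card_1_singleton_iff)

lemma finite_subsets_of_size [simp]: "finite (subsets_of_size n r)"
  unfolding subsets_of_size_def by (rule finite_subset[of _ "Pow {..<n}"]) auto

lemma finite_var_pairs [simp]: "finite (var_pairs n)"
  by (simp add: var_pairs_def)

lemma card_increasing_pairs:
  fixes K :: "nat set"
  assumes "finite K"
  shows "card {(i, j). i \<in> K \<and> j \<in> K \<and> i < j} = card K choose 2"
proof -
  have "bij_betw (\<lambda>(i, j). {i, j}) {(i, j). i \<in> K \<and> j \<in> K \<and> i < j} {B. B \<subseteq> K \<and> card B = 2}"
  proof (rule bij_betw_imageI)
    show "inj_on (\<lambda>(i, j). {i, j}) {(i, j). i \<in> K \<and> j \<in> K \<and> i < j}"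
      by (auto simp: inj_on_def doubleton_eq_iff)
    have "B \<in> (\<lambda>(i, j). {i, j}) ` {(i, j). i \<in> K \<and> j \<in> K \<and> i < j}" if B: "B \<subseteq> K" "card B = 2" for B
    proof -
      obtain x y where "B = {x, y}" "x \<noteq> y" using B(2) by (auto simp: card_2_iff)
      then show ?thesis using B(1)
        by (intro image_eqI[of _ _ "(min x y, max x y)"]) (auto simp: min_def max_def)
    qed
    then show "(\<lambda>(i, j). {i, j}) ` {(i, j). i \<in> K \<and> j \<in> K \<and> i < j} = {B. B \<subseteq> K \<and> card B = 2}"
      by auto
  qed
  from bij_betw_same_card[OF this] show ?thesis using n_subsets[OF assms, of 2] by simp
qed

text \<open>
  Rescaling \<open>x\<^sub>i\<close> by \<open>t\<close> for \<open>i \<in> K\<close> multiplies a factor \<open>x\<^sub>i - x\<^sub>j\<close> by \<open>t\<close> if both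
  variables are rescaled, and by the factor of Macdonald's coefficient if exactly one is.  So the
  coefficient is the quotient of the rescaled Vandermonde product by the original one; the first
  case occurs for \<open>card K choose 2\<close> pairs.
\<close>

lemma vandermonde_macdonald_coef:
  assumes "K \<subseteq> {..<n}"
  defines "s \<equiv> (\<lambda>i. if i \<in> K then indet_t else 1)"
  shows "vandermonde (var_pairs n) * macdonald_coef n K
    = (\<Prod>(i, j) \<in> var_pairs n. const (s i) * var i - const (s j) * var j)"
proof -
  let ?\<psi> = "\<lambda>i j. (1 - const indet_t * var i / var j) / (1 - var i / var j)"
  let ?P = "var_pairs n"
  have finK: "finite K" using assms(1) finite_subset by blast
  have \<psi>: "?\<psi> i j = (const indet_t * var i - var j) / (var i - var j)"
          "?\<psi> i j = (var j - const indet_t * var i) / (var j - var i)" if "i \<noteq> j" for i j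
    using that by (simp_all add: field_simps)
  have ratio: "const (s i) * var i - const (s j) * var j = (var i - var j) *
     ((if i \<in> K \<and> j \<in> K then const indet_t else 1) *
      (if i \<in> K \<and> j \<notin> K then ?\<psi> i j else 1) *
      (if i \<notin> K \<and> j \<in> K then ?\<psi> j i else 1))" if "i < j" for i j
  proof -
    have ne: "i \<noteq> j" "j \<noteq> i" using that by auto
    have both: "const indet_t * var i - const indet_t * var j = (var i - var j) * const indet_t"
      by (simp add: algebra_simps)
    show ?thesis using ne unfolding \<psi>(1)[OF ne(1)] \<psi>(2)[OF ne(2)]
      by (cases "i \<in> K"; cases "j \<in> K") (simp_all add: s_def both)
  qed
  have "(\<Prod>(i, j) \<in> ?P. const (s i) * var i - const (s j) * var j) =
     (\<Prod>(i, j) \<in> ?P. (var i - var j) * ((if i \<in> K \<and> j \<in> K then const indet_t else 1) *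
      (if i \<in> K \<and> j \<notin> K then ?\<psi> i j else 1) * (if i \<notin> K \<and> j \<in> K then ?\<psi> j i else 1)))"
    by (rule prod.cong) (auto simp: var_pairs_def ratio simp del: mult_cancel_left)
  also have "\<dots> = vandermonde ?P * ((\<Prod>(i, j) \<in> ?P. if i \<in> K \<and> j \<in> K then const indet_t else 1) *
      ((\<Prod>(i, j) \<in> ?P. if i \<in> K \<and> j \<notin> K then ?\<psi> i j else 1) *
       (\<Prod>(i, j) \<in> ?P. if i \<notin> K \<and> j \<in> K then ?\<psi> j i else 1)))"
    by (simp add: prod.distrib vandermonde_def case_prod_unfold mult.assoc)
  also have "(\<Prod>(i, j) \<in> ?P. if i \<in> K \<and> j \<in> K then const indet_t else 1) = const indet_t ^ (card K choose 2)"
  proof -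
    have "{x \<in> ?P. fst x \<in> K \<and> snd x \<in> K} = {(i, j). i \<in> K \<and> j \<in> K \<and> i < j}"
      using assms(1) by (auto simp: var_pairs_def)
    then show ?thesis
      by (simp add: case_prod_unfold card_increasing_pairs[OF finK, unfolded case_prod_unfold] flip: prod.inter_filter)
  qed
  also have "(\<Prod>(i, j) \<in> ?P. if i \<in> K \<and> j \<notin> K then ?\<psi> i j else 1) *
       (\<Prod>(i, j) \<in> ?P. if i \<notin> K \<and> j \<in> K then ?\<psi> j i else 1) =
       (\<Prod>(i, j) \<in> K \<times> ({..<n} - K). ?\<psi> i j)"
  proof -
    let ?A = "{x \<in> ?P. fst x \<in> K \<and> snd x \<notin> K}" and ?B = "{x \<in> ?P. fst x \<notin> K \<and> snd x \<in> K}"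
    have "K \<times> ({..<n} - K) = ?A \<union> prod.swap ` ?B"
    proof (intro equalityI subsetI)
      fix x assume x: "x \<in> K \<times> ({..<n} - K)"
      obtain i j where ij: "x = (i, j)" by (cases x)
      have "i \<noteq> j" using x ij by auto
      then consider "i < j" | "j < i" by linarith
      then show "x \<in> ?A \<union> prod.swap ` ?B"
      proof cases
        case 1 then show ?thesis using x ij assms(1) by (auto simp: var_pairs_def)
      next
        case 2
        then have "(j, i) \<in> ?B" using x ij assms(1) by (auto simp: var_pairs_def)
        then have "prod.swap (j, i) \<in> prod.swap ` ?B" by (rule imageI)
        then show ?thesis using ij by simp
      qed
    qed (auto simp: var_pairs_def)
    moreover have "?A \<inter> prod.swap ` ?B = {}" by (auto simp: var_pairs_def)
    moreover have "(\<Prod>(i, j) \<in> prod.swap ` ?B. ?\<psi> i j) = (\<Prod>(i, j) \<in> ?B. ?\<psi> j i)"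
      by (subst prod.reindex) (auto simp: case_prod_unfold)
    ultimately have "(\<Prod>(i, j) \<in> K \<times> ({..<n} - K). ?\<psi> i j) = (\<Prod>(i, j) \<in> ?A. ?\<psi> i j) * (\<Prod>(i, j) \<in> ?B. ?\<psi> j i)"
      by (simp add: prod.union_disjoint)
    then show ?thesis by (simp add: case_prod_unfold prod.inter_filter)
  qed
  also have "\<dots> = (\<Prod>i\<in>K. \<Prod>j\<in>{..<n} - K. ?\<psi> i j)"
    using finK by (simp add: prod.cartesian_product)
  finally show ?thesis unfolding macdonald_coef_def by simp
qed

lemma leading_term_linear:
  assumes "i < j"
  shows "leading_term (const a * var i - const b * var j) (Poly_Mapping.single i 1) a"
proof -
  have "Poly_Mapping.single j 1 < Poly_Mapping.single i (1::nat)"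
    unfolding less_poly_mapping.rep_eq less_fun_def
    using assms by (intro exI[of _ i]) (auto simp: lookup_single)
  then have "leading_term (const b * var j) (Poly_Mapping.single i 1) 0"
    using leading_term_less leading_term_const_mult[OF leading_term_var] by blast
  then show ?thesis
    using leading_term_diff[OF leading_term_const_mult[OF leading_term_var[of i], of a]] by fastforce
qed

lemma leading_term_scaled_vandermonde:
  "leading_term (\<Prod>(i, j) \<in> var_pairs n. const (s i) * var i - const (s j) * var j)
     (\<Sum>(i, j) \<in> var_pairs n. Poly_Mapping.single i 1) (\<Prod>i<n. s i ^ (n - Suc i))"
proof -
  have "leading_term (\<Prod>(i, j) \<in> var_pairs n. const (s i) * var i - const (s j) * var j)
     (\<Sum>(i, j) \<in> var_pairs n. Poly_Mapping.single i 1) (\<Prod>(i, j) \<in> var_pairs n. s i)"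
    unfolding case_prod_unfold
    by (rule leading_term_prod, rule leading_term_linear) (auto simp: var_pairs_def)
  moreover have "(\<Prod>(i, j) \<in> var_pairs n. s i) = (\<Prod>i<n. s i ^ (n - Suc i))"
    unfolding var_pairs_def by (subst prod.Sigma[symmetric]) auto
  ultimately show ?thesis by simp
qed

definition symmetric_pols :: "nat \<Rightarrow> ratfun set" where
  "symmetric_pols n = {f \<in> pol n. symmetric_fun n f}"

lemma permutes_image_subsets_of_size:
  assumes "w permutes {..<n}"
  shows "bij_betw ((`) w) (subsets_of_size n r) (subsets_of_size n r)"
proof (rule bij_betw_byWitness[where f' = "(`) (inv w)"])
  note i = permutes_inverses[OF assms]
  have *: "v ` K \<subseteq> {..<n} \<and> card (v ` K) = r" if "v permutes {..<n}" "K \<subseteq> {..<n}" "card K = r" for v K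
    using that permutes_image[OF that(1)] by (auto simp: card_image permutes_inj_on)
  show "(`) w ` subsets_of_size n r \<subseteq> subsets_of_size n r"
       "(`) (inv w) ` subsets_of_size n r \<subseteq> subsets_of_size n r"
    unfolding subsets_of_size_def using *[OF assms] *[OF permutes_inv[OF assms]] by blast+
  show "\<forall>K\<in>subsets_of_size n r. inv w ` w ` K = K" "\<forall>K\<in>subsets_of_size n r. w ` inv w ` K = K"
    using i by (auto simp: image_image)
qed

lemma perm_act_macdonald_coef:
  assumes w: "w permutes {..<n}" and "K \<subseteq> {..<n}"
  shows "perm_act w (macdonald_coef n K) = macdonald_coef n (w ` K)"
proof -
  note k = khom_simps[OF khom_perm_act_permutes[OF w]]
  have inj: "inj_on w A" for A using w by (rule permutes_inj_on)
  have "{..<n} - w ` K = w ` ({..<n} - K)"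
    using permutes_image[OF w] permutes_inj[OF w] by (metis image_set_diff)
  then show ?thesis unfolding macdonald_coef_def
    by (simp add: k perm_act_var card_image[OF inj] prod.reindex[OF inj])
qed

lemma perm_act_macdonald_op:
  assumes w: "w permutes {..<n}" and f: "perm_act w f = f"
  shows "perm_act w (macdonald_op n r f) = macdonald_op n r f"
proof -
  note k = khom_simps[OF khom_perm_act_permutes[OF w]]
  have "perm_act w (macdonald_op n r f) =
    (\<Sum>K \<in> subsets_of_size n r. macdonald_coef n (w ` K) * multi_qshift n (ind (w ` K)) f)"
    unfolding macdonald_op_def k
  proof (rule sum.cong)
    fix K assume "K \<in> subsets_of_size n r"
    then have K: "K \<subseteq> {..<n}" by (simp add: subsets_of_size_def)
    have "ind K \<circ> inv w = ind (w ` K)"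
    proof
      fix i
      have "inv w i \<in> K \<longleftrightarrow> i \<in> w ` K"
        using permutes_inverses[OF w] by (metis image_iff)
      then show "(ind K \<circ> inv w) i = ind (w ` K) i" by simp
    qed
    then show "perm_act w (macdonald_coef n K) * perm_act w (multi_qshift n (ind K) f) =
        macdonald_coef n (w ` K) * multi_qshift n (ind (w ` K)) f"
      by (simp only: perm_act_macdonald_coef[OF w K] perm_act_multi_qshift[OF w] f)
  qed simp
  also have "\<dots> = macdonald_op n r f"
    unfolding macdonald_op_def
    by (rule sum.reindex_bij_betw[OF permutes_image_subsets_of_size[OF w]])
  finally show ?thesis .
qed

section \<open>Macdonald operators preserve symmetric polynomials\<close>

lemma monom_eval_diff_divisible:
  assumes "k < n" "l < n" "Poly_Mapping.keys e \<subseteq> {..<n}"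
  shows "\<exists>g\<in>pol n. monom_eval var e - monom_eval (var(k := var l)) e = (var k - var l) * g"
proof -
  let ?r = "\<Prod>i\<in>{..<n} - {k}. var i ^ Poly_Mapping.lookup e i"
  let ?a = "Poly_Mapping.lookup e k"
  have "monom_eval \<sigma> e = \<sigma> k ^ ?a * (\<Prod>i\<in>{..<n} - {k}. \<sigma> i ^ Poly_Mapping.lookup e i)" for \<sigma>
    using assms by (subst monom_eval_superset[of "{..<n}"]) (auto simp: prod.remove[of "{..<n}" k])
  then have "monom_eval var e = var k ^ ?a * ?r" "monom_eval (var(k := var l)) e = var l ^ ?a * ?r"
    by simp_all
  then have "monom_eval var e - monom_eval (var(k := var l)) e =
      (var k - var l) * ((\<Sum>i<?a. var l ^ (?a - Suc i) * var k ^ i) * ?r)"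
    by (simp add: power_diff_sumr2 flip: left_diff_distrib mult.assoc)
  moreover have "(\<Sum>i<?a. var l ^ (?a - Suc i) * var k ^ i) * ?r \<in> pol n"
    using assms by (intro pol_mult pol_sum pol_prod pol_power pol_var) auto
  ultimately show ?thesis by blast
qed

text \<open>
  The factor theorem for the linear form \<open>x\<^sub>k - x\<^sub>l\<close>: a polynomial differs from its
  specialisation at \<open>x\<^sub>k = x\<^sub>l\<close> by a multiple of \<open>x\<^sub>k - x\<^sub>l\<close>.
\<close>

lemma divisible_by_var_diff:
  assumes "k < n" "l < n" "p \<in> mpolys n" "mpol_subst (var(k := var l)) p = 0"
  shows "\<exists>g\<in>pol n. to_fract p = (var k - var l) * g"
proof -
  let ?\<sigma> = "var(k := var l)"
  have "\<exists>g\<in>pol n. monom_eval var e - monom_eval ?\<sigma> e = (var k - var l) * g" if "e \<in> Poly_Mapping.keys p" for e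
    using assms that by (intro monom_eval_diff_divisible) (auto simp: mpolys_def)
  then obtain g where g: "\<And>e. e \<in> Poly_Mapping.keys p \<Longrightarrow> g e \<in> pol n"
    "\<And>e. e \<in> Poly_Mapping.keys p \<Longrightarrow> monom_eval var e - monom_eval ?\<sigma> e = (var k - var l) * g e"
    by metis
  have "to_fract p = mpol_subst var p - mpol_subst ?\<sigma> p"
    by (simp add: mpol_subst_var assms(4))
  also have "\<dots> = (\<Sum>e\<in>Poly_Mapping.keys p. const (Poly_Mapping.lookup p e) * (monom_eval var e - monom_eval ?\<sigma> e))"
    by (simp add: mpol_subst_superset[of "Poly_Mapping.keys p"] right_diff_distrib sum_subtractf)
  also have "\<dots> = (var k - var l) * (\<Sum>e\<in>Poly_Mapping.keys p. const (Poly_Mapping.lookup p e) * g e)"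
    by (simp add: g(2) sum_distrib_left mult_ac)
  finally show ?thesis using g(1) by (blast intro: pol_sum pol_mult pol_const)
qed

text \<open>
  Exchanging \<open>x\<^sub>k\<close> and \<open>x\<^sub>l\<close> makes no difference after setting \<open>x\<^sub>k = x\<^sub>l\<close>.
\<close>

lemma perm_act_specialise:
  assumes "k \<noteq> l"
  obtains p' where "to_fract p' = perm_act (Transposition.transpose k l) (to_fract p)"
    "mpol_subst (var(k := var l)) p' = mpol_subst (var(k := var l)) p"
proof -
  let ?s = "Transposition.transpose k l"
  let ?m = "\<lambda>i. Poly_Mapping.single (Poly_Mapping.single (?s i) 1) 1 :: mpol"
  let ?\<sigma> = "var(k := var l)"
  have "(\<lambda>i. mpol_subst ?\<sigma> (?m i)) = ?\<sigma>"
    using assms by (auto simp: fun_eq_iff transpose_def)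
  moreover have "(\<lambda>i. to_fract (?m i)) = (\<lambda>i. var (?s i))" by (simp add: var_def)
  ultimately show ?thesis
    using mpol_subst_comp[of ?m p ?\<sigma>] that
    by (auto simp: perm_act_def ratfun_subst_to_fract)
qed

text \<open>
  A symmetric function cannot have a simple pole along \<open>x\<^sub>k = x\<^sub>l\<close>.  Write
  \<open>D (x\<^sub>k - x\<^sub>l) R = p\<close> with \<open>R\<close> the product of the remaining factors, and apply the exchange \<open>s\<close>
  of the two variables: \<open>D (x\<^sub>l - x\<^sub>k) (s R) = s p\<close>.  Hence \<open>p (s R) + (s p) R = 0\<close>, and setting
  \<open>x\<^sub>k = x\<^sub>l\<close> gives \<open>2 p R = 0\<close>.  As \<open>R\<close> does not vanish there, \<open>p\<close> does, and
  \<open>x\<^sub>k - x\<^sub>l\<close> can be cancelled.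
\<close>

lemma pol_of_symmetric_vandermonde:
  assumes D: "symmetric_fun n D" and S: "S \<subseteq> var_pairs n" and "D * vandermonde S \<in> pol n"
  shows "D \<in> pol n"
proof -
  have "finite S" using S by (rule finite_subset) simp
  then show ?thesis using assms(2,3)
  proof (induction S rule: finite_induct)
    case empty
    then show ?case by (simp add: vandermonde_def)
  next
    case (insert x S)
    obtain k l where x: "x = (k, l)" by (cases x)
    then have kl: "k < l" "l < n" "k < n" using insert.prems(1) by (auto simp: var_pairs_def)
    let ?s = "Transposition.transpose k l" and ?\<sigma> = "var(k := var l)"
    have s: "?s permutes {..<n}" using kl by (intro permutes_swap_id) auto
    note ks = khom_simps[OF khom_perm_act_permutes[OF s]]
    have V: "vandermonde (insert x S) = (var k - var l) * vandermonde S"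
      using insert.hyps x by (simp add: vandermonde_def)
    obtain p where p: "p \<in> mpolys n" "D * vandermonde (insert x S) = to_fract p"
      using insert.prems(2) by (auto simp: pol_def)
    let ?v = "\<lambda>i. Poly_Mapping.single (Poly_Mapping.single i 1) 1 :: mpol"
    define r where "r = (\<Prod>(i, j)\<in>S. ?v i - ?v j)"
    have r: "to_fract r = vandermonde S"
      unfolding r_def vandermonde_def case_prod_unfold by (simp add: to_fract_prod var_def)
    obtain p' where p': "to_fract p' = perm_act ?s (to_fract p)" "mpol_subst ?\<sigma> p' = mpol_subst ?\<sigma> p"
      using kl perm_act_specialise[of k l p] by auto
    obtain r' where r': "to_fract r' = perm_act ?s (to_fract r)" "mpol_subst ?\<sigma> r' = mpol_subst ?\<sigma> r"
      using kl perm_act_specialise[of k l r] by auto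
    have 1: "to_fract p' = D * (var l - var k) * to_fract r'"
      unfolding p' r' using D s by (simp add: V r ks symmetric_fun_def perm_act_var flip: p(2))
    have 2: "to_fract p = D * (var k - var l) * to_fract r"
      unfolding p(2)[symmetric] V r by (simp only: mult.assoc)
    have "to_fract (p * r' + p' * r) = 0"
      unfolding to_fract_add to_fract_mult 1 2 by (simp add: algebra_simps)
    then have "p * r' + p' * r = 0" by (simp only: to_fract_eq_0_iff)
    then have "mpol_subst ?\<sigma> (p * r' + p' * r) = 0" by simp
    then have "of_nat 2 * (mpol_subst ?\<sigma> p * mpol_subst ?\<sigma> r) = 0"
      by (simp add: mpol_subst_add mpol_subst_mult p'(2) r'(2))
    then have "mpol_subst ?\<sigma> p * mpol_subst ?\<sigma> r = 0"
      using of_nat_ratfun_eq_0_iff[of 2] by (metis mult_eq_0_iff zero_neq_numeral)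
    moreover have "mpol_subst ?\<sigma> r \<noteq> 0"
    proof -
      have "mpol_subst ?\<sigma> r = (\<Prod>(i, j)\<in>S. ?\<sigma> i - ?\<sigma> j)"
        unfolding r_def case_prod_unfold by (simp add: mpol_subst_prod mpol_subst_diff del: fun_upd_apply)
      moreover have "?\<sigma> i - ?\<sigma> j \<noteq> 0" if "(i, j) \<in> S" for i j
      proof -
        have "i < j" "(i, j) \<noteq> (k, l)" using that insert.prems(1) insert.hyps x by (auto simp: var_pairs_def)
        then show ?thesis using kl by auto
      qed
      ultimately show ?thesis using insert.hyps(1) by (auto simp del: fun_upd_apply)
    qed
    ultimately have "mpol_subst ?\<sigma> p = 0" by simp
    from divisible_by_var_diff[OF kl(3,2) p(1) this]
    obtain g where g: "g \<in> pol n" "to_fract p = (var k - var l) * g" by blast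
    have "(var k - var l) * (D * vandermonde S) = (var k - var l) * g"
      using p(2) V g(2) by (simp add: mult_ac)
    then have "D * vandermonde S = g" using kl by simp
    then show ?case using insert g(1) by simp
  qed
qed


lemma multi_qshift_pol: "f \<in> pol n \<Longrightarrow> multi_qshift n \<gamma> f \<in> pol n"
  by (rule khom_pol[OF khom_multi_qshift, of n]) (simp_all add: multi_qshift_var pol_mult pol_var)

lemma vandermonde_macdonald_op:
  "vandermonde (var_pairs n) * macdonald_op n r f = (\<Sum>K \<in> subsets_of_size n r.
     (\<Prod>(i, j) \<in> var_pairs n. const (if i \<in> K then indet_t else 1) * var i -
        const (if j \<in> K then indet_t else 1) * var j) * multi_qshift n (ind K) f)"
  unfolding macdonald_op_def sum_distrib_left mult.assoc[symmetric]
  by (rule sum.cong) (simp_all add: vandermonde_macdonald_coef subsets_of_size_def)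

lemma macdonald_op_symmetric_pols:
  assumes "f \<in> symmetric_pols n"
  shows "macdonald_op n r f \<in> symmetric_pols n"
proof -
  have "symmetric_fun n (macdonald_op n r f)"
    using assms by (simp add: symmetric_fun_def symmetric_pols_def perm_act_macdonald_op)
  moreover have "macdonald_op n r f * vandermonde (var_pairs n) \<in> pol n"
    unfolding mult.commute[of _ "vandermonde (var_pairs n)"] vandermonde_macdonald_op case_prod_unfold
    using assms
    by (intro pol_sum pol_mult pol_prod pol_diff pol_const multi_qshift_pol pol_var)
      (auto simp: var_pairs_def symmetric_pols_def)
  ultimately show ?thesis
    using pol_of_symmetric_vandermonde unfolding symmetric_pols_def by blast
qed

section \<open>Triangularity of the Macdonald operators\<close>

definition macdonald_eigenvalue :: "nat \<Rightarrow> nat \<Rightarrow> (nat \<Rightarrow> nat) \<Rightarrow> coef" where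
  "macdonald_eigenvalue n r \<mu> =
     (\<Sum>K \<in> subsets_of_size n r. \<Prod>i\<in>K. indet_q ^ \<mu> i * indet_t ^ (n - Suc i))"

lemma leading_term_multi_qshift:
  assumes "leading_term f e c" "Poly_Mapping.keys e \<subseteq> {..<n}" "K \<subseteq> {..<n}"
  shows "leading_term (multi_qshift n (ind K) f) e (c * (\<Prod>i\<in>K. indet_q ^ Poly_Mapping.lookup e i))"
proof -
  let ?s = "\<lambda>i. if i \<in> K then indet_q else 1"
  have "multi_qshift n (ind K) (var i) = const (?s i) * var i" for i
    using assms(3) by (auto simp: multi_qshift_var)
  from leading_term_scale[OF khom_multi_qshift this assms(1)]
  have "leading_term (multi_qshift n (ind K) f) e
      (c * (\<Prod>i\<in>Poly_Mapping.keys e. ?s i ^ Poly_Mapping.lookup e i))" .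
  moreover have "(\<Prod>i\<in>Poly_Mapping.keys e. ?s i ^ Poly_Mapping.lookup e i) =
      (\<Prod>i<n. ?s i ^ Poly_Mapping.lookup e i)"
    by (rule prod.mono_neutral_left) (use assms(2) in \<open>auto simp: in_keys_iff\<close>)
  moreover have "\<dots> = (\<Prod>i\<in>K. ?s i ^ Poly_Mapping.lookup e i)"
    by (rule prod.mono_neutral_right) (use assms(3) in auto)
  ultimately show ?thesis by simp
qed

text \<open>
  Leading terms can be divided: if the leading monomial of \<open>h\<close> exceeded \<open>e\<close>, that of \<open>v h\<close> would
  exceed \<open>d + e\<close>.
\<close>

lemma leading_term_cancel:
  assumes "h \<in> pol n" "leading_term v d a" "a \<noteq> 0" "leading_term (v * h) (d + e) c"
  shows "leading_term h e (c / a)"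
proof (cases "h = 0")
  case True
  then have "c = 0" using leading_term_unique[OF assms(4)] leading_term_0 by simp
  then show ?thesis using True by (simp add: leading_term_0)
next
  case False
  obtain k b where k: "leading_term h k b" "b \<noteq> 0"
    by (rule leading_term_exists[OF assms(1) False])
  have "leading_term (v * h) (d + k) (a * b)" by (rule leading_term_mult[OF assms(2) k(1)])
  moreover have "a * b \<noteq> 0" using k(2) assms(3) by simp
  ultimately have "d + k \<le> d + e" using leading_term_le[OF _ _ assms(4)] by blast
  then have "k \<le> e" by simp
  then obtain b' where b': "leading_term h e b'" using leading_term_le_imp[OF k(1)] by blast
  have "c = a * b'" by (rule leading_term_unique[OF assms(4) leading_term_mult[OF assms(2) b']])
  then show ?thesis using b' assms(3) by simp
qed

text \<open>
  After multiplication by the Vandermonde product, the summand of \<open>K\<close> is a product of two rescaled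
  polynomials, whose leading monomial does not depend on \<open>K\<close>.  Rescaling contributes
  \<open>t\<^bsup>n-1-i\<^esup> q\<^bsup>e i\<^esup>\<close> for every \<open>i \<in> K\<close>, and the sum over \<open>K\<close> is the elementary
  symmetric function \<open>macdonald_eigenvalue\<close>.
\<close>

lemma leading_term_macdonald_op:
  assumes f: "f \<in> symmetric_pols n" and lt: "leading_term f e c" and e: "Poly_Mapping.keys e \<subseteq> {..<n}"
  shows "leading_term (macdonald_op n r f) e (macdonald_eigenvalue n r (Poly_Mapping.lookup e) * c)"
proof -
  let ?V = "vandermonde (var_pairs n)" and ?d = "\<Sum>(i, j) \<in> var_pairs n. Poly_Mapping.single i (1::nat)"
  let ?s = "\<lambda>K i. if i \<in> K then indet_t else 1"
  have "leading_term ?V ?d 1"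
    using leading_term_scaled_vandermonde[of "\<lambda>_. 1" n] by (simp add: vandermonde_def)
  moreover have "leading_term (?V * macdonald_op n r f) (?d + e)
      (macdonald_eigenvalue n r (Poly_Mapping.lookup e) * c)"
  proof -
    have "leading_term ((\<Prod>(i, j) \<in> var_pairs n. const (?s K i) * var i - const (?s K j) * var j)
        * multi_qshift n (ind K) f) (?d + e)
        ((\<Prod>i\<in>K. indet_q ^ Poly_Mapping.lookup e i * indet_t ^ (n - Suc i)) * c)"
      if "K \<in> subsets_of_size n r" for K
    proof -
      have K: "K \<subseteq> {..<n}" using that by (simp add: subsets_of_size_def)
      have "(\<Prod>i<n. ?s K i ^ (n - Suc i)) = (\<Prod>i\<in>K. ?s K i ^ (n - Suc i))"
        by (rule prod.mono_neutral_right) (use K in auto)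
      also have "\<dots> = (\<Prod>i\<in>K. indet_t ^ (n - Suc i))" by simp
      finally have *: "(\<Prod>i<n. ?s K i ^ (n - Suc i)) * (c * (\<Prod>i\<in>K. indet_q ^ Poly_Mapping.lookup e i))
        = (\<Prod>i\<in>K. indet_q ^ Poly_Mapping.lookup e i * indet_t ^ (n - Suc i)) * c"
        by (simp add: prod.distrib mult_ac)
      show ?thesis unfolding *[symmetric]
        by (rule leading_term_mult[OF leading_term_scaled_vandermonde leading_term_multi_qshift[OF lt e K]])
    qed
    then show ?thesis
      unfolding vandermonde_macdonald_op macdonald_eigenvalue_def sum_distrib_right
      by (rule leading_term_sum)
  qed
  ultimately show ?thesis
    using leading_term_cancel[of "macdonald_op n r f" n ?V ?d 1 e] macdonald_op_symmetric_pols[OF f, of r]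
    by (simp add: symmetric_pols_def)
qed

lemma macdonald_op_add: "macdonald_op n r (f + g) = macdonald_op n r f + macdonald_op n r g"
  by (simp add: macdonald_op_def khom_add[OF khom_multi_qshift] distrib_left sum.distrib)

lemma macdonald_op_const_mult: "macdonald_op n r (const c * f) = const c * macdonald_op n r f"
  by (simp add: macdonald_op_def khom_mult[OF khom_multi_qshift] khom_const[OF khom_multi_qshift]
      sum_distrib_left mult_ac)

lemma macdonald_op_0: "macdonald_op n r 0 = 0"
  by (simp add: macdonald_op_def khom_0[OF khom_multi_qshift])

lemma macdonald_op_diff: "macdonald_op n r (f - g) = macdonald_op n r f - macdonald_op n r g"
  by (simp add: macdonald_op_def khom_diff[OF khom_multi_qshift] right_diff_distrib sum_subtractf)

section \<open>Commutativity of the Macdonald operators\<close>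

text \<open>
  Compare the top coefficients of \<open>p\<close> and of its Lagrange interpolation polynomial at the nodes
  \<open>S\<close>.
\<close>

lemma sum_lagrange_leading_coeff:
  fixes p :: "'a::field poly"
  assumes "finite S" "degree p < card S"
  shows "(\<Sum>a\<in>S. poly p a / (\<Prod>b\<in>S - {a}. a - b)) = coeff p (card S - 1)"
proof -
  let ?N = "\<lambda>a. \<Prod>b\<in>S - {a}. [:- b, 1:]"
  let ?q = "\<Sum>a\<in>S. smult (poly p a / (\<Prod>b\<in>S - {a}. a - b)) (?N a)"
  have degN: "degree (?N a) = card S - 1" if "a \<in> S" for a
    using assms(1) that by (subst degree_prod_sum_eq) auto
  have "p = ?q"
  proof (rule poly_eqI_degree[of S])
    fix x assume x: "x \<in> S"
    have N: "poly (?N a) x = (\<Prod>b\<in>S - {a}. x - b)" for a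
      by (simp add: poly_prod)
    have "poly ?q x = (\<Sum>a\<in>S. poly p a / (\<Prod>b\<in>S - {a}. a - b) * (\<Prod>b\<in>S - {a}. x - b))"
      by (simp add: poly_sum N)
    also have "\<dots> = (\<Sum>a\<in>{x}. poly p a / (\<Prod>b\<in>S - {a}. a - b) * (\<Prod>b\<in>S - {a}. x - b))"
      using x assms(1) by (intro sum.mono_neutral_right) auto
    also have "\<dots> = poly p x" using assms(1) by simp
    finally show "poly p x = poly ?q x" ..
  next
    have "degree ?q \<le> card S - 1"
      using assms(1) degN by (intro degree_sum_le order.trans[OF degree_smult_le]) auto
    then show "degree ?q < card S" using assms(2) by linarith
  qed (use assms(2) in simp)
  then have "coeff p (card S - 1) = coeff ?q (card S - 1)" by (rule arg_cong)
  also have "\<dots> = (\<Sum>a\<in>S. poly p a / (\<Prod>b\<in>S - {a}. a - b))"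
  proof -
    have "coeff (?N a) (card S - 1) = 1" if "a \<in> S" for a
      using lead_coeff_prod[of "\<lambda>b. [:- b, 1:]" "S - {a}"] degN[OF that] by simp
    then show ?thesis by (simp add: coeff_sum)
  qed
  finally show ?thesis ..
qed

definition macdonald_factor :: "'a::field \<Rightarrow> 'a \<Rightarrow> 'a \<Rightarrow> 'a" where
  "macdonald_factor t a b = (1 - t * a / b) / (1 - a / b)"

lemma macdonald_factor_eq:
  assumes "b \<noteq> 0"
  shows "macdonald_factor t a b = (b - t * a) / (b - a)"
proof -
  have "macdonald_factor t a b = ((b - t * a) / b) / ((b - a) / b)"
    using assms by (simp add: macdonald_factor_def diff_divide_distrib)
  then show ?thesis using assms by simp
qed

text \<open>
  Apply \<open>sum_lagrange_leading_coeff\<close> to the polynomial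
  \<open>p(z) = \<Prod>\<^sub>k (x\<^sub>k - t z) (q z - t x\<^sub>k)\<close> of degree \<open>2 |L|\<close> and the \<open>2 |L| + 1\<close> nodes \<open>0\<close>,
  \<open>x\<^sub>k\<close> and \<open>x\<^sub>k / q\<close>.  The node \<open>0\<close> already contributes the leading coefficient, so the other
  contributions cancel; up to a common constant, the nodes \<open>x\<^sub>i\<close> give the summands on the left, and
  the nodes \<open>x\<^sub>i / q\<close> give minus those on the right.
\<close>

lemma macdonald_factor_exchange:
  fixes x :: "'i \<Rightarrow> 'a::field"
  assumes L: "finite L" and inj: "inj_on x L" and nz: "\<And>i. i \<in> L \<Longrightarrow> x i \<noteq> 0"
    and q: "q \<noteq> 0" "q \<noteq> 1" and t: "t \<noteq> 0" "t \<noteq> 1" "t \<noteq> q"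
    and gen: "\<And>i j. i \<in> L \<Longrightarrow> j \<in> L \<Longrightarrow> q * x i \<noteq> x j"
  shows "(\<Sum>i\<in>L. \<Prod>k\<in>L - {i}. macdonald_factor t (x i) (x k) * macdonald_factor t (x k) (q * x i)) =
         (\<Sum>i\<in>L. \<Prod>k\<in>L - {i}. macdonald_factor t (x k) (x i) * macdonald_factor t (x i) (q * x k))"
    (is "(\<Sum>i\<in>L. ?l i) = (\<Sum>i\<in>L. ?r i)")
proof (cases "L = {}")
  case False
  define r where "r = card L"
  let ?A = "x ` L" and ?B = "(\<lambda>i. x i / q) ` L"
  define S where "S = insert 0 (?A \<union> ?B)"
  define p where "p = (\<Prod>k\<in>L. [:x k, - t:] * [:- t * x k, q:])"
  \<comment> \<open>The part of the Lagrange summand at x i that comes from the node 0 and the factors with k = i.\<close>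
  define c where "c = (1 - t) * (q - t) * q / (q - 1)"
  have injB: "inj_on (\<lambda>i. x i / q) L" using inj q by (auto simp: inj_on_def)
  have disj: "?A \<inter> ?B = {}" "0 \<notin> ?A \<union> ?B"
  proof -
    show "?A \<inter> ?B = {}"
    proof (rule ccontr)
      assume "?A \<inter> ?B \<noteq> {}"
      then obtain i j where ij: "i \<in> L" "j \<in> L" "x i = x j / q" by auto
      then have "q * x i = x j" using q by simp
      then show False using gen[OF ij(1,2)] by simp
    qed
    show "0 \<notin> ?A \<union> ?B" using nz q by auto
  qed
  have cardS: "card S = 2 * r + 1"
    using L disj by (simp add: S_def r_def card_Un_disjoint card_image[OF inj] card_image[OF injB])
  have degp: "degree p = 2 * r"
    unfolding p_def using t q nz L by (subst degree_prod_sum_eq) (auto simp: degree_mult_eq r_def)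
  have lc: "coeff p (2 * r) = (- t * q) ^ r"
    using lead_coeff_prod[of "\<lambda>k. [:x k, - t:] * [:- t * x k, q:]" L] t q
    unfolding degp[symmetric] by (simp add: p_def lead_coeff_mult r_def del: mult_pCons_left mult_pCons_right)
  have pz: "poly p z = (\<Prod>k\<in>L. (x k - t * z) * (q * z - t * x k))" for z
    unfolding p_def by (simp add: poly_prod algebra_simps)
  let ?d = "\<lambda>a. \<Prod>b\<in>S - {a}. a - b"
  have split: "(\<Prod>k\<in>L. f k) = f i * (\<Prod>k\<in>L - {i}. f k)" if "i \<in> L" for f :: "'i \<Rightarrow> 'a" and i
    using L that by (rule prod.remove)
  have t0: "poly p 0 / ?d 0 = (- t * q) ^ r"
  proof -
    have "S - {0} = ?A \<union> ?B" using disj by (auto simp: S_def)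
    then have "?d 0 = (\<Prod>b\<in>?A. 0 - b) * (\<Prod>b\<in>?B. 0 - b)"
      using L disj by (simp add: prod.union_disjoint)
    also have "\<dots> = (\<Prod>k\<in>L. - x k * (- (x k / q)))"
      unfolding prod.reindex[OF inj] prod.reindex[OF injB] by (simp flip: prod.distrib)
    finally have d: "?d 0 = (\<Prod>k\<in>L. - x k * (- (x k / q)))" .
    have n: "poly p 0 = (\<Prod>k\<in>L. x k * (- t * x k))"
      unfolding pz by simp
    have "poly p 0 / ?d 0 = (\<Prod>k\<in>L. (x k * (- t * x k)) / (- x k * (- (x k / q))))"
      unfolding n d by (rule prod_dividef[symmetric])
    also have "\<dots> = (\<Prod>k\<in>L. - t * q)"
      using nz q by (intro prod.cong) (auto simp: field_simps)
    finally show ?thesis by (simp add: r_def)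
  qed
  have tA: "poly p (x i) / ?d (x i) = c * (- q) ^ (r - 1) * ?l i" if i: "i \<in> L" for i
  proof -
    have "S - {x i} = insert 0 (x ` (L - {i}) \<union> ?B)"
      using disj i nz inj by (auto simp: S_def inj_on_def)
    moreover have "x ` (L - {i}) \<inter> ?B = {}" "0 \<notin> x ` (L - {i}) \<union> ?B" using disj by auto
    ultimately have "?d (x i) = x i * ((\<Prod>b\<in>x ` (L - {i}). x i - b) * (\<Prod>b\<in>?B. x i - b))"
      using L by (simp add: prod.union_disjoint)
    also have "(\<Prod>b\<in>x ` (L - {i}). x i - b) = (\<Prod>k\<in>L - {i}. x i - x k)"
      by (subst prod.reindex) (use inj in \<open>auto simp: inj_on_def\<close>)
    also have "(\<Prod>b\<in>?B. x i - b) = (x i - x i / q) * (\<Prod>k\<in>L - {i}. x i - x k / q)"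
      unfolding prod.reindex[OF injB] by (simp add: split[OF i])
    finally have "?d (x i) = (x i * (x i - x i / q)) * (\<Prod>k\<in>L - {i}. (x i - x k) * (x i - x k / q))"
      by (simp add: prod.distrib mult_ac)
    moreover have "poly p (x i) = ((x i - t * x i) * (q * x i - t * x i)) *
        (\<Prod>k\<in>L - {i}. (x k - t * x i) * (q * x i - t * x k))"
      unfolding pz by (rule split[OF i])
    ultimately have "poly p (x i) / ?d (x i) =
       (((x i - t * x i) * (q * x i - t * x i)) / (x i * (x i - x i / q))) *
       (\<Prod>k\<in>L - {i}. ((x k - t * x i) * (q * x i - t * x k)) / ((x i - x k) * (x i - x k / q)))"
      by (simp only: prod_dividef times_divide_times_eq)
    also have "((x i - t * x i) * (q * x i - t * x i)) / (x i * (x i - x i / q)) = c"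
    proof -
      have "x i - x i / q = x i * (q - 1) / q" using q by (simp add: field_simps)
      moreover have "(x i - t * x i) * (q * x i - t * x i) = x i * x i * ((1 - t) * (q - t))"
        by (simp add: algebra_simps)
      ultimately show ?thesis using nz[OF i] q by (simp add: c_def)
    qed
    also have "(\<Prod>k\<in>L - {i}. ((x k - t * x i) * (q * x i - t * x k)) / ((x i - x k) * (x i - x k / q))) =
       (\<Prod>k\<in>L - {i}. (- q) * (macdonald_factor t (x i) (x k) * macdonald_factor t (x k) (q * x i)))"
    proof (rule prod.cong)
      fix k assume k: "k \<in> L - {i}"
      have "(x i - x k) * (x i - x k / q) = (x k - x i) * (q * x i - x k) / (- q)"
        using q by (simp add: field_simps)
      then show "((x k - t * x i) * (q * x i - t * x k)) / ((x i - x k) * (x i - x k / q)) =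
          (- q) * (macdonald_factor t (x i) (x k) * macdonald_factor t (x k) (q * x i))"
        using nz[OF i] nz[of k] k q by (simp add: macdonald_factor_eq)
    qed simp
    also have "\<dots> = (- q) ^ (r - 1) * ?l i"
      using L i by (simp only: prod.distrib prod_constant) (simp add: r_def)
    finally show ?thesis by (simp only: mult.assoc)
  qed
  have tB: "poly p (x i / q) / ?d (x i / q) = - c * (- q) ^ (r - 1) * ?r i" if i: "i \<in> L" for i
  proof -
    have "S - {x i / q} = insert 0 (?A \<union> (\<lambda>i. x i / q) ` (L - {i}))"
      using disj i nz injB q by (auto simp: S_def inj_on_def)
    moreover have "?A \<inter> (\<lambda>i. x i / q) ` (L - {i}) = {}" "0 \<notin> ?A \<union> (\<lambda>i. x i / q) ` (L - {i})" using disj by auto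
    ultimately have "?d (x i / q) = x i / q *
        ((\<Prod>b\<in>?A. x i / q - b) * (\<Prod>b\<in>(\<lambda>i. x i / q) ` (L - {i}). x i / q - b))"
      using L by (simp add: prod.union_disjoint)
    also have "(\<Prod>b\<in>(\<lambda>i. x i / q) ` (L - {i}). x i / q - b) = (\<Prod>k\<in>L - {i}. x i / q - x k / q)"
      by (subst prod.reindex) (use injB in \<open>auto simp: inj_on_def\<close>)
    also have "(\<Prod>b\<in>?A. x i / q - b) = (x i / q - x i) * (\<Prod>k\<in>L - {i}. x i / q - x k)"
      unfolding prod.reindex[OF inj] by (simp add: split[OF i])
    finally have "?d (x i / q) = (x i / q * (x i / q - x i)) * (\<Prod>k\<in>L - {i}. (x i / q - x k) * (x i / q - x k / q))"
      by (simp add: prod.distrib mult_ac)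
    moreover have "poly p (x i / q) = ((x i - t * (x i / q)) * (q * (x i / q) - t * x i)) *
        (\<Prod>k\<in>L - {i}. (x k - t * (x i / q)) * (q * (x i / q) - t * x k))"
      unfolding pz by (rule split[OF i])
    ultimately have "poly p (x i / q) / ?d (x i / q) =
       (((x i - t * (x i / q)) * (q * (x i / q) - t * x i)) / (x i / q * (x i / q - x i))) *
       (\<Prod>k\<in>L - {i}. ((x k - t * (x i / q)) * (q * (x i / q) - t * x k)) / ((x i / q - x k) * (x i / q - x k / q)))"
      by (simp only: prod_dividef times_divide_times_eq)
    also have "((x i - t * (x i / q)) * (q * (x i / q) - t * x i)) / (x i / q * (x i / q - x i)) = - c"
    proof -
      have "x i / q * (x i / q - x i) = x i * x i * (- (q - 1) / (q * q))" using q by (simp add: field_simps)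
      moreover have "(x i - t * (x i / q)) * (q * (x i / q) - t * x i) = x i * x i * ((1 - t) * (q - t) / q)"
        using q by (simp add: field_simps)
      moreover have "- c = (1 - t) * (q - t) * q / (1 - q)"
        using minus_divide_right[of "(1 - t) * (q - t) * q" "q - 1"] by (simp add: c_def)
      ultimately show ?thesis using nz[OF i] q by (simp add: mult.assoc)
    qed
    also have "(\<Prod>k\<in>L - {i}. ((x k - t * (x i / q)) * (q * (x i / q) - t * x k)) / ((x i / q - x k) * (x i / q - x k / q))) =
       (\<Prod>k\<in>L - {i}. (- q) * (macdonald_factor t (x k) (x i) * macdonald_factor t (x i) (q * x k)))"
    proof (rule prod.cong)
      fix k assume k: "k \<in> L - {i}"
      have "(x i / q - x k) * (x i / q - x k / q) = (x i - x k) * (q * x k - x i) / (- (q * q))"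
        using q by (simp add: field_simps)
      moreover have "(x k - t * (x i / q)) * (q * (x i / q) - t * x k) = (x i - t * x k) * (q * x k - t * x i) / q"
        using q by (simp add: field_simps)
      ultimately show "((x k - t * (x i / q)) * (q * (x i / q) - t * x k)) / ((x i / q - x k) * (x i / q - x k / q)) =
          (- q) * (macdonald_factor t (x k) (x i) * macdonald_factor t (x i) (q * x k))"
        using nz[OF i] nz[of k] k q by (simp add: macdonald_factor_eq)
    qed simp
    also have "\<dots> = (- q) ^ (r - 1) * ?r i"
      using L i by (simp only: prod.distrib prod_constant) (simp add: r_def)
    finally show ?thesis by (simp only: mult.assoc)
  qed
  have "(\<Sum>a\<in>S. poly p a / ?d a) = (- t * q) ^ r"
    using sum_lagrange_leading_coeff[of S p] L degp cardS lc by (simp add: S_def)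
  also have "(\<Sum>a\<in>S. poly p a / ?d a) = poly p 0 / ?d 0 + ((\<Sum>a\<in>?A. poly p a / ?d a) + (\<Sum>a\<in>?B. poly p a / ?d a))"
    unfolding S_def using L disj by (subst sum.insert) (simp_all add: sum.union_disjoint)
  also have "(\<Sum>a\<in>?A. poly p a / ?d a) = c * (- q) ^ (r - 1) * (\<Sum>i\<in>L. ?l i)"
    unfolding sum.reindex[OF inj] by (simp add: tA sum_distrib_left)
  also have "(\<Sum>a\<in>?B. poly p a / ?d a) = - c * (- q) ^ (r - 1) * (\<Sum>i\<in>L. ?r i)"
    unfolding sum.reindex[OF injB] by (simp add: tB sum_distrib_left)
  finally have eq: "c * (- q) ^ (r - 1) * (\<Sum>i\<in>L. ?l i) = c * (- q) ^ (r - 1) * (\<Sum>i\<in>L. ?r i)"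
    unfolding t0 by simp
  have "c * (- q) ^ (r - 1) \<noteq> 0" using q t by (simp add: c_def)
  from mult_left_cancel[OF this] eq show ?thesis by blast
qed simp


lemma indet_neq [simp]:
  "indet_q \<noteq> 1" "indet_t \<noteq> 1" "indet_t \<noteq> indet_q"
  by (simp_all add: indet_q_def indet_t_def flip: to_fract_1) (simp_all add: one_pCons)

abbreviation vfac :: "ratfun \<Rightarrow> ratfun \<Rightarrow> ratfun" where
  "vfac \<equiv> macdonald_factor (const indet_t)"

lemma macdonald_coef_vfac:
  "macdonald_coef n K = const indet_t ^ (card K choose 2) * (\<Prod>i \<in> K. \<Prod>j \<in> {..<n} - K. vfac (var i) (var j))"
  by (simp add: macdonald_coef_def macdonald_factor_def)

lemma khom_vfac: "khom h \<Longrightarrow> h (vfac a b) = vfac (h a) (h b)"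
  unfolding macdonald_factor_def by (simp only: khom_divide khom_diff khom_mult khom_const khom_1)

lemma multi_qshift_ind_var:
  "K \<subseteq> {..<n} \<Longrightarrow> multi_qshift n (ind K) (var i) = (if i \<in> K then const indet_q * var i else var i)"
  by (auto simp: multi_qshift_var)

lemma multi_qshift_macdonald_coef:
  assumes "S \<subseteq> {..<n}"
  shows "multi_qshift n (ind S) (macdonald_coef n K) = const indet_t ^ (card K choose 2) *
    (\<Prod>i \<in> K. \<Prod>j \<in> {..<n} - K. vfac (if i \<in> S then const indet_q * var i else var i)
       (if j \<in> S then const indet_q * var j else var j))"
  unfolding macdonald_coef_vfac
  by (simp add: khom_mult[OF khom_multi_qshift] khom_power[OF khom_multi_qshift]
      khom_const[OF khom_multi_qshift] khom_prod[OF khom_multi_qshift] khom_vfac[OF khom_multi_qshift]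
      multi_qshift_ind_var[OF assms])

lemma vfac_scale: "vfac (const indet_q * a) (const indet_q * b) = vfac a b"
  by (simp add: macdonald_factor_def)

lemma one_choose_two [simp]: "Suc 0 choose 2 = 0"
  by (simp add: binomial_eq_0)

text \<open>
  The case \<open>i \<in> K\<close> of the commutation of \<open>D\<^sub>1\<close> and \<open>D\<^sub>r\<close>, in which the coefficients of the two
  products agree term by term.
\<close>

lemma macdonald_coef_exchange_inside:
  assumes K: "K \<subseteq> {..<n}" and i: "i \<in> K"
  shows "macdonald_coef n {i} * multi_qshift n (ind {i}) (macdonald_coef n K) =
         macdonald_coef n K * multi_qshift n (ind K) (macdonald_coef n {i})"
proof -
  have fin: "finite K" using K finite_subset by blast
  have i': "{i} \<subseteq> {..<n}" using K i by auto
  let ?N = "{..<n} - K"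
  have N: "{..<n} - {i} = (K - {i}) \<union> ?N" "(K - {i}) \<inter> ?N = {}" using K i by auto
  have split: "(\<Prod>j\<in>{..<n} - {i}. g j) = (\<Prod>j\<in>K - {i}. g j) * (\<Prod>j\<in>?N. g j)" for g :: "nat \<Rightarrow> ratfun"
    unfolding N(1) using fin N(2) by (intro prod.union_disjoint) auto
  have remove: "(\<Prod>k\<in>K. g k) = g i * (\<Prod>k\<in>K - {i}. g k)" for g :: "nat \<Rightarrow> ratfun"
    using fin i by (rule prod.remove)
  let ?X = "\<Prod>j\<in>K - {i}. vfac (var i) (var j)" and ?Y = "\<Prod>j\<in>?N. vfac (var i) (var j)"
  let ?Z = "\<Prod>k\<in>K - {i}. \<Prod>j\<in>?N. vfac (var k) (var j)" and ?W = "\<Prod>j\<in>?N. vfac (const indet_q * var i) (var j)"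
  let ?c = "const indet_t ^ (card K choose 2)"
  have 1: "macdonald_coef n {i} = ?X * ?Y"
    by (simp add: macdonald_coef_vfac split)
  have 2: "macdonald_coef n K = ?c * (?Y * ?Z)"
    by (simp add: macdonald_coef_vfac remove)
  have 3: "multi_qshift n (ind {i}) (macdonald_coef n K) = ?c * (?W * ?Z)"
  proof -
    have "(\<Prod>j\<in>?N. vfac (const indet_q * var i) (if j \<in> {i} then const indet_q * var j else var j)) = ?W"
      using i by (intro prod.cong) auto
    moreover have "(\<Prod>k\<in>K - {i}. \<Prod>j\<in>?N. vfac (if k \<in> {i} then const indet_q * var k else var k)
        (if j \<in> {i} then const indet_q * var j else var j)) = ?Z"
      using i by (intro prod.cong) auto
    ultimately show ?thesis
      unfolding multi_qshift_macdonald_coef[OF i'] remove by simp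
  qed
  have 4: "multi_qshift n (ind K) (macdonald_coef n {i}) = ?X * ?W"
  proof -
    have "(\<Prod>j\<in>K - {i}. vfac (const indet_q * var i) (if j \<in> K then const indet_q * var j else var j)) = ?X"
      by (intro prod.cong) (auto simp: vfac_scale)
    moreover have "(\<Prod>j\<in>?N. vfac (const indet_q * var i) (if j \<in> K then const indet_q * var j else var j)) = ?W"
      by (intro prod.cong) auto
    ultimately show ?thesis
      unfolding multi_qshift_macdonald_coef[OF K] using i by (simp add: split)
  qed
  show ?thesis unfolding 3 4 unfolding 1 2 by (simp add: mult_ac)
qed

text \<open>
  The case \<open>i \<notin> K\<close>, with \<open>L = K \<union> {i}\<close>.  The two coefficients differ in general, but they have the common
  factor \<open>P\<close>, which depends only on \<open>L\<close> and \<open>|K| = |L| - 1\<close>.  Only after summation over \<open>i \<in> L\<close>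
  do the remaining factors agree.
\<close>

lemma macdonald_coef_exchange_outside:
  assumes L: "L \<subseteq> {..<n}" and i: "i \<in> L"
  defines "P \<equiv> const indet_t ^ (card (L - {i}) choose 2) * (\<Prod>k\<in>L. \<Prod>j\<in>{..<n} - L. vfac (var k) (var j))"
  shows "macdonald_coef n {i} * multi_qshift n (ind {i}) (macdonald_coef n (L - {i})) =
           P * (\<Prod>k\<in>L - {i}. vfac (var i) (var k) * vfac (var k) (const indet_q * var i))"
    and "macdonald_coef n (L - {i}) * multi_qshift n (ind (L - {i})) (macdonald_coef n {i}) =
           P * (\<Prod>k\<in>L - {i}. vfac (var k) (var i) * vfac (var i) (const indet_q * var k))"
proof -
  have fin: "finite L" using L finite_subset by blast
  have i': "{i} \<subseteq> {..<n}" "L - {i} \<subseteq> {..<n}" using L i by auto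
  let ?K = "L - {i}" and ?N = "{..<n} - L"
  have N: "{..<n} - {i} = ?K \<union> ?N" "?K \<inter> ?N = {}" "{..<n} - ?K = insert i ?N" "i \<notin> ?N"
    using L i by auto
  have split: "(\<Prod>j\<in>{..<n} - {i}. g j) = (\<Prod>j\<in>?K. g j) * (\<Prod>j\<in>?N. g j)" for g :: "nat \<Rightarrow> ratfun"
    unfolding N(1) using fin N(2) by (intro prod.union_disjoint) auto
  have split2: "(\<Prod>j\<in>{..<n} - ?K. g j) = g i * (\<Prod>j\<in>?N. g j)" for g :: "nat \<Rightarrow> ratfun"
    unfolding N(3) using N(4) by (intro prod.insert) auto
  have remove: "(\<Prod>k\<in>L. g k) = g i * (\<Prod>k\<in>?K. g k)" for g :: "nat \<Rightarrow> ratfun"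
    using fin i by (rule prod.remove)
  let ?X = "\<Prod>j\<in>?K. vfac (var i) (var j)" and ?Y = "\<Prod>j\<in>?N. vfac (var i) (var j)"
  let ?Z = "\<Prod>k\<in>?K. \<Prod>j\<in>?N. vfac (var k) (var j)"
  let ?c = "const indet_t ^ (card ?K choose 2)"
  have P: "P = ?c * (?Y * ?Z)" by (simp add: P_def remove)
  have 1: "macdonald_coef n {i} = ?X * ?Y"
    by (simp add: macdonald_coef_vfac split)
  have 2: "macdonald_coef n ?K = ?c * ((\<Prod>k\<in>?K. vfac (var k) (var i)) * ?Z)"
    unfolding macdonald_coef_vfac split2 by (simp add: prod.distrib)
  have 3: "multi_qshift n (ind {i}) (macdonald_coef n ?K) =
      ?c * ((\<Prod>k\<in>?K. vfac (var k) (const indet_q * var i)) * ?Z)"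
  proof -
    have "(\<Prod>k\<in>?K. \<Prod>j\<in>?N. vfac (if k \<in> {i} then const indet_q * var k else var k)
        (if j \<in> {i} then const indet_q * var j else var j)) = ?Z"
      using i by (intro prod.cong) auto
    moreover have "(\<Prod>k\<in>?K. vfac (if k \<in> {i} then const indet_q * var k else var k) (const indet_q * var i)) =
       (\<Prod>k\<in>?K. vfac (var k) (const indet_q * var i))"
      by (intro prod.cong) auto
    ultimately show ?thesis
      unfolding multi_qshift_macdonald_coef[OF i'(1)] split2 by (simp add: prod.distrib)
  qed
  have 4: "multi_qshift n (ind ?K) (macdonald_coef n {i}) =
     (\<Prod>k\<in>?K. vfac (var i) (const indet_q * var k)) * ?Y"
  proof -
    have "(\<Prod>j\<in>?K. vfac (var i) (if j \<in> ?K then const indet_q * var j else var j)) =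
       (\<Prod>k\<in>?K. vfac (var i) (const indet_q * var k))"
      by (intro prod.cong) auto
    moreover have "(\<Prod>j\<in>?N. vfac (var i) (if j \<in> ?K then const indet_q * var j else var j)) = ?Y"
      by (intro prod.cong) auto
    moreover have "i \<notin> ?K" by simp
    ultimately show ?thesis
      unfolding multi_qshift_macdonald_coef[OF i'(2)] by (simp del: Diff_iff add: split)
  qed
  show "macdonald_coef n {i} * multi_qshift n (ind {i}) (macdonald_coef n ?K) =
           P * (\<Prod>k\<in>?K. vfac (var i) (var k) * vfac (var k) (const indet_q * var i))"
    unfolding 1 3 P by (simp add: prod.distrib mult_ac)
  show "macdonald_coef n ?K * multi_qshift n (ind ?K) (macdonald_coef n {i}) =
           P * (\<Prod>k\<in>?K. vfac (var k) (var i) * vfac (var i) (const indet_q * var k))"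
    unfolding 2 4 P by (simp add: prod.distrib mult_ac)
qed

lemma macdonald_coef_exchange_sum:
  assumes L: "L \<subseteq> {..<n}"
  shows "(\<Sum>i\<in>L. macdonald_coef n {i} * multi_qshift n (ind {i}) (macdonald_coef n (L - {i}))) =
         (\<Sum>i\<in>L. macdonald_coef n (L - {i}) * multi_qshift n (ind (L - {i})) (macdonald_coef n {i}))"
proof -
  have fin: "finite L" using L finite_subset by blast
  let ?P = "const indet_t ^ (card L - 1 choose 2) * (\<Prod>k\<in>L. \<Prod>j\<in>{..<n} - L. vfac (var k) (var j))"
  have "const indet_q * var i \<noteq> var j" for i j
    using scaled_var_eq_iff[of indet_q i 1 j] by simp
  moreover have "const indet_q \<noteq> 1" "const indet_t \<noteq> 1"
    using const_eq_iff[of _ 1] by (simp_all del: const_eq_iff)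
  ultimately have "(\<Sum>i\<in>L. \<Prod>k\<in>L - {i}. vfac (var i) (var k) * vfac (var k) (const indet_q * var i)) =
         (\<Sum>i\<in>L. \<Prod>k\<in>L - {i}. vfac (var k) (var i) * vfac (var i) (const indet_q * var k))"
    by (intro macdonald_factor_exchange[OF fin]) (auto simp: inj_on_def)
  then have "(\<Sum>i\<in>L. ?P * (\<Prod>k\<in>L - {i}. vfac (var i) (var k) * vfac (var k) (const indet_q * var i))) =
         (\<Sum>i\<in>L. ?P * (\<Prod>k\<in>L - {i}. vfac (var k) (var i) * vfac (var i) (const indet_q * var k)))"
    unfolding sum_distrib_left[symmetric] by simp
  then show ?thesis
    using macdonald_coef_exchange_outside[OF L] fin by simp
qed

lemma macdonald_op_1: "macdonald_op n 1 f = (\<Sum>i<n. macdonald_coef n {i} * multi_qshift n (ind {i}) f)"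
  unfolding macdonald_op_def subsets_of_size_1 by (simp add: sum.reindex)

text \<open>
  Expand both products into terms with a shift \<open>T\<^sub>i T\<^sub>K\<close>.  The terms with \<open>i \<in> K\<close> agree
  individually; those with \<open>i \<notin> K\<close> are collected according to \<open>L = K \<union> {i}\<close>, which determines
  the shift.
\<close>

lemma macdonald_op_commute: "macdonald_op n 1 (macdonald_op n r f) = macdonald_op n r (macdonald_op n 1 f)"
proof -
  let ?A = "macdonald_coef n" and ?T = "\<lambda>K. multi_qshift n (ind K)"
  let ?S = "subsets_of_size n r" and ?S' = "subsets_of_size n (Suc r)"
  let ?l = "\<lambda>i K. ?A {i} * ?T {i} (?A K) * ?T {i} (?T K f)"
  let ?r = "\<lambda>i K. ?A K * ?T K (?A {i}) * ?T {i} (?T K f)"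
  have comm: "?T K (?T {i} f) = ?T {i} (?T K f)" for K i
    by (simp add: multi_qshift_comp add.commute)
  have l: "macdonald_op n 1 (macdonald_op n r f) = (\<Sum>K\<in>?S. \<Sum>i<n. ?l i K)"
    unfolding macdonald_op_1 unfolding macdonald_op_def
    by (subst sum.swap) (simp add: khom_sum[OF khom_multi_qshift] khom_mult[OF khom_multi_qshift] sum_distrib_left mult.assoc)
  have r: "macdonald_op n r (macdonald_op n 1 f) = (\<Sum>K\<in>?S. \<Sum>i<n. ?r i K)"
    unfolding macdonald_op_1 unfolding macdonald_op_def
    by (simp add: khom_sum[OF khom_multi_qshift] khom_mult[OF khom_multi_qshift] sum_distrib_left mult.assoc comm[simplified])
  have split: "(\<Sum>K\<in>?S. \<Sum>i<n. g i K) = (\<Sum>K\<in>?S. \<Sum>i\<in>K. g i K) + (\<Sum>L\<in>?S'. \<Sum>i\<in>L. g i (L - {i}))"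
    for g :: "nat \<Rightarrow> nat set \<Rightarrow> ratfun"
  proof -
    have "(\<Sum>i<n. g i K) = (\<Sum>i\<in>K. g i K) + (\<Sum>i\<in>{..<n} - K. g i K)" if "K \<in> ?S" for K
      using that by (subst sum.subset_diff[of K]) (auto simp: subsets_of_size_def)
    then have "(\<Sum>K\<in>?S. \<Sum>i<n. g i K) = (\<Sum>K\<in>?S. \<Sum>i\<in>K. g i K) + (\<Sum>K\<in>?S. \<Sum>i\<in>{..<n} - K. g i K)"
      by (simp add: sum.distrib)
    also have "(\<Sum>K\<in>?S. \<Sum>i\<in>{..<n} - K. g i K) = (\<Sum>(K, i)\<in>(SIGMA K:?S. {..<n} - K). g i K)"
      by (rule sum.Sigma) auto
    also have "\<dots> = (\<Sum>(L, i)\<in>(SIGMA L:?S'. L). g i (L - {i}))"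
    proof (rule sum.reindex_bij_witness[where j = "\<lambda>(K, i). (insert i K, i)" and i = "\<lambda>(L, i). (L - {i}, i)"])
      fix a assume "a \<in> (SIGMA K:?S. {..<n} - K)"
      then show "(case (case a of (K, i) \<Rightarrow> (insert i K, i)) of (L, i) \<Rightarrow> (L - {i}, i)) = a"
        "(case a of (K, i) \<Rightarrow> (insert i K, i)) \<in> (SIGMA L:?S'. L)"
        "(case case a of (K, i) \<Rightarrow> (insert i K, i) of (L, i) \<Rightarrow> g i (L - {i})) = (case a of (K, i) \<Rightarrow> g i K)"
        by (auto simp: subsets_of_size_def card_insert_if finite_subset[OF _ finite_lessThan])
    next
      fix b assume "b \<in> (SIGMA L:?S'. L)"
      then show "(case (case b of (L, i) \<Rightarrow> (L - {i}, i)) of (K, i) \<Rightarrow> (insert i K, i)) = b"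
        "(case b of (L, i) \<Rightarrow> (L - {i}, i)) \<in> (SIGMA K:?S. {..<n} - K)"
        by (auto simp: subsets_of_size_def card_Diff_singleton)
    qed
    also have "\<dots> = (\<Sum>L\<in>?S'. \<Sum>i\<in>L. g i (L - {i}))"
      by (rule sum.Sigma[symmetric]) (auto simp: subsets_of_size_def finite_subset[OF _ finite_lessThan])
    finally show ?thesis .
  qed
  have inside: "(\<Sum>K\<in>?S. \<Sum>i\<in>K. ?l i K) = (\<Sum>K\<in>?S. \<Sum>i\<in>K. ?r i K)"
    by (intro sum.cong refl arg_cong2[where f = "(*)"] macdonald_coef_exchange_inside) (auto simp: subsets_of_size_def)
  have outside: "(\<Sum>i\<in>L. ?l i (L - {i})) = (\<Sum>i\<in>L. ?r i (L - {i}))" if "L \<in> ?S'" for L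
  proof -
    have "?T {i} (?T (L - {i}) f) = ?T L f" if "i \<in> L" for i
      unfolding multi_qshift_comp using that by (intro arg_cong[where f = "\<lambda>\<gamma>. multi_qshift n \<gamma> f"]) auto
    then have "(\<Sum>i\<in>L. ?l i (L - {i})) = (\<Sum>i\<in>L. ?A {i} * ?T {i} (?A (L - {i}))) * ?T L f"
      "(\<Sum>i\<in>L. ?r i (L - {i})) = (\<Sum>i\<in>L. ?A (L - {i}) * ?T (L - {i}) (?A {i})) * ?T L f"
      by (simp_all add: sum_distrib_right)
    moreover have "L \<subseteq> {..<n}" using \<open>L \<in> ?S'\<close> by (simp add: subsets_of_size_def)
    ultimately show ?thesis using macdonald_coef_exchange_sum by simp
  qed
  have "(\<Sum>L\<in>?S'. \<Sum>i\<in>L. ?l i (L - {i})) = (\<Sum>L\<in>?S'. \<Sum>i\<in>L. ?r i (L - {i}))"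
    by (rule sum.cong[OF refl outside])
  then show ?thesis unfolding l r split[of ?l] split[of ?r] using inside by simp
qed

section \<open>Diagonalisation of the first Macdonald operator\<close>

(* Keeps the index of macdonald_op n 1 in the form in which the lemmas on it are stated. *)
declare One_nat_def [simp del]

lemma macdonald_eigenvalue_1: "macdonald_eigenvalue n 1 \<mu> = (\<Sum>i<n. indet_q ^ \<mu> i * indet_t ^ (n - Suc i))"
  unfolding macdonald_eigenvalue_def subsets_of_size_1 by (simp add: sum.reindex)

lemma indet_monom: "indet_q ^ a * indet_t ^ b = to_fract (monom (monom 1 a) b)"
proof -
  have "(to_fract x :: coef) ^ k = to_fract (x ^ k)" for x k
    by (induction k) simp_all
  then have "indet_q ^ a * indet_t ^ b = to_fract ([:[:0, 1:]:] ^ a * [:0, 1:] ^ b)"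
    by (simp add: indet_q_def indet_t_def)
  also have "[:[:0, 1:]:] ^ a * [:0, 1:] ^ b = (monom (monom 1 a) b :: rat poly poly)"
    by (simp add: poly_const_pow monom_altdef)
  finally show ?thesis .
qed

text \<open>
  The \<open>i\<close>-th part is read off as the exponent of \<open>q\<close> in the coefficient of \<open>t\<^bsup>n-1-i\<^esup>\<close>.
\<close>

lemma macdonald_eigenvalue_1_inj:
  assumes "macdonald_eigenvalue n 1 \<mu> = macdonald_eigenvalue n 1 \<nu>" "i < n"
  shows "\<mu> i = \<nu> i"
proof -
  have E: "macdonald_eigenvalue n 1 \<mu> = to_fract (\<Sum>j<n. monom (monom 1 (\<mu> j)) (n - Suc j))" for \<mu>
    by (simp add: macdonald_eigenvalue_1 indet_monom)
  have C: "coeff (\<Sum>j<n. monom (monom 1 (\<mu> j)) (n - Suc j)) (n - Suc i) = (monom 1 (\<mu> i) :: rat poly)" for \<mu>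
  proof -
    have "coeff (\<Sum>j<n. monom (monom 1 (\<mu> j)) (n - Suc j)) (n - Suc i) =
       (\<Sum>j<n. if j = i then monom 1 (\<mu> j) else (0 :: rat poly))"
      unfolding coeff_sum coeff_monom using assms(2) by (intro sum.cong) auto
    then show ?thesis using assms(2) by simp
  qed
  have "(\<Sum>j<n. monom (monom 1 (\<mu> j)) (n - Suc j)) = (\<Sum>j<n. monom (monom 1 (\<nu> j)) (n - Suc j) :: rat poly poly)"
    using assms(1) unfolding E to_fract_eq_iff .
  then have "(monom 1 (\<mu> i) :: rat poly) = monom 1 (\<nu> i)" using C by metis
  then show ?thesis by (metis degree_monom_eq zero_neq_one)
qed

lemma lookup_beyond:
  "Poly_Mapping.keys e \<subseteq> {..<n} \<Longrightarrow> \<not> i < n \<Longrightarrow> Poly_Mapping.lookup e i = 0"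
  by (metis in_keys_iff lessThan_iff subsetD)

lemma macdonald_eigenvalue_1_inj_exponent:
  assumes "macdonald_eigenvalue n 1 (Poly_Mapping.lookup d) = macdonald_eigenvalue n 1 (Poly_Mapping.lookup e)"
    and "Poly_Mapping.keys d \<subseteq> {..<n}" "Poly_Mapping.keys e \<subseteq> {..<n}"
  shows "d = e"
proof (rule poly_mapping_eqI)
  fix i
  show "Poly_Mapping.lookup d i = Poly_Mapping.lookup e i"
    using macdonald_eigenvalue_1_inj[OF assms(1)] assms(2,3)
    by (cases "i < n") (auto simp: lookup_beyond)
qed

lemma leading_term_lookup: "leading_term (to_fract p) e c \<Longrightarrow> Poly_Mapping.lookup p e = c"
  unfolding leading_term_def by auto

lemma symmetric_pols_0 [simp]: "0 \<in> symmetric_pols n"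
  by (simp add: symmetric_pols_def symmetric_fun_def khom_0[OF khom_perm_act_permutes])

lemma symmetric_pols_add: "f \<in> symmetric_pols n \<Longrightarrow> g \<in> symmetric_pols n \<Longrightarrow> f + g \<in> symmetric_pols n"
  by (simp add: symmetric_pols_def symmetric_fun_def khom_add[OF khom_perm_act_permutes] pol_add)

lemma symmetric_pols_const_mult: "f \<in> symmetric_pols n \<Longrightarrow> const c * f \<in> symmetric_pols n"
  by (simp add: symmetric_pols_def symmetric_fun_def khom_mult[OF khom_perm_act_permutes]
      khom_const[OF khom_perm_act_permutes] pol_mult)

lemma symmetric_pols_diff: "f \<in> symmetric_pols n \<Longrightarrow> g \<in> symmetric_pols n \<Longrightarrow> f - g \<in> symmetric_pols n"
  by (simp add: symmetric_pols_def symmetric_fun_def khom_diff[OF khom_perm_act_permutes] pol_diff)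

definition eigenfunction :: "nat \<Rightarrow> (nat \<Rightarrow>\<^sub>0 nat) \<Rightarrow> ratfun \<Rightarrow> bool" where
  "eigenfunction n e f \<longleftrightarrow> f \<in> symmetric_pols n \<and>
     macdonald_op n 1 f = const (macdonald_eigenvalue n 1 (Poly_Mapping.lookup e)) * f"

text \<open>
  By triangularity, the leading monomial of an eigenfunction determines the eigenvalue, and
  the eigenvalue determines the exponent.
\<close>

lemma eigenfunction_leading_exponent:
  assumes "eigenfunction n e f" "Poly_Mapping.keys e \<subseteq> {..<n}"
    and d: "leading_term f d b" "b \<noteq> 0" "Poly_Mapping.keys d \<subseteq> {..<n}"
  shows "d = e"
proof -
  have "f \<in> symmetric_pols n" using assms(1) by (simp add: eigenfunction_def)
  from leading_term_macdonald_op[OF this d(1,3)]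
  have "leading_term (macdonald_op n 1 f) d (macdonald_eigenvalue n 1 (Poly_Mapping.lookup d) * b)" .
  moreover have "leading_term (macdonald_op n 1 f) d (macdonald_eigenvalue n 1 (Poly_Mapping.lookup e) * b)"
    using assms(1) leading_term_const_mult[OF d(1)] by (simp add: eigenfunction_def)
  ultimately have "macdonald_eigenvalue n 1 (Poly_Mapping.lookup d) * b = macdonald_eigenvalue n 1 (Poly_Mapping.lookup e) * b"
    by (rule leading_term_unique)
  then show ?thesis using d(2,3) assms(2) macdonald_eigenvalue_1_inj_exponent by simp
qed

lemma eigenfunction_leading_term:
  assumes "eigenfunction n e f" "Poly_Mapping.keys e \<subseteq> {..<n}"
  shows "\<exists>c. leading_term f e c"
proof (cases "f = 0")
  case False
  have "f \<in> pol n" using assms(1) by (simp add: eigenfunction_def symmetric_pols_def)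
  then obtain d b where d: "leading_term f d b" "b \<noteq> 0" "Poly_Mapping.keys d \<subseteq> {..<n}"
    using leading_term_exists False by metis
  then show ?thesis using eigenfunction_leading_exponent[OF assms] by blast
qed (auto intro: leading_term_0)

lemma eigenfunction_eq_0:
  assumes "eigenfunction n e (to_fract p)" "Poly_Mapping.keys e \<subseteq> {..<n}" "Poly_Mapping.lookup p e = 0"
  shows "p = 0"
proof (rule ccontr)
  assume "p \<noteq> 0"
  have "to_fract p \<in> pol n" using assms(1) by (simp add: eigenfunction_def symmetric_pols_def)
  then obtain d b where d: "leading_term (to_fract p) d b" "b \<noteq> 0" "Poly_Mapping.keys d \<subseteq> {..<n}"
    using leading_term_exists[of "to_fract p" n] \<open>p \<noteq> 0\<close> by auto
  then have "d = e" using eigenfunction_leading_exponent[OF assms(1,2)] by blast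
  then show False using d leading_term_lookup assms(3) by auto
qed

lemma eigenfunction_diff: "eigenfunction n e f \<Longrightarrow> eigenfunction n e g \<Longrightarrow> eigenfunction n e (f - g)"
  by (simp add: eigenfunction_def symmetric_pols_diff macdonald_op_diff right_diff_distrib)

lemma eigenfunction_const_mult: "eigenfunction n e f \<Longrightarrow> eigenfunction n e (const c * f)"
  by (simp add: eigenfunction_def symmetric_pols_const_mult macdonald_op_const_mult mult.left_commute)

text \<open>
  The sum of the eigenspaces for the exponents in \<open>B\<close>, as an inductive set: linear claims
  reduce to single eigenfunctions by rule induction.
\<close>

inductive_set eigen_sums :: "nat \<Rightarrow> (nat \<Rightarrow>\<^sub>0 nat) set \<Rightarrow> ratfun set" for n B where
  zero: "0 \<in> eigen_sums n B"
| add: "f \<in> eigen_sums n B \<Longrightarrow> d \<in> B \<Longrightarrow> eigenfunction n d g \<Longrightarrow> f + g \<in> eigen_sums n B"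

lemma eigen_sums_mono:
  assumes "f \<in> eigen_sums n B" "B \<subseteq> B'"
  shows "f \<in> eigen_sums n B'"
  using assms by (induction rule: eigen_sums.induct) (auto intro: eigen_sums.intros)

lemma eigen_sums_symmetric_pols: "f \<in> eigen_sums n B \<Longrightarrow> f \<in> symmetric_pols n"
  by (induction rule: eigen_sums.induct) (auto simp: eigenfunction_def symmetric_pols_add)

lemma eigen_sums_leading_term:
  assumes "f \<in> eigen_sums n B" "\<And>d. d \<in> B \<Longrightarrow> d < e \<and> Poly_Mapping.keys d \<subseteq> {..<n}"
  shows "leading_term f e 0"
  using assms
proof (induction rule: eigen_sums.induct)
  case (add f d g)
  then have "leading_term g e 0"
    using eigenfunction_leading_term leading_term_less by metis
  then show ?case using add leading_term_add[of f e 0 g 0] by simp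
qed (rule leading_term_0)

text \<open>
  On each eigenspace occurring in \<open>f\<close> the operator \<open>D\<^sub>1 - E\<close> acts as a nonzero scalar.
\<close>

lemma eigen_sums_solve:
  assumes "f \<in> eigen_sums n B" "\<And>d. d \<in> B \<Longrightarrow> d \<noteq> e \<and> Poly_Mapping.keys d \<subseteq> {..<n}" "Poly_Mapping.keys e \<subseteq> {..<n}"
  shows "\<exists>h \<in> eigen_sums n B.
    macdonald_op n 1 h - const (macdonald_eigenvalue n 1 (Poly_Mapping.lookup e)) * h = f"
  using assms(1)
proof (induction rule: eigen_sums.induct)
  case zero
  show ?case by (rule bexI[of _ 0]) (simp_all add: macdonald_op_0 eigen_sums.zero)
next
  case (add f d g)
  let ?E = "\<lambda>e. macdonald_eigenvalue n 1 (Poly_Mapping.lookup e)"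
  obtain h where h: "h \<in> eigen_sums n B" "macdonald_op n 1 h - const (?E e) * h = f" using add by blast
  have "?E d \<noteq> ?E e"
    using macdonald_eigenvalue_1_inj_exponent assms(2)[OF add(2)] assms(3) by blast
  let ?c = "inverse (?E d - ?E e)"
  have "macdonald_op n 1 (const ?c * g) = const ?c * (const (?E d) * g)"
    using add(3) by (simp add: eigenfunction_def macdonald_op_const_mult)
  then have "macdonald_op n 1 (const ?c * g) - const (?E e) * (const ?c * g) = const (?c * (?E d - ?E e)) * g"
    by (simp add: const_mult const_diff algebra_simps)
  then have "macdonald_op n 1 (const ?c * g) - const (?E e) * (const ?c * g) = g"
    using \<open>?E d \<noteq> ?E e\<close> by simp
  then have "macdonald_op n 1 (h + const ?c * g) - const (?E e) * (h + const ?c * g) = f + g"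
    using h(2) by (simp add: macdonald_op_add algebra_simps)
  moreover have "h + const ?c * g \<in> eigen_sums n B"
    using h(1) add by (intro eigen_sums.add[of _ _ _ d] eigenfunction_const_mult)
  ultimately show ?case by blast
qed

definition box_partitions :: "nat \<Rightarrow> nat \<Rightarrow> (nat \<Rightarrow>\<^sub>0 nat) set" where
  "box_partitions n m = {e. Poly_Mapping.keys e \<subseteq> {..<n} \<and> antimono (Poly_Mapping.lookup e)
     \<and> Poly_Mapping.lookup e 0 \<le> m}"

lemma finite_box_partitions: "finite (box_partitions n m)"
proof (rule finite_imageD)
  have "Poly_Mapping.lookup ` box_partitions n m \<subseteq> {f. \<forall>i. (i \<in> {..<n} \<longrightarrow> f i \<in> {..m}) \<and> (i \<notin> {..<n} \<longrightarrow> f i = 0)}"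
    by (auto simp: box_partitions_def lookup_beyond) (metis antimonoD le0 order_trans)
  then show "finite (Poly_Mapping.lookup ` box_partitions n m)"
    by (rule finite_subset) (rule finite_set_of_finite_funs, auto)
  show "inj_on Poly_Mapping.lookup (box_partitions n m)"
    by (simp add: inj_on_def lookup_inject)
qed

lemma less_exponent_lookup_0:
  assumes "d < e"
  shows "Poly_Mapping.lookup d 0 \<le> Poly_Mapping.lookup (e :: nat \<Rightarrow>\<^sub>0 nat) 0"
proof -
  obtain k where k: "Poly_Mapping.lookup d k < Poly_Mapping.lookup e k"
    "\<forall>k'<k. Poly_Mapping.lookup d k' = Poly_Mapping.lookup e k'"
    using assms unfolding less_poly_mapping.rep_eq less_fun_def by blast
  then show ?thesis by (cases "k = 0") auto
qed

text \<open>
  Induction along the lexicographic order.  The function \<open>g = D\<^sub>1 f - E\<^sub>e f\<close> is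
  symmetric with a leading monomial below \<open>e\<close>, hence a sum of eigenfunctions for smaller exponents.
  If \<open>s\<close> is a sum of the same kind with \<open>(D\<^sub>1 - E\<^sub>e) s = g\<close>, then \<open>f - s\<close> is an
  eigenfunction.  Smaller exponents stay in the box because the lexicographic order compares
  the exponent of \<open>x\<^sub>0\<close>, the largest part, first.
\<close>

lemma eigenfunction_decomposition:
  assumes "f \<in> symmetric_pols n" "leading_term f e c" "e \<in> box_partitions n m"
  shows "\<exists>h. eigenfunction n e h \<and> leading_term h e c \<and>
           f - h \<in> eigen_sums n {d \<in> box_partitions n m. d < e}"
  using assms
proof (induction "card {d \<in> box_partitions n m. d < e}" arbitrary: e f c rule: less_induct)
  case less
  let ?B = "\<lambda>e. {d \<in> box_partitions n m. d < e}"
  let ?E = "macdonald_eigenvalue n 1 (Poly_Mapping.lookup e)"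
  have e: "Poly_Mapping.keys e \<subseteq> {..<n}" "Poly_Mapping.lookup e 0 \<le> m"
    using less.prems(3) by (auto simp: box_partitions_def)
  let ?g = "macdonald_op n 1 f - const ?E * f"
  have g: "?g \<in> symmetric_pols n"
    using less.prems(1) by (intro symmetric_pols_diff symmetric_pols_const_mult macdonald_op_symmetric_pols)
  have g0: "leading_term ?g e 0"
    using leading_term_diff[OF leading_term_macdonald_op[OF less.prems(1,2) e(1), of 1]
        leading_term_const_mult[OF less.prems(2), of ?E]] by simp
  have "?g \<in> eigen_sums n (?B e)"
  proof (cases "?g = 0")
    case True
    then show ?thesis by (simp only: eigen_sums.zero)
  next
    case False
    have "?g \<in> pol n" using g by (simp add: symmetric_pols_def)
    then obtain d b where d: "leading_term ?g d b" "b \<noteq> 0" "Poly_Mapping.keys d \<subseteq> {..<n}"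
      using leading_term_exists False by metis
    have "d \<le> e" by (rule leading_term_le[OF d(1,2) g0])
    moreover have "d \<noteq> e" using leading_term_unique[OF g0] d(1,2) by blast
    ultimately have "d < e" by simp
    have "antimono (Poly_Mapping.lookup d)"
      using leading_term_symmetric_antimono[OF _ d] g by (simp add: symmetric_pols_def)
    then have dB: "d \<in> box_partitions n m"
      using d(3) less_exponent_lookup_0[OF \<open>d < e\<close>] e(2) by (simp add: box_partitions_def)
    have sub: "?B d \<subset> ?B e" using \<open>d < e\<close> dB by auto
    then have "card (?B d) < card (?B e)"
      by (intro psubset_card_mono) (auto simp: finite_box_partitions)
    from less.hyps[OF this g d(1) dB] obtain h where
      h: "eigenfunction n d h" "?g - h \<in> eigen_sums n (?B d)" by blast
    have "?g - h + h \<in> eigen_sums n (?B e)"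
      by (rule eigen_sums.add[OF eigen_sums_mono[OF h(2)] _ h(1)]) (use sub dB \<open>d < e\<close> in auto)
    then show ?thesis by simp
  qed
  then have "\<exists>s \<in> eigen_sums n (?B e). macdonald_op n 1 s - const ?E * s = ?g"
    by (rule eigen_sums_solve[OF _ _ e(1)]) (auto simp: box_partitions_def)
  then obtain s where s: "s \<in> eigen_sums n (?B e)" "macdonald_op n 1 s - const ?E * s = ?g"
    by blast
  have "macdonald_op n 1 s = ?g + const ?E * s"
    using s(2) unfolding diff_eq_eq .
  then have "macdonald_op n 1 (f - s) = const ?E * (f - s)"
    unfolding macdonald_op_diff by (simp add: right_diff_distrib)
  then have "eigenfunction n e (f - s)"
    unfolding eigenfunction_def
    using symmetric_pols_diff[OF less.prems(1) eigen_sums_symmetric_pols[OF s(1)]] by blast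
  moreover have "leading_term s e 0"
    by (rule eigen_sums_leading_term[OF s(1)]) (auto simp: box_partitions_def)
  then have "leading_term (f - s) e c"
    using leading_term_diff[OF less.prems(2), of s 0] by simp
  ultimately show ?case using s(1) by (intro exI[of _ "f - s"]) simp
qed

section \<open>Symmetrized monomials\<close>

definition symmetrized_monom :: "nat \<Rightarrow> (nat \<Rightarrow>\<^sub>0 nat) \<Rightarrow> ratfun" where
  "symmetrized_monom n e = (\<Sum>w | w permutes {..<n}. perm_act w (monom_eval var e))"

lemma symmetrized_monom_symmetric_pols:
  assumes "Poly_Mapping.keys e \<subseteq> {..<n}"
  shows "symmetrized_monom n e \<in> symmetric_pols n"
proof -
  have "perm_act w (monom_eval var e) \<in> pol n" if w: "w permutes {..<n}" for w
    by (rule khom_pol[OF khom_perm_act_permutes[OF w] _ pol_monom_eval[OF assms]])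
      (use permutes_in_image[OF w] in \<open>simp add: perm_act_var pol_var\<close>)
  then have "symmetrized_monom n e \<in> pol n"
    unfolding symmetrized_monom_def by (intro pol_sum) auto
  moreover have "perm_act v (symmetrized_monom n e) = symmetrized_monom n e" if v: "v permutes {..<n}" for v
  proof -
    have "perm_act v (symmetrized_monom n e) = (\<Sum>w | w permutes {..<n}. perm_act (v \<circ> w) (monom_eval var e))"
      unfolding symmetrized_monom_def khom_sum[OF khom_perm_act_permutes[OF v]]
      using v by (intro sum.cong) (auto simp: perm_act_comp permutes_bij)
    also have "\<dots> = symmetrized_monom n e"
      unfolding symmetrized_monom_def by (rule setum_permutations_compose_left[OF v, symmetric])
    finally show ?thesis .
  qed
  ultimately show ?thesis by (simp add: symmetric_pols_def symmetric_fun_def)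
qed

text \<open>
  If \<open>f (w k)\<close> and \<open>f k\<close> differed, then \<open>w\<close> or its inverse would map the \<open>k + 1\<close> numbers up to \<open>k\<close>
  into the \<open>k\<close> numbers below \<open>k\<close>.
\<close>

lemma antimono_permutes_eq:
  fixes f :: "nat \<Rightarrow> nat"
  assumes "antimono f" "antimono (\<lambda>i. f (w i))" "w permutes {..<n}"
  shows "f (w k) = f k"
proof (rule ccontr)
  assume "f (w k) \<noteq> f k"
  have inj: "inj w" using assms(3) by (rule permutes_inj)
  consider "f (w k) > f k" | "f (w k) < f k" using \<open>f (w k) \<noteq> f k\<close> by linarith
  then show False
  proof cases
    case 1
    have "w ` {..k} \<subseteq> {..<k}"
    proof
      fix j assume "j \<in> w ` {..k}"
      then have "f j \<ge> f (w k)" using antimonoD[OF assms(2)] by auto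
      then show "j \<in> {..<k}" using 1 antimonoD[OF assms(1), of k j] by (cases "j < k") auto
    qed
    then have "card (w ` {..k}) \<le> card {..<k}" by (intro card_mono) auto
    then show False using inj by (simp add: card_image inj_on_subset[OF inj])
  next
    case 2
    have "inv w ` {..k} \<subseteq> {..<k}"
    proof
      fix j assume "j \<in> inv w ` {..k}"
      then have "f (w j) \<ge> f k" using antimonoD[OF assms(1)] permutes_inverses[OF assms(3)] by auto
      then show "j \<in> {..<k}" using 2 antimonoD[OF assms(2), of k j] by (cases "j < k") auto
    qed
    then have "card (inv w ` {..k}) \<le> card {..<k}" by (intro card_mono) auto
    moreover have "inj (inv w)" using permutes_inv[OF assms(3)] by (rule permutes_inj)
    ultimately show False by (simp add: card_image inj_on_subset[of "inv w" UNIV])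
  qed
qed

lemma symmetrized_monom_to_fract:
  "symmetrized_monom n e = to_fract (\<Sum>w | w permutes {..<n}. Poly_Mapping.single (Poly_Mapping.map_key (inv w) e) 1)"
proof -
  have "perm_act w (monom_eval var e) = to_fract (Poly_Mapping.single (Poly_Mapping.map_key (inv w) e) 1)"
    if w: "w permutes {..<n}" for w
    using monom_eval_map_key[OF permutes_bij[OF w], of var "Poly_Mapping.map_key (inv w) e"]
    by (simp add: khom_monom_eval[OF khom_perm_act_permutes[OF w]] perm_act_var o_def to_fract_single
        map_key_inv[OF permutes_bij[OF w]])
  then show ?thesis by (simp add: symmetrized_monom_def)
qed

text \<open>
  The symmetrization is nonzero: the coefficient of \<open>x\<^sup>e\<close> is the order of the stabiliser of \<open>e\<close>, and
  the characteristic is zero.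
\<close>

lemma symmetrized_monom_leading_term:
  assumes "Poly_Mapping.keys e \<subseteq> {..<n}"
  obtains d c w where "leading_term (symmetrized_monom n e) d c" "c \<noteq> 0" "Poly_Mapping.keys d \<subseteq> {..<n}"
    "w permutes {..<n}" "d = Poly_Mapping.map_key w e" "antimono (Poly_Mapping.lookup d)"
proof -
  define p :: mpol where "p = (\<Sum>w | w permutes {..<n}. Poly_Mapping.single (Poly_Mapping.map_key (inv w) e) 1)"
  have p: "symmetrized_monom n e = to_fract p" by (simp add: p_def symmetrized_monom_to_fract)
  have lookup: "Poly_Mapping.lookup p e = of_nat (card {w. w permutes {..<n} \<and> Poly_Mapping.map_key (inv w) e = e})"
    unfolding p_def lookup_sum lookup_single when_def
    by (simp add: finite_permutations sum.If_cases Int_def)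
  have "Poly_Mapping.map_key (inv id) e = e"
    by (subst inv_id) (simp add: id_def map_key_id)
  then have "id \<in> {w. w permutes {..<n} \<and> Poly_Mapping.map_key (inv w) e = e}"
    using permutes_id by blast
  moreover have "finite {w. w permutes {..<n} \<and> Poly_Mapping.map_key (inv w) e = e}"
    by (simp add: finite_permutations)
  ultimately have "card {w. w permutes {..<n} \<and> Poly_Mapping.map_key (inv w) e = e} \<noteq> 0"
    using card_0_eq by blast
  with lookup have "Poly_Mapping.lookup p e \<noteq> 0" by (simp add: of_nat_coef_eq_0_iff)
  then have "p \<noteq> 0" by auto
  have sym: "symmetrized_monom n e \<in> symmetric_pols n" by (rule symmetrized_monom_symmetric_pols[OF assms])
  then obtain d c where d: "leading_term (symmetrized_monom n e) d c" "c \<noteq> 0" "Poly_Mapping.keys d \<subseteq> {..<n}"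
    using leading_term_exists[of "symmetrized_monom n e" n] p \<open>p \<noteq> 0\<close> by (auto simp: symmetric_pols_def)
  have "d \<in> Poly_Mapping.keys p" using d leading_term_lookup p by (auto simp: in_keys_iff)
  then obtain w where w: "w permutes {..<n}" "d = Poly_Mapping.map_key (inv w) e"
    using keys_sum[of "\<lambda>w. Poly_Mapping.single (Poly_Mapping.map_key (inv w) e) (1::coef)" "{w. w permutes {..<n}}"]
    unfolding p_def by (auto split: if_splits)
  have "antimono (Poly_Mapping.lookup d)"
    using leading_term_symmetric_antimono[OF _ d] sym by (simp add: symmetric_pols_def)
  then show ?thesis using that d w permutes_inv by blast
qed


lemma exists_symmetric_pol_leading_term:
  assumes "e \<in> box_partitions n m"
  obtains f where "f \<in> symmetric_pols n" "leading_term f e 1"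
proof -
  have e: "Poly_Mapping.keys e \<subseteq> {..<n}" "antimono (Poly_Mapping.lookup e)"
    using assms by (auto simp: box_partitions_def)
  obtain d c w where d: "leading_term (symmetrized_monom n e) d c" "c \<noteq> 0"
    "w permutes {..<n}" "d = Poly_Mapping.map_key w e" "antimono (Poly_Mapping.lookup d)"
    by (rule symmetrized_monom_leading_term[OF e(1)])
  have l: "Poly_Mapping.lookup d = (\<lambda>i. Poly_Mapping.lookup e (w i))"
    using d(4) permutes_inj[OF d(3)] by (simp add: map_key.rep_eq o_def)
  have "d = e"
  proof (rule poly_mapping_eqI)
    show "Poly_Mapping.lookup d i = Poly_Mapping.lookup e i" for i
      using antimono_permutes_eq[OF e(2) _ d(3)] d(5) unfolding l by blast
  qed
  then have "leading_term (const (inverse c) * symmetrized_monom n e) e (inverse c * c)"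
    using d(1) leading_term_const_mult by blast
  then show ?thesis
    using that[OF symmetric_pols_const_mult[OF symmetrized_monom_symmetric_pols[OF e(1)]]] d(2) by simp
qed

section \<open>Existence and uniqueness of Macdonald polynomials\<close>

lemma coeff_sum_subsets:
  "coeff (\<Sum>K\<in>Pow {..<n}. (- [:0, 1:]) ^ card K * [:g K:]) r = (-1) ^ r * (\<Sum>K\<in>subsets_of_size n r. g K :: ratfun)"
proof -
  have "(- [:0, 1:] :: ratfun poly) = monom (-1) 1" by (simp add: monom_altdef)
  then have m: "(- [:0, 1:]) ^ k * [:a:] = monom ((-1) ^ k * a) k" for k and a :: ratfun
    using mult_monom[of "(-1) ^ k" k a 0] by (simp add: monom_power monom_0)
  have "coeff (\<Sum>K\<in>Pow {..<n}. (- [:0, 1:]) ^ card K * [:g K:]) r =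
     (\<Sum>K\<in>Pow {..<n}. if card K = r then (-1) ^ r * g K else 0)"
    unfolding m coeff_sum coeff_monom by (intro sum.cong) auto
  also have "\<dots> = (\<Sum>K\<in>{K \<in> Pow {..<n}. card K = r}. (-1) ^ r * g K)"
    by (rule sum.inter_filter[symmetric]) simp
  also have "{K \<in> Pow {..<n}. card K = r} = subsets_of_size n r"
    by (auto simp: subsets_of_size_def)
  finally show ?thesis by (simp add: sum_distrib_left)
qed

lemma coeff_macdonald_D: "coeff (macdonald_D n f) r = (-1) ^ r * macdonald_op n r f"
  unfolding macdonald_D_def macdonald_op_def
  by (subst coeff_sum_subsets) (simp add: macdonald_coef_def)

lemma coeff_macdonald_eigenvalue:
  "coeff (\<Prod>i<n. 1 - [:0, 1:] * [:const (indet_q ^ \<mu> i * indet_t ^ (n - Suc i)):]) r =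
     (-1) ^ r * const (macdonald_eigenvalue n r \<mu>)"
proof -
  let ?c = "\<lambda>i. const (indet_q ^ \<mu> i * indet_t ^ (n - Suc i))"
  have const_poly_prod: "(\<Prod>i\<in>K. [:f i:]) = [:\<Prod>i\<in>K. f i:]" for K and f :: "nat \<Rightarrow> ratfun"
    by (induction K rule: infinite_finite_induct) (simp_all add: one_pCons)
  have "(\<Prod>i<n. 1 - [:0, 1:] * [:?c i:]) = (\<Prod>i<n. (- [:0, 1:]) * [:?c i:] + 1)"
    by (intro prod.cong) (simp_all add: one_pCons)
  also have "\<dots> = (\<Sum>K\<in>Pow {..<n}. (\<Prod>i\<in>K. (- [:0, 1:]) * [:?c i:]) * (\<Prod>i\<in>{..<n} - K. 1))"
    by (rule prod_add) simp
  also have "\<dots> = (\<Sum>K\<in>Pow {..<n}. (- [:0, 1:]) ^ card K * [:\<Prod>i\<in>K. ?c i:])"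
    by (simp only: prod.distrib prod_constant const_poly_prod prod.neutral_const mult_1_right power_one)
  finally show ?thesis
    by (simp only: coeff_sum_subsets macdonald_eigenvalue_def const_sum const_prod)
qed

lemma is_macdonald_P_iff:
  "is_macdonald_P n (Poly_Mapping.lookup e) p \<longleftrightarrow> to_fract p \<in> symmetric_pols n \<and>
     (\<forall>r. macdonald_op n r (to_fract p) = const (macdonald_eigenvalue n r (Poly_Mapping.lookup e)) * to_fract p) \<and>
     Poly_Mapping.lookup p e = 1"
proof -
  have "to_fract p \<in> symmetric_pols n \<longleftrightarrow> p \<in> mpolys n \<and> is_symmetric n p"
    by (auto simp: symmetric_pols_def pol_def is_symmetric_def symmetric_fun_def)
  moreover have "macdonald_D n (to_fract p) = smult (to_fract p)
       (\<Prod>i<n. 1 - [:0, 1:] * [:const (indet_q ^ Poly_Mapping.lookup e i * indet_t ^ (n - Suc i)):]) \<longleftrightarrow>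
     (\<forall>r. macdonald_op n r (to_fract p) = const (macdonald_eigenvalue n r (Poly_Mapping.lookup e)) * to_fract p)"
    unfolding poly_eq_iff coeff_smult coeff_macdonald_D coeff_macdonald_eigenvalue
    by (simp add: mult_ac)
  ultimately show ?thesis
    unfolding is_macdonald_P_def by (auto simp: lookup_inverse)
qed

text \<open>
  As \<open>D\<^sub>r\<close> commutes with \<open>D\<^sub>1\<close>, the difference of the two sides is again an eigenfunction for
  \<open>e\<close>.  Its coefficient at \<open>x\<^sup>e\<close> vanishes by triangularity, so it is zero.
\<close>

lemma eigenfunction_macdonald_op:
  assumes f: "eigenfunction n e f" and "Poly_Mapping.keys e \<subseteq> {..<n}"
  shows "macdonald_op n r f = const (macdonald_eigenvalue n r (Poly_Mapping.lookup e)) * f"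
proof -
  let ?E = "\<lambda>r. macdonald_eigenvalue n r (Poly_Mapping.lookup e)"
  have sym: "f \<in> symmetric_pols n" using f by (simp add: eigenfunction_def)
  obtain c where c: "leading_term f e c" using eigenfunction_leading_term[OF assms] by blast
  have "eigenfunction n e (macdonald_op n r f)"
    using f unfolding eigenfunction_def macdonald_op_commute
    by (simp add: macdonald_op_symmetric_pols macdonald_op_const_mult)
  then have g: "eigenfunction n e (macdonald_op n r f - const (?E r) * f)"
    by (intro eigenfunction_diff eigenfunction_const_mult f)
  then obtain p where p: "macdonald_op n r f - const (?E r) * f = to_fract p"
    by (auto simp: eigenfunction_def symmetric_pols_def pol_def)
  have "leading_term (macdonald_op n r f - const (?E r) * f) e 0"
    using leading_term_diff[OF leading_term_macdonald_op[OF sym c assms(2), of r]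
        leading_term_const_mult[OF c, of "?E r"]] by simp
  then have "Poly_Mapping.lookup p e = 0" unfolding p by (rule leading_term_lookup)
  then have "p = 0" using eigenfunction_eq_0[of n e p] g assms(2) unfolding p by blast
  then show ?thesis using p by simp
qed

lemma ex1_macdonald_P:
  assumes "e \<in> box_partitions n m"
  shows "\<exists>!p. is_macdonald_P n (Poly_Mapping.lookup e) p"
proof -
  have e: "Poly_Mapping.keys e \<subseteq> {..<n}" using assms by (simp add: box_partitions_def)
  obtain f where f: "f \<in> symmetric_pols n" "leading_term f e 1"
    by (rule exists_symmetric_pol_leading_term[OF assms])
  obtain h where h: "eigenfunction n e h" "leading_term h e 1"
    using eigenfunction_decomposition[OF f assms] by blast
  then obtain p where p: "h = to_fract p"
    by (auto simp: eigenfunction_def symmetric_pols_def pol_def)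
  have "is_macdonald_P n (Poly_Mapping.lookup e) p"
    using h eigenfunction_macdonald_op[OF h(1) e] leading_term_lookup
    unfolding is_macdonald_P_iff p by (auto simp: eigenfunction_def)
  moreover have "p' = p''" if "is_macdonald_P n (Poly_Mapping.lookup e) p'" "is_macdonald_P n (Poly_Mapping.lookup e) p''" for p' p''
  proof -
    have "eigenfunction n e (to_fract p' - to_fract p'')"
      using that unfolding is_macdonald_P_iff by (intro eigenfunction_diff) (auto simp: eigenfunction_def)
    then have "p' - p'' = 0"
      using that eigenfunction_eq_0[of n e "p' - p''"] e by (simp add: is_macdonald_P_iff lookup_minus)
    then show ?thesis by simp
  qed
  ultimately show ?thesis by blast
qed

lemma is_macdonald_P_macdonald_P:
  "e \<in> box_partitions n m \<Longrightarrow> is_macdonald_P n (Poly_Mapping.lookup e) (macdonald_P n (Poly_Mapping.lookup e))"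
  unfolding macdonald_P_def by (rule theI'[OF ex1_macdonald_P])

lemma eigenfunction_multiple:
  assumes "e \<in> box_partitions n m" "eigenfunction n e f"
  shows "\<exists>c. f = const c * to_fract (macdonald_P n (Poly_Mapping.lookup e))"
proof -
  let ?P = "macdonald_P n (Poly_Mapping.lookup e)"
  note P = is_macdonald_P_macdonald_P[OF assms(1), unfolded is_macdonald_P_iff]
  obtain p where p: "f = to_fract p" using assms(2) by (auto simp: eigenfunction_def symmetric_pols_def pol_def)
  define c where "c = Poly_Mapping.lookup p e"
  let ?r = "p - Poly_Mapping.single 0 c * ?P"
  have r: "to_fract ?r = f - const c * to_fract ?P" by (simp add: p const_def)
  have "Poly_Mapping.single 0 c * ?P = Poly_Mapping.map ((*) c) ?P" by (rule mult_map_scale_conv_mult[symmetric])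
  then have "Poly_Mapping.lookup (Poly_Mapping.single 0 c * ?P) e = c"
    using P by (simp add: map.rep_eq when_def)
  then have "Poly_Mapping.lookup ?r e = 0" by (simp add: lookup_minus c_def)
  moreover have "eigenfunction n e (to_fract ?r)"
    unfolding r using P by (intro eigenfunction_diff eigenfunction_const_mult assms(2)) (auto simp: eigenfunction_def)
  moreover have "Poly_Mapping.keys e \<subseteq> {..<n}"
    using assms(1) by (simp add: box_partitions_def)
  ultimately have "?r = 0"
    by (intro eigenfunction_eq_0[of n e])
  then have "f = const c * to_fract ?P" using r by simp
  then show ?thesis ..
qed

text \<open>
  The Macdonald polynomials of partitions in the box span all symmetrized monomials of degree at
  most \<open>m\<close> in each variable; the statement is phrased for a linear map \<open>L\<close> because
  this is how the span is used.
\<close>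

lemma functional_vanishes_on_symmetrized_monom:
  assumes add: "\<And>f g. L (f + g) = L f + (L g :: ratfun)"
    and scale: "\<And>c f. L (const c * f) = const c * L f"
    and P: "\<And>d. d \<in> box_partitions n m \<Longrightarrow> L (to_fract (macdonald_P n (Poly_Mapping.lookup d))) = 0"
    and e: "Poly_Mapping.keys e \<subseteq> {..<n}" "\<And>i. Poly_Mapping.lookup e i \<le> m"
  shows "L (symmetrized_monom n e) = 0"
proof -
  have eig: "L f = 0" if "d \<in> box_partitions n m" "eigenfunction n d f" for d f
    using eigenfunction_multiple[OF that] P[OF that(1)] scale by auto
  have zero: "L 0 = 0" using scale[of 0 0] by simp
  have sums: "L f = 0" if "f \<in> eigen_sums n B" "B \<subseteq> box_partitions n m" for f B
    using that by (induction rule: eigen_sums.induct) (auto simp: zero add eig)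
  obtain d c w where d: "leading_term (symmetrized_monom n e) d c" "Poly_Mapping.keys d \<subseteq> {..<n}"
    "w permutes {..<n}" "d = Poly_Mapping.map_key w e" "antimono (Poly_Mapping.lookup d)"
    by (rule symmetrized_monom_leading_term[OF e(1)])
  have "Poly_Mapping.lookup d 0 \<le> m"
    using d(4) permutes_inj[OF d(3)] e(2) by (simp add: map_key.rep_eq)
  then have dB: "d \<in> box_partitions n m" using d by (simp add: box_partitions_def)
  obtain h where h: "eigenfunction n d h" "symmetrized_monom n e - h \<in> eigen_sums n {b \<in> box_partitions n m. b < d}"
    using eigenfunction_decomposition[OF symmetrized_monom_symmetric_pols[OF e(1)] d(1) dB] by blast
  have "L (symmetrized_monom n e - h) = 0" by (rule sums[OF h(2)]) auto
  moreover have "L h = 0" by (rule eig[OF dB h(1)])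
  ultimately show ?thesis using add[of "symmetrized_monom n e - h" h] by simp
qed

section \<open>Linear systems with entries in a subfield\<close>

text \<open>
  The coefficients of the operators have to lie in \<open>ratfuns n\<close>, a proper subset of the type
  \<open>ratfun\<close>.  So linear systems are solved relative to a subfield.
\<close>

definition is_subfield :: "'a::field set \<Rightarrow> bool" where
  "is_subfield F \<longleftrightarrow> 1 \<in> F \<and> (\<forall>x\<in>F. \<forall>y\<in>F. x + y \<in> F \<and> x * y \<in> F) \<and> (\<forall>x\<in>F. - x \<in> F \<and> inverse x \<in> F)"

lemma is_subfield_closed:
  assumes "is_subfield F"
  shows "1 \<in> F" "0 \<in> F" "x \<in> F \<Longrightarrow> y \<in> F \<Longrightarrow> x + y \<in> F" "x \<in> F \<Longrightarrow> y \<in> F \<Longrightarrow> x * y \<in> F"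
    "x \<in> F \<Longrightarrow> - x \<in> F" "x \<in> F \<Longrightarrow> y \<in> F \<Longrightarrow> x - y \<in> F" "x \<in> F \<Longrightarrow> y \<in> F \<Longrightarrow> x / y \<in> F"
proof -
  show *: "1 \<in> F" "x \<in> F \<Longrightarrow> y \<in> F \<Longrightarrow> x + y \<in> F" "x \<in> F \<Longrightarrow> y \<in> F \<Longrightarrow> x * y \<in> F"
    "x \<in> F \<Longrightarrow> - x \<in> F" for x y using assms by (auto simp: is_subfield_def)
  show "x \<in> F \<Longrightarrow> y \<in> F \<Longrightarrow> x - y \<in> F" for x y using *(2)[of x "- y"] *(4)[of y] by simp
  show "x \<in> F \<Longrightarrow> y \<in> F \<Longrightarrow> x / y \<in> F" for x y
    using *(3)[of x "inverse y"] assms by (simp add: is_subfield_def divide_inverse)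
  show "0 \<in> F" using *(2)[of 1 "- 1"] *(1) *(4)[of 1] by simp
qed

lemma is_subfield_sum:
  assumes "is_subfield F" "\<And>i. i \<in> A \<Longrightarrow> f i \<in> F"
  shows "(\<Sum>i\<in>A. f i) \<in> F"
  using assms(2)
  by (induction A rule: infinite_finite_induct) (auto simp: is_subfield_closed[OF assms(1)])

text \<open>
  Gaussian elimination: one equation and one unknown are removed in every step.
\<close>

lemma underdetermined_system_kernel:
  fixes M :: "'i \<Rightarrow> 'j \<Rightarrow> 'a::field"
  assumes F: "is_subfield F" and "finite J" "finite I" "card J < card I"
    "\<And>i j. i \<in> I \<Longrightarrow> j \<in> J \<Longrightarrow> M i j \<in> F"
  shows "\<exists>b. (\<forall>i\<in>I. b i \<in> F) \<and> (\<exists>i\<in>I. b i \<noteq> 0) \<and> (\<forall>j\<in>J. (\<Sum>i\<in>I. b i * M i j) = 0)"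
  using assms(2-)
proof (induction J arbitrary: I M rule: finite_induct)
  case empty
  then have "I \<noteq> {}" by auto
  then show ?case by (intro exI[of _ "\<lambda>_. 1"]) (auto simp: is_subfield_closed[OF F])
next
  case (insert j J)
  show ?case
  proof (cases "\<forall>i\<in>I. M i j = 0")
    case True
    have "card J < card I" using insert by simp
    then obtain b where b: "\<forall>i\<in>I. b i \<in> F" "\<exists>i\<in>I. b i \<noteq> 0" "\<forall>j\<in>J. (\<Sum>i\<in>I. b i * M i j) = 0"
      using insert.IH[OF insert.prems(1)] insert.prems(3) by blast
    moreover have "(\<Sum>i\<in>I. b i * M i j) = 0" using True by simp
    ultimately show ?thesis by (intro exI[of _ b]) auto
  next
    case False
    then obtain i0 where i0: "i0 \<in> I" "M i0 j \<noteq> 0" by blast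
    let ?I = "I - {i0}" and ?M = "\<lambda>i k. M i k - M i j / M i0 j * M i0 k"
    have "card J < card ?I" using insert i0 by (simp add: card_Diff_singleton)
    moreover have "finite ?I" using insert by simp
    moreover have "?M i k \<in> F" if "i \<in> ?I" "k \<in> J" for i k
      using that insert.prems(3) i0(1) by (intro is_subfield_closed[OF F]) auto
    ultimately obtain b where b: "\<forall>i\<in>?I. b i \<in> F" "\<exists>i\<in>?I. b i \<noteq> 0" "\<forall>k\<in>J. (\<Sum>i\<in>?I. b i * ?M i k) = 0"
      using insert.IH[of ?I ?M] by blast
    let ?s = "\<Sum>i\<in>?I. b i * M i j"
    let ?b = "b(i0 := - (?s / M i0 j))"
    have sum: "(\<Sum>i\<in>I. ?b i * M i k) = - (?s / M i0 j) * M i0 k + (\<Sum>i\<in>?I. b i * M i k)" for k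
      using i0(1) insert.prems(1) by (subst sum.remove[of I i0]) auto
    have "?s \<in> F"
      using b(1) insert.prems(3) by (intro is_subfield_sum[OF F] is_subfield_closed[OF F]) auto
    then have "\<forall>i\<in>I. ?b i \<in> F"
      using b(1) i0(1) insert.prems(3) by (auto intro!: is_subfield_closed[OF F])
    moreover have "\<exists>i\<in>I. ?b i \<noteq> 0" using b(2) by auto
    moreover have "(\<Sum>i\<in>I. ?b i * M i j) = 0" unfolding sum using i0(2) by simp
    moreover have "(\<Sum>i\<in>I. ?b i * M i k) = 0" if "k \<in> J" for k
    proof -
      have "(\<Sum>i\<in>?I. b i * ?M i k) = (\<Sum>i\<in>?I. b i * M i k) - ?s / M i0 j * M i0 k"
        by (simp add: right_diff_distrib sum_subtractf sum_distrib_left sum_distrib_right sum_divide_distrib mult.assoc)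
      then show ?thesis unfolding sum using b(3) that by simp
    qed
    ultimately show ?thesis by (intro exI[of _ ?b]) auto
  qed
qed

text \<open>
  Adjoin the right-hand side as an additional row, indexed by \<open>None\<close>.  The enlarged system has a
  nontrivial relation between its rows, and by the triviality of the kernel it involves the new row.
\<close>

lemma square_system_solvable:
  fixes M :: "'i \<Rightarrow> 'j \<Rightarrow> 'a::field"
  assumes F: "is_subfield F" and fin: "finite I" "finite J" and card: "card I = card J"
    and M: "\<And>i j. i \<in> I \<Longrightarrow> j \<in> J \<Longrightarrow> M i j \<in> F" and r: "\<And>j. j \<in> J \<Longrightarrow> r j \<in> F"
    and kernel: "\<And>b. (\<And>j. j \<in> J \<Longrightarrow> (\<Sum>i\<in>I. b i * M i j) = 0) \<Longrightarrow> \<forall>i\<in>I. b i = 0"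
  shows "\<exists>b. (\<forall>i\<in>I. b i \<in> F) \<and> (\<forall>j\<in>J. (\<Sum>i\<in>I. b i * M i j) = r j)"
proof -
  let ?I = "insert None (Some ` I)" and ?M = "\<lambda>i j. case i of None \<Rightarrow> r j | Some i \<Rightarrow> M i j"
  have "card J < card ?I" using fin card by (simp add: card_image)
  moreover have "?M i j \<in> F" if "i \<in> ?I" "j \<in> J" for i j
    using that M r by auto
  ultimately obtain c where c: "\<forall>i\<in>?I. c i \<in> F" "\<exists>i\<in>?I. c i \<noteq> 0" "\<forall>j\<in>J. (\<Sum>i\<in>?I. c i * ?M i j) = 0"
    using underdetermined_system_kernel[OF F fin(2), of ?I ?M] fin(1) by blast
  have sum: "c None * r j + (\<Sum>i\<in>I. c (Some i) * M i j) = 0" if "j \<in> J" for j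
    using c(3) that fin(1) by (simp add: sum.reindex)
  have "c None \<noteq> 0"
  proof
    assume 0: "c None = 0"
    then have "\<forall>i\<in>I. c (Some i) = 0" using kernel[of "\<lambda>i. c (Some i)"] sum by simp
    then show False using c(2) 0 by auto
  qed
  let ?b = "\<lambda>i. - c (Some i) / c None"
  have "(\<Sum>i\<in>I. ?b i * M i j) = r j" if "j \<in> J" for j
  proof -
    have "(\<Sum>i\<in>I. ?b i * M i j) = - (\<Sum>i\<in>I. c (Some i) * M i j) / c None"
      by (simp add: sum_negf sum_divide_distrib)
    also have "- (\<Sum>i\<in>I. c (Some i) * M i j) = c None * r j"
      using sum[OF that] by (intro minus_unique) (simp add: add.commute)
    finally show ?thesis using \<open>c None \<noteq> 0\<close> by simp
  qed
  moreover have "\<forall>i\<in>I. ?b i \<in> F" using c(1) by (auto intro!: is_subfield_closed[OF F])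
  ultimately show ?thesis by (intro exI[of _ ?b]) blast
qed

section \<open>Operators of bounded order are determined by symmetric polynomials\<close>

lemma is_subfield_ratfuns: "is_subfield (ratfuns n)"
  by (simp add: is_subfield_def ratfuns_add ratfuns_mult ratfuns_minus ratfuns_inverse ratfuns_pol)

lemma finite_multi_indices: "finite (multi_indices n m)"
proof (rule finite_subset)
  show "multi_indices n m \<subseteq> {f. \<forall>i. (i \<in> {..<n} \<longrightarrow> f i \<in> {..m}) \<and> (i \<notin> {..<n} \<longrightarrow> f i = 0)}"
  proof
    fix \<gamma> assume g: "\<gamma> \<in> multi_indices n m"
    have "\<gamma> i \<le> m" if "i < n" for i
      using member_le_sum[of i "{..<n}" \<gamma>] that g by (auto simp: multi_indices_def)
    then show "\<gamma> \<in> {f. \<forall>i. (i \<in> {..<n} \<longrightarrow> f i \<in> {..m}) \<and> (i \<notin> {..<n} \<longrightarrow> f i = 0)}"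
      using g by (auto simp: multi_indices_def)
  qed
qed (rule finite_set_of_finite_funs, auto)

text \<open>
  The partition of \<open>\<gamma>\<close> has the parts \<open>\<gamma> i + \<dots> + \<gamma> (n - 1)\<close>; its largest part is \<open>|\<gamma>|\<close>.
\<close>

lemma card_multi_indices: "card (multi_indices n m) = card (box_partitions n m)"
proof -
  let ?f = "\<lambda>\<gamma>. Abs_poly_mapping (\<lambda>i. \<Sum>j\<in>{i..<n}. \<gamma> j) :: nat \<Rightarrow>\<^sub>0 nat"
  let ?g = "\<lambda>e i. Poly_Mapping.lookup e i - Poly_Mapping.lookup e (Suc i)"
  have lookup_f: "Poly_Mapping.lookup (?f \<gamma>) = (\<lambda>i. \<Sum>j\<in>{i..<n}. \<gamma> j)" for \<gamma> :: "nat \<Rightarrow> nat"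
  proof (rule lookup_Abs_poly_mapping)
    have "{i. (\<Sum>j\<in>{i..<n}. \<gamma> j) \<noteq> 0} \<subseteq> {..<n}" by (auto intro: ccontr)
    then show "finite {i. (\<Sum>j\<in>{i..<n}. \<gamma> j) \<noteq> 0}" by (rule finite_subset) simp
  qed
  have tele: "(\<Sum>j\<in>{i..<n}. ?g e j) = Poly_Mapping.lookup e i" if e: "e \<in> box_partitions n m" for e i
  proof -
    have keys: "Poly_Mapping.keys e \<subseteq> {..<n}" and anti: "antimono (Poly_Mapping.lookup e)"
      using e by (auto simp: box_partitions_def)
    show ?thesis
    proof (cases "i \<le> n")
      case True
      then show ?thesis
      proof (induction rule: inc_induct)
        case base
        then show ?case using keys by (simp add: lookup_beyond)
      next
        case (step i)
        have "Poly_Mapping.lookup e (Suc i) \<le> Poly_Mapping.lookup e i" using anti by (rule antimonoD) simp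
        then show ?case using step by (simp add: sum.atLeast_Suc_lessThan)
      qed
    qed (use keys in \<open>simp add: lookup_beyond\<close>)
  qed
  have "bij_betw ?f (multi_indices n m) (box_partitions n m)"
  proof (rule bij_betw_byWitness[where f' = ?g])
    show "\<forall>\<gamma>\<in>multi_indices n m. ?g (?f \<gamma>) = \<gamma>"
    proof (intro ballI ext)
      fix \<gamma> i assume "\<gamma> \<in> multi_indices n m"
      then show "?g (?f \<gamma>) i = \<gamma> i"
        unfolding lookup_f by (cases "i < n") (auto simp: multi_indices_def sum.atLeast_Suc_lessThan)
    qed
    show "\<forall>e\<in>box_partitions n m. ?f (?g e) = e"
      by (intro ballI poly_mapping_eqI) (simp add: lookup_f tele)
    show "?f ` multi_indices n m \<subseteq> box_partitions n m"
    proof (rule image_subsetI)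
      fix \<gamma> assume g: "\<gamma> \<in> multi_indices n m"
      have "antimono (\<lambda>i. \<Sum>j\<in>{i..<n}. \<gamma> j)" by (intro antimonoI sum_mono2) auto
      moreover have "Poly_Mapping.keys (?f \<gamma>) \<subseteq> {..<n}" by (auto simp: in_keys_iff lookup_f intro: ccontr)
      ultimately show "?f \<gamma> \<in> box_partitions n m"
        using g by (simp add: box_partitions_def lookup_f multi_indices_def atLeast0LessThan)
    qed
    show "?g ` box_partitions n m \<subseteq> multi_indices n m"
    proof (rule image_subsetI)
      fix e assume e: "e \<in> box_partitions n m"
      then have "(\<Sum>i<n. ?g e i) \<le> m" using tele[OF e, of 0] by (simp add: box_partitions_def atLeast0LessThan)
      moreover have "\<forall>i\<ge>n. ?g e i = 0" using e by (auto simp: box_partitions_def lookup_beyond)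
      ultimately show "?g e \<in> multi_indices n m" by (simp add: multi_indices_def)
    qed
  qed
  then show ?thesis by (rule bij_betw_same_card)
qed

lemma indet_q_power_inj: "indet_q ^ a = indet_q ^ b \<longleftrightarrow> a = b"
proof
  assume "indet_q ^ a = indet_q ^ b"
  then have "monom (monom 1 a) 0 = (monom (monom 1 b) 0 :: rat poly poly)"
    using indet_monom[of a 0] indet_monom[of b 0] by (simp del: monom_eq_iff)
  then have "(monom 1 a :: rat poly) = monom 1 b" by (simp del: monom_eq_iff add: monom_eq_iff[of _ 0])
  then show "a = b" by (metis degree_monom_eq zero_neq_one)
qed simp

text \<open>
  Expand \<open>\<Prod>\<^sub>i C(y\<^sub>i)\<close> into monomials \<open>y\<^sup>e\<close>.  The coefficient \<open>\<Prod>\<^sub>i C\<^bsub>e i\<^esub>\<close> is symmetric in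
  \<open>e\<close>, so the expansion is a combination of symmetrized monomials in \<open>y\<close>.  The coefficients of \<open>C\<close>
  involve \<open>x\<close> and are not shifted, so the operator cannot be applied to the product
  itself; the argument uses linearity in the values of the operator on monomials.
\<close>

lemma qdiff_vanishes_on_products:
  fixes C :: "ratfun poly"
  assumes vanish: "\<And>e. Poly_Mapping.keys e \<subseteq> {..<n} \<Longrightarrow> (\<And>i. Poly_Mapping.lookup e i \<le> m) \<Longrightarrow>
      (\<Sum>\<gamma>\<in>G. b \<gamma> * multi_qshift n \<gamma> (symmetrized_monom n e)) = 0"
    and C: "degree C \<le> m"
  shows "(\<Sum>\<gamma>\<in>G. b \<gamma> * (\<Prod>i<n. poly C (const (indet_q ^ \<gamma> i) * var i))) = 0"
proof -
  let ?L = "\<lambda>f. \<Sum>\<gamma>\<in>G. b \<gamma> * multi_qshift n \<gamma> f"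
  let ?E = "PiE {..<n} (\<lambda>_. {..m})"
  let ?x = "\<lambda>e::nat \<Rightarrow> nat. \<Prod>i<n. var i ^ e i" and ?C = "\<lambda>e. \<Prod>i<n. coeff C (e i)"
  let ?W = "{w. w permutes {..<n}}"
  have L_sum: "?L (\<Sum>w\<in>A. f w) = (\<Sum>w\<in>A. ?L (f w))" for A and f :: "(nat \<Rightarrow> nat) \<Rightarrow> ratfun"
    by (subst sum.swap) (simp add: khom_sum[OF khom_multi_qshift] sum_distrib_left)
  \<comment> \<open>Averaging over all permutations costs only the factor n!, as the sum over e is invariant.\<close>
  have reindex: "(\<Sum>e\<in>?E. ?C e * ?L (perm_act w (?x e))) = (\<Sum>e\<in>?E. ?C e * ?L (?x e))" if w: "w \<in> ?W" for w
  proof -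
    have w: "w permutes {..<n}" "inv w permutes {..<n}" using w permutes_inv by auto
    have bij: "bij_betw (\<lambda>e. e \<circ> inv w) ?E ?E"
    proof (rule bij_betw_byWitness[where f' = "\<lambda>e. e \<circ> w"])
      have *: "(\<lambda>e. e \<circ> v) ` ?E \<subseteq> ?E" if "v permutes {..<n}" for v
        using permutes_in_image[OF that] permutes_not_in[OF that]
        by (fastforce simp: PiE_iff extensional_def)
      show "(\<lambda>e. e \<circ> inv w) ` ?E \<subseteq> ?E" "(\<lambda>e. e \<circ> w) ` ?E \<subseteq> ?E" using * w by blast+
    qed (auto simp: comp_assoc permutes_inv_o[OF w(1)])
    have "?C (e \<circ> inv w) * ?L (?x (e \<circ> inv w)) = ?C e * ?L (perm_act w (?x e))" for e
    proof -
      have "?C (e \<circ> inv w) = ?C e"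
        using prod.permute[OF w(2), of "\<lambda>i. coeff C (e i)"] by (simp add: o_def)
      moreover have "perm_act w (?x e) = (\<Prod>i<n. var (w i) ^ e i)"
        by (simp add: khom_prod[OF khom_perm_act_permutes[OF w(1)]]
            khom_power[OF khom_perm_act_permutes[OF w(1)]] perm_act_var)
      moreover have "\<dots> = ?x (e \<circ> inv w)"
        using prod.permute[OF w(1), of "\<lambda>i. var i ^ e (inv w i)"] permutes_inverses[OF w(1)]
        by (simp add: o_def)
      ultimately show ?thesis by simp
    qed
    then show ?thesis using sum.reindex_bij_betw[OF bij, of "\<lambda>e. ?C e * ?L (?x e)"] by simp
  qed
  have sym: "(\<Sum>w\<in>?W. ?L (perm_act w (?x e))) = 0" if e: "e \<in> ?E" for e
  proof -
    define d where "d = Abs_poly_mapping (\<lambda>i. if i < n then e i else 0)"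
    have "finite {i. (if i < n then e i else 0) \<noteq> 0}"
      by (rule finite_subset[of _ "{..<n}"]) auto
    then have d: "Poly_Mapping.lookup d = (\<lambda>i. if i < n then e i else 0)"
      unfolding d_def by (rule lookup_Abs_poly_mapping)
    have keys: "Poly_Mapping.keys d \<subseteq> {..<n}" by (auto simp: in_keys_iff d split: if_splits)
    then have "monom_eval var d = ?x e"
      by (subst monom_eval_superset[of "{..<n}"]) (simp_all add: d)
    moreover have "Poly_Mapping.lookup d i \<le> m" for i using e by (auto simp: d)
    ultimately show ?thesis
      using vanish[OF keys] L_sum[of "\<lambda>w. perm_act w (?x e)" ?W] by (simp add: symmetrized_monom_def)
  qed
  have "of_nat (card ?W) * (\<Sum>e\<in>?E. ?C e * ?L (?x e)) = (\<Sum>w\<in>?W. \<Sum>e\<in>?E. ?C e * ?L (perm_act w (?x e)))"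
    using reindex by simp
  also have "\<dots> = (\<Sum>e\<in>?E. ?C e * (\<Sum>w\<in>?W. ?L (perm_act w (?x e))))"
    by (subst sum.swap) (simp add: sum_distrib_left)
  also have "\<dots> = 0" using sym by simp
  finally have "of_nat (card ?W) * (\<Sum>e\<in>?E. ?C e * ?L (?x e)) = 0" .
  moreover have "card ?W \<noteq> 0" using card_permutations[of "{..<n}" n] by simp
  ultimately have "(\<Sum>e\<in>?E. ?C e * ?L (?x e)) = 0" by (simp add: of_nat_ratfun_eq_0_iff)
  moreover have "(\<Sum>e\<in>?E. ?C e * ?L (?x e)) = (\<Sum>\<gamma>\<in>G. b \<gamma> * (\<Prod>i<n. poly C (const (indet_q ^ \<gamma> i) * var i)))"
  proof -
    have *: "(\<Prod>i<n. poly C (y i)) = (\<Sum>e\<in>?E. ?C e * (\<Prod>i<n. y i ^ e i))" for y :: "nat \<Rightarrow> ratfun"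
    proof -
      have "poly C z = (\<Sum>a\<le>m. coeff C a * z ^ a)" for z
        unfolding poly_altdef using C by (intro sum.mono_neutral_left) (auto simp: coeff_eq_0)
      then have "(\<Prod>i<n. poly C (y i)) = (\<Prod>i<n. \<Sum>a\<le>m. coeff C a * y i ^ a)" by simp
      also have "\<dots> = (\<Sum>e\<in>?E. \<Prod>i<n. coeff C (e i) * y i ^ e i)"
        by (rule prod_sum_PiE) auto
      finally show ?thesis by (simp add: prod.distrib)
    qed
    have "multi_qshift n \<gamma> (?x e) = (\<Prod>i<n. (const (indet_q ^ \<gamma> i) * var i) ^ e i)" for \<gamma> e
      by (simp add: khom_prod[OF khom_multi_qshift] khom_power[OF khom_multi_qshift] multi_qshift_var)
    then show ?thesis unfolding *
      by (simp add: sum_distrib_left, subst sum.swap, simp add: mult_ac)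
  qed
  ultimately show ?thesis by simp
qed

text \<open>
  Interpolation: \<open>C(q\<^bsup>\<gamma> i\<^esup> x\<^sub>i)\<close> vanishes exactly if \<open>\<gamma> i < \<delta> i\<close>, because
  \<open>q\<^bsup>\<gamma> i\<^esup> x\<^sub>i = q\<^sup>k x\<^sub>j\<close> forces \<open>i = j\<close> and \<open>\<gamma> i = k\<close>.  The degree of \<open>C\<close> is \<open>|\<delta>| \<le> m\<close>.
\<close>

lemma qdiff_coefficients_eq_0:
  assumes vanish: "\<And>e. Poly_Mapping.keys e \<subseteq> {..<n} \<Longrightarrow> (\<And>i. Poly_Mapping.lookup e i \<le> m) \<Longrightarrow>
      (\<Sum>\<gamma>\<in>multi_indices n m. b \<gamma> * multi_qshift n \<gamma> (symmetrized_monom n e)) = 0"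
  shows "\<forall>\<gamma>\<in>multi_indices n m. b \<gamma> = 0"
proof (rule ccontr)
  let ?G = "multi_indices n m" and ?s = "\<lambda>\<gamma>::nat \<Rightarrow> nat. \<Sum>i<n. \<gamma> i"
  assume "\<not> (\<forall>\<gamma>\<in>?G. b \<gamma> = 0)"
  then have ne: "{\<gamma> \<in> ?G. b \<gamma> \<noteq> 0} \<noteq> {}" by blast
  have fin: "finite {\<gamma> \<in> ?G. b \<gamma> \<noteq> 0}" using finite_multi_indices by simp
  obtain \<delta> where \<delta>: "\<delta> \<in> ?G" "b \<delta> \<noteq> 0" and max: "\<And>\<gamma>. \<gamma> \<in> ?G \<Longrightarrow> b \<gamma> \<noteq> 0 \<Longrightarrow> ?s \<gamma> \<le> ?s \<delta>"
  proof -
    have "Max (?s ` {\<gamma> \<in> ?G. b \<gamma> \<noteq> 0}) \<in> ?s ` {\<gamma> \<in> ?G. b \<gamma> \<noteq> 0}"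
      using fin ne by (intro Max_in) auto
    then obtain \<delta> where "\<delta> \<in> {\<gamma> \<in> ?G. b \<gamma> \<noteq> 0}" "?s \<delta> = Max (?s ` {\<gamma> \<in> ?G. b \<gamma> \<noteq> 0})" by force
    then show ?thesis using that[of \<delta>] fin by auto
  qed
  let ?y = "\<lambda>\<gamma> i. const (indet_q ^ \<gamma> i) * var i"
  define C where "C = (\<Prod>j<n. \<Prod>k<\<delta> j. [:- (const (indet_q ^ k) * var j), 1:])"
  have "degree C = ?s \<delta>"
    unfolding C_def by (simp add: degree_prod_sum_eq)
  then have degC: "degree C \<le> m" using \<delta>(1) by (simp add: multi_indices_def)
  have polyC: "poly C z = (\<Prod>j<n. \<Prod>k<\<delta> j. z - const (indet_q ^ k) * var j)" for z
    by (simp add: C_def poly_prod)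
  have y_eq: "?y \<gamma> i = const (indet_q ^ k) * var j \<longleftrightarrow> i = j \<and> \<gamma> i = k" for \<gamma> i j k
    using scaled_var_eq_iff[of "indet_q ^ \<gamma> i" i "indet_q ^ k" j] by (simp add: indet_q_power_inj)
  have C_nz: "poly C (?y \<gamma> i) \<noteq> 0 \<longleftrightarrow> \<delta> i \<le> \<gamma> i" if "i < n" for \<gamma> i
    using that by (auto simp: polyC y_eq not_less)
  have "b \<gamma> * (\<Prod>i<n. poly C (?y \<gamma> i)) = 0" if \<gamma>: "\<gamma> \<in> ?G" "\<gamma> \<noteq> \<delta>" for \<gamma>
  proof (rule ccontr)
    assume "b \<gamma> * (\<Prod>i<n. poly C (?y \<gamma> i)) \<noteq> 0"
    then have "b \<gamma> \<noteq> 0" and le: "\<And>i. i < n \<Longrightarrow> \<delta> i \<le> \<gamma> i" using C_nz by auto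
    then have "?s \<gamma> \<le> ?s \<delta>" using max \<gamma>(1) by blast
    moreover have "?s \<delta> \<le> ?s \<gamma>" using le by (intro sum_mono) auto
    ultimately have "?s \<gamma> = ?s \<delta>" by (rule antisym)
    then have "\<gamma> i = \<delta> i" if "i < n" for i
      using sum_mono_inv[of \<delta> "{..<n}" \<gamma> i] le that by simp
    moreover have "\<gamma> i = \<delta> i" if "\<not> i < n" for i
      using that \<gamma>(1) \<delta>(1) by (simp add: multi_indices_def)
    ultimately show False using \<gamma>(2) by blast
  qed
  then have "(\<Sum>\<gamma>\<in>?G - {\<delta>}. b \<gamma> * (\<Prod>i<n. poly C (?y \<gamma> i))) = 0"
    by (intro sum.neutral) blast
  then have "(\<Sum>\<gamma>\<in>?G. b \<gamma> * (\<Prod>i<n. poly C (?y \<gamma> i))) = b \<delta> * (\<Prod>i<n. poly C (?y \<delta> i))"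
    using \<delta>(1) finite_multi_indices by (simp add: sum.remove[of _ \<delta>])
  moreover have "(\<Sum>\<gamma>\<in>?G. b \<gamma> * (\<Prod>i<n. poly C (?y \<gamma> i))) = 0"
    by (rule qdiff_vanishes_on_products[OF vanish degC])
  ultimately show False using \<delta>(2) C_nz by auto
qed


section \<open>Partitions in a box and integral forms\<close>

text \<open>
  The nonzero parts form an initial segment, so the number of parts is the first index of a zero part.
\<close>

lemma partition_support:
  assumes "is_partition \<mu>"
  shows "\<mu> i = 0 \<longleftrightarrow> part_length \<mu> \<le> i"
proof -
  have anti: "antimono \<mu>" and fin: "finite {i. \<mu> i \<noteq> 0}"
    using assms by (auto simp: is_partition_def)
  define k where "k = (LEAST k. \<mu> k = 0)"
  have "\<exists>k. \<mu> k = 0"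
  proof (rule ccontr)
    assume "\<nexists>k. \<mu> k = 0"
    then have "{i. \<mu> i \<noteq> 0} = UNIV" by auto
    then show False using fin by simp
  qed
  then have "\<mu> k = 0" unfolding k_def by (rule LeastI_ex)
  have *: "\<mu> i = 0 \<longleftrightarrow> k \<le> i" for i
  proof
    assume "\<mu> i = 0"
    then show "k \<le> i" unfolding k_def by (rule Least_le)
  next
    assume "k \<le> i"
    then show "\<mu> i = 0" using antimonoD[OF anti, of k i] \<open>\<mu> k = 0\<close> by simp
  qed
  then have "{i. \<mu> i \<noteq> 0} = {..<k}" by (auto simp: not_le)
  then have "part_length \<mu> = k" by (simp add: part_length_def)
  then show ?thesis using * by simp
qed

lemma box_partitions_iff:
  "(\<exists>e \<in> box_partitions n m. \<mu> = Poly_Mapping.lookup e) \<longleftrightarrow>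
     is_partition \<mu> \<and> part_length \<mu> \<le> n \<and> \<mu> 0 \<le> m"
proof
  assume "\<exists>e \<in> box_partitions n m. \<mu> = Poly_Mapping.lookup e"
  then obtain e where e: "e \<in> box_partitions n m" "\<mu> = Poly_Mapping.lookup e" by blast
  then have part: "is_partition \<mu>" by (simp add: is_partition_def box_partitions_def)
  have "\<mu> n = 0" using e lookup_beyond[of e n n] by (simp add: box_partitions_def)
  then show "is_partition \<mu> \<and> part_length \<mu> \<le> n \<and> \<mu> 0 \<le> m"
    using part partition_support[OF part] e by (simp add: box_partitions_def)
next
  assume \<mu>: "is_partition \<mu> \<and> part_length \<mu> \<le> n \<and> \<mu> 0 \<le> m"
  then have l: "Poly_Mapping.lookup (Abs_poly_mapping \<mu>) = \<mu>"
    by (simp add: is_partition_def)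
  have "\<mu> i = 0" if "n \<le> i" for i using \<mu> partition_support[of \<mu> i] that by simp
  then have "Poly_Mapping.keys (Abs_poly_mapping \<mu>) \<subseteq> {..<n}"
    by (metis in_keys_iff l lessThan_iff not_le subsetI)
  then have "Abs_poly_mapping \<mu> \<in> box_partitions n m"
    using \<mu> by (simp add: box_partitions_def l is_partition_def)
  then show "\<exists>e \<in> box_partitions n m. \<mu> = Poly_Mapping.lookup e" using l by metis
qed

lemma add_row_box_partition:
  assumes "is_partition \<mu>" "part_length \<mu> < n" "\<mu> 0 \<le> m"
  shows "\<exists>e \<in> box_partitions n m. add_row m \<mu> = Poly_Mapping.lookup e"
proof -
  have anti: "antimono (add_row m \<mu>)"
  proof (rule antimonoI)
    fix i j :: nat assume "i \<le> j"
    moreover have "\<mu> k \<le> m" for k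
      using assms(1,3) antimonoD[of \<mu> 0 k] by (auto simp: is_partition_def)
    ultimately show "add_row m \<mu> j \<le> add_row m \<mu> i"
      using assms(1) antimonoD[of \<mu>] unfolding add_row_def is_partition_def
      by (auto split: nat.split)
  qed
  have zero: "add_row m \<mu> i = 0" if "n \<le> i" for i
    using that assms(2) partition_support[OF assms(1)] by (cases i) (auto simp: add_row_def)
  then have "{i. add_row m \<mu> i \<noteq> 0} \<subseteq> {..<n}"
    by (metis (mono_tags, lifting) lessThan_iff mem_Collect_eq not_le subsetI)
  then have part: "is_partition (add_row m \<mu>)"
    using anti finite_subset[of _ "{..<n}"] by (simp add: is_partition_def)
  have "part_length (add_row m \<mu>) \<le> n" using partition_support[OF part, of n] zero by simp
  then show ?thesis using part box_partitions_iff[of n m "add_row m \<mu>"] by (simp add: add_row_def)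
qed

lemma macdonald_J_symmetric_pols:
  assumes "e \<in> box_partitions n m"
  shows "macdonald_J n (Poly_Mapping.lookup e) \<in> symmetric_pols n"
  using is_macdonald_P_macdonald_P[OF assms]
  unfolding is_macdonald_P_iff macdonald_J_def by (intro symmetric_pols_const_mult) blast

text \<open>
  Every factor is nonzero because \<open>q\<^sup>a t\<^bsup>l+1\<^esup>\<close> has positive degree in \<open>t\<close>.
\<close>

lemma macdonald_J_factor_nonzero:
  "(\<Prod>s \<in> boxes \<mu>. 1 - indet_q ^ arm \<mu> s * indet_t ^ (leg \<mu> s + 1)) \<noteq> 0"
proof -
  have "indet_q ^ a * indet_t ^ (l + 1) \<noteq> 1" for a l
  proof
    assume "indet_q ^ a * indet_t ^ (l + 1) = 1"
    then have "monom (monom 1 a) (l + 1) = (1 :: rat poly poly)"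
      unfolding indet_monom by (metis to_fract_1 to_fract_eq_iff)
    then have "degree (monom (monom 1 a) (l + 1) :: rat poly poly) = 0" by simp
    then show False by (simp add: degree_monom_eq)
  qed
  then have "1 - indet_q ^ a * indet_t ^ (l + 1) \<noteq> 0" for a l
    by (metis right_minus_eq)
  then show ?thesis
    by (cases "finite (boxes \<mu>)") auto
qed

section \<open>Row-raising operators\<close>

definition row_raising_target :: "nat \<Rightarrow> nat \<Rightarrow> (nat \<Rightarrow> nat) \<Rightarrow> ratfun" where
  "row_raising_target n m \<mu> = (if part_length \<mu> < n then macdonald_J n (add_row m \<mu>) else 0)"

lemma row_raising_iff:
  "row_raising n m B \<longleftrightarrow> (\<forall>e \<in> box_partitions n m.
     B (macdonald_J n (Poly_Mapping.lookup e)) = row_raising_target n m (Poly_Mapping.lookup e))"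
  unfolding row_raising_def row_raising_target_def box_partitions_iff[symmetric] by blast

lemma row_raising_target_symmetric_pols:
  assumes "e \<in> box_partitions n m"
  shows "row_raising_target n m (Poly_Mapping.lookup e) \<in> symmetric_pols n"
proof (cases "part_length (Poly_Mapping.lookup e) < n")
  case True
  then obtain d where "d \<in> box_partitions n m" "add_row m (Poly_Mapping.lookup e) = Poly_Mapping.lookup d"
    using add_row_box_partition[of "Poly_Mapping.lookup e" n m] box_partitions_iff[of n m "Poly_Mapping.lookup e"] assms
    by blast
  then show ?thesis using True macdonald_J_symmetric_pols by (simp add: row_raising_target_def)
qed (simp add: row_raising_target_def)

lemma qdiff_vanishing_on_macdonald_J:
  assumes "\<And>e. e \<in> box_partitions n m \<Longrightarrow>
    (\<Sum>\<gamma>\<in>multi_indices n m. b \<gamma> * multi_qshift n \<gamma> (macdonald_J n (Poly_Mapping.lookup e))) = 0"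
  shows "\<forall>\<gamma>\<in>multi_indices n m. b \<gamma> = 0"
proof (rule qdiff_coefficients_eq_0)
  fix e assume e: "Poly_Mapping.keys e \<subseteq> {..<n}" "\<And>i. Poly_Mapping.lookup e i \<le> m"
  let ?L = "\<lambda>f. \<Sum>\<gamma>\<in>multi_indices n m. b \<gamma> * multi_qshift n \<gamma> f"
  have scale: "?L (const c * f) = const c * ?L f" for c f
    by (simp add: khom_mult[OF khom_multi_qshift] khom_const[OF khom_multi_qshift] sum_distrib_left mult_ac)
  have add: "?L (f + g) = ?L f + ?L g" for f g
    by (simp add: khom_add[OF khom_multi_qshift] distrib_left sum.distrib)
  have "?L (to_fract (macdonald_P n (Poly_Mapping.lookup d))) = 0" if "d \<in> box_partitions n m" for d
    using assms[OF that] macdonald_J_factor_nonzero[of "Poly_Mapping.lookup d"]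
    unfolding macdonald_J_def scale by (simp only: mult_eq_0_iff const_eq_0_iff simp_thms)
  then show "?L (symmetrized_monom n e) = 0"
    by (intro functional_vanishes_on_symmetrized_monom[of ?L, OF add scale _ e])
qed

lemma symmetric_pols_ratfuns: "f \<in> symmetric_pols n \<Longrightarrow> f \<in> ratfuns n"
  by (simp add: symmetric_pols_def ratfuns_pol)

lemma row_raising_exists: "\<exists>B. is_qdiff_operator n m B \<and> row_raising n m B"
proof -
  let ?M = "\<lambda>\<gamma> e. multi_qshift n \<gamma> (macdonald_J n (Poly_Mapping.lookup e))"
  have "\<exists>b. (\<forall>\<gamma>\<in>multi_indices n m. b \<gamma> \<in> ratfuns n) \<and>
    (\<forall>e\<in>box_partitions n m. (\<Sum>\<gamma>\<in>multi_indices n m. b \<gamma> * ?M \<gamma> e) = row_raising_target n m (Poly_Mapping.lookup e))"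
  proof (rule square_system_solvable[OF is_subfield_ratfuns finite_multi_indices finite_box_partitions card_multi_indices])
    fix \<gamma> e assume "e \<in> box_partitions n m"
    then show "?M \<gamma> e \<in> ratfuns n"
      using macdonald_J_symmetric_pols[of e n m]
      by (intro ratfuns_pol multi_qshift_pol) (simp add: symmetric_pols_def)
  next
    fix e assume "e \<in> box_partitions n m"
    then show "row_raising_target n m (Poly_Mapping.lookup e) \<in> ratfuns n"
      by (intro symmetric_pols_ratfuns row_raising_target_symmetric_pols)
  qed (rule qdiff_vanishing_on_macdonald_J)
  then obtain b where b: "\<forall>\<gamma>\<in>multi_indices n m. b \<gamma> \<in> ratfuns n"
    "\<forall>e\<in>box_partitions n m. (\<Sum>\<gamma>\<in>multi_indices n m. b \<gamma> * ?M \<gamma> e) = row_raising_target n m (Poly_Mapping.lookup e)"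
    by blast
  let ?B = "\<lambda>f. \<Sum>\<gamma>\<in>multi_indices n m. b \<gamma> * multi_qshift n \<gamma> f"
  have "is_qdiff_operator n m ?B" using b(1) unfolding is_qdiff_operator_def by blast
  moreover have "row_raising n m ?B" using b(2) unfolding row_raising_iff by blast
  ultimately show ?thesis by blast
qed

lemma row_raising_unique:
  assumes "is_qdiff_operator n m B" "row_raising n m B" "is_qdiff_operator n m B'" "row_raising n m B'"
  shows "B = B'"
proof -
  obtain b where b: "B = (\<lambda>f. \<Sum>\<gamma>\<in>multi_indices n m. b \<gamma> * multi_qshift n \<gamma> f)"
    using assms(1) unfolding is_qdiff_operator_def by blast
  obtain b' where b': "B' = (\<lambda>f. \<Sum>\<gamma>\<in>multi_indices n m. b' \<gamma> * multi_qshift n \<gamma> f)"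
    using assms(3) unfolding is_qdiff_operator_def by blast
  have "\<forall>\<gamma>\<in>multi_indices n m. b \<gamma> - b' \<gamma> = 0"
  proof (rule qdiff_vanishing_on_macdonald_J)
    fix e assume e: "e \<in> box_partitions n m"
    have "B (macdonald_J n (Poly_Mapping.lookup e)) = B' (macdonald_J n (Poly_Mapping.lookup e))"
      using assms(2,4) e by (simp add: row_raising_iff)
    then show "(\<Sum>\<gamma>\<in>multi_indices n m. (b \<gamma> - b' \<gamma>) * multi_qshift n \<gamma> (macdonald_J n (Poly_Mapping.lookup e))) = 0"
      unfolding b b' by (simp add: left_diff_distrib sum_subtractf)
  qed
  then show ?thesis unfolding b b' by (intro ext sum.cong) auto
qed

lemma multi_indices_compose:
  assumes "w permutes {..<n}" "\<gamma> \<in> multi_indices n m"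
  shows "\<gamma> \<circ> w \<in> multi_indices n m"
  using assms(2) sum.permute[OF assms(1), of \<gamma>] permutes_not_in[OF assms(1)]
  by (simp add: multi_indices_def)

text \<open>
  Conjugation by \<open>w\<close> turns \<open>b\<^sub>\<gamma> T\<^sup>\<gamma>\<close> into \<open>w(b\<^sub>\<gamma>) T\<^bsup>\<gamma> \<circ> inv w\<^esup>\<close>, which does not
  change the order.
\<close>

lemma is_qdiff_operator_conjugate:
  assumes B: "is_qdiff_operator n m B" and w: "w permutes {..<n}"
  shows "is_qdiff_operator n m (perm_act w \<circ> B \<circ> perm_act (inv w))"
proof -
  note k = khom_perm_act_permutes[OF w]
  note w' = permutes_inv[OF w]
  obtain b where b: "\<forall>\<gamma>\<in>multi_indices n m. b \<gamma> \<in> ratfuns n"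
    "B = (\<lambda>f. \<Sum>\<gamma>\<in>multi_indices n m. b \<gamma> * multi_qshift n \<gamma> f)"
    using B unfolding is_qdiff_operator_def by blast
  let ?b = "\<lambda>\<gamma>. perm_act w (b (\<gamma> \<circ> w))"
  have bij: "bij_betw (\<lambda>\<gamma>. \<gamma> \<circ> inv w) (multi_indices n m) (multi_indices n m)"
    by (rule bij_betw_byWitness[where f' = "\<lambda>\<gamma>. \<gamma> \<circ> w"])
       (auto simp: comp_assoc permutes_inv_o[OF w] intro: multi_indices_compose[OF w] multi_indices_compose[OF w'])
  have "(perm_act w \<circ> B \<circ> perm_act (inv w)) f = (\<Sum>\<gamma>\<in>multi_indices n m. ?b \<gamma> * multi_qshift n \<gamma> f)" for f
  proof -
    have "perm_act w (perm_act (inv w) f) = f"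
      by (simp add: perm_act_comp permutes_bij[OF w] permutes_bij[OF w'] permutes_inv_o[OF w])
    then have "(perm_act w \<circ> B \<circ> perm_act (inv w)) f =
        (\<Sum>\<gamma>\<in>multi_indices n m. perm_act w (b \<gamma>) * multi_qshift n (\<gamma> \<circ> inv w) f)"
      by (simp add: b(2) khom_sum[OF k] khom_mult[OF k] perm_act_multi_qshift[OF w])
    also have "\<dots> = (\<Sum>\<gamma>\<in>multi_indices n m. ?b (\<gamma> \<circ> inv w) * multi_qshift n (\<gamma> \<circ> inv w) f)"
      by (simp add: comp_assoc permutes_inv_o[OF w])
    also have "\<dots> = (\<Sum>\<gamma>\<in>multi_indices n m. ?b \<gamma> * multi_qshift n \<gamma> f)"
      by (rule sum.reindex_bij_betw[OF bij])
    finally show ?thesis .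
  qed
  moreover have "?b \<gamma> \<in> ratfuns n" if "\<gamma> \<in> multi_indices n m" for \<gamma>
    by (rule khom_ratfuns[OF k, of n])
      (use b(1) multi_indices_compose[OF w that] permutes_in_image[OF w] in \<open>auto simp: perm_act_var intro: pol_var\<close>)
  ultimately show ?thesis
    unfolding is_qdiff_operator_def by (intro exI[of _ ?b]) auto
qed

lemma row_raising_conjugate:
  assumes "row_raising n m B" and w: "w permutes {..<n}"
  shows "row_raising n m (perm_act w \<circ> B \<circ> perm_act (inv w))"
  unfolding row_raising_iff
proof
  fix e assume e: "e \<in> box_partitions n m"
  have "perm_act (inv w) (macdonald_J n (Poly_Mapping.lookup e)) = macdonald_J n (Poly_Mapping.lookup e)"
    using macdonald_J_symmetric_pols[OF e] permutes_inv[OF w]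
    by (simp add: symmetric_pols_def symmetric_fun_def)
  moreover have "perm_act w (row_raising_target n m (Poly_Mapping.lookup e)) = row_raising_target n m (Poly_Mapping.lookup e)"
    using row_raising_target_symmetric_pols[OF e] w
    by (simp add: symmetric_pols_def symmetric_fun_def)
  ultimately show "(perm_act w \<circ> B \<circ> perm_act (inv w)) (macdonald_J n (Poly_Mapping.lookup e))
      = row_raising_target n m (Poly_Mapping.lookup e)"
    using assms(1) e by (simp add: row_raising_iff)
qed

theorem theorem1p1:
  fixes n m :: nat
  assumes "n \<ge> 1"
  shows "(\<exists>!B. is_qdiff_operator n m B \<and> row_raising n m B) \<and>
         (\<forall>B. is_qdiff_operator n m B \<and> row_raising n m B \<longrightarrow> perm_invariant n B)"
proof (intro conjI allI impI)
  show "\<exists>!B. is_qdiff_operator n m B \<and> row_raising n m B"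
    using row_raising_exists row_raising_unique by blast
next
  fix B assume "is_qdiff_operator n m B \<and> row_raising n m B"
  then show "perm_invariant n B"
    unfolding perm_invariant_def
    using row_raising_unique is_qdiff_operator_conjugate row_raising_conjugate by blast
qed

end
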